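(* Let $K>0$, $\varepsilon>0$, and let $x\in\mathbb{C}$ with $|x|<1$. Let $(h(t))_{t\ge0}$ be the solution of the stochastic differential equation $$dh=K(1-h^2)\,dt+\sqrt2\,i\,\varepsilon\,h\circ dW$$ with $h(0)=x$ almost surely. Then $$\lim_{t\to+\infty}|h(t)|=1\quad\text{almost surely.}$$
   Context: $W$ is a one-dimensional real Brownian motion with respect to a complete filtration $\{\mathcal{F}_t\}_{t\ge0}$ on a probability space $(\Omega,\mathcal{F},\mathbb{P})$; $\circ$ denotes the Stratonovich product; $h$ is complex-valued. For initial data with $|h(0)|\le1$ the equation has a unique global adapted continuous solution. *)

theory Defs
  imports "HOL-Probability.Probability"
begin

text \<open>
  Processes are functions \<open>X :: real \<Rightarrow> 'a \<Rightarrow> 'b\<close> of time and outcome; only times \<open>t \<ge> 0\<close> matter.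
  The library's \<^locale>\<open>filtration\<close> is indexed by all reals here. A filtration given on \<open>[0, \<infinity>)\<close>
  extends to it by \<open>F t = F 0\<close> for \<open>t < 0\<close>, and no definition below depends on the values at
  negative times.
\<close>

locale complete_filtered_prob_space =
  prob_space M + complete_measure M + filtration "space M" F
  for M :: "'a measure" and F :: "real \<Rightarrow> 'a measure" +
  assumes subalgebra_F: "t \<ge> 0 \<Longrightarrow> subalgebra M (F t)"
    and null_sets_F: "null_sets M \<subseteq> sets (F 0)"

definition adapted :: "(real \<Rightarrow> 'a measure) \<Rightarrow> (real \<Rightarrow> 'a \<Rightarrow> 'b::topological_space) \<Rightarrow> bool" where
  "adapted F X \<longleftrightarrow> (\<forall>t\<ge>0. X t \<in> borel_measurable (F t))"

definition continuous_process ::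
  "'a measure \<Rightarrow> (real \<Rightarrow> 'a \<Rightarrow> 'b::topological_space) \<Rightarrow> bool" where
  "continuous_process M X \<longleftrightarrow> (AE \<omega> in M. continuous_on {0..} (\<lambda>t. X t \<omega>))"

definition brownian_motion ::
  "'a measure \<Rightarrow> (real \<Rightarrow> 'a measure) \<Rightarrow> (real \<Rightarrow> 'a \<Rightarrow> real) \<Rightarrow> bool" where
  "brownian_motion M F W \<longleftrightarrow>
     adapted F W \<and> continuous_process M W \<and> (AE \<omega> in M. W 0 \<omega> = 0) \<and>
     (\<forall>s t. 0 \<le> s \<and> s < t \<longrightarrow>
        distributed M lborel (\<lambda>\<omega>. W t \<omega> - W s \<omega>) (\<lambda>x. ennreal (normal_density 0 (sqrt (t - s)) x)) \<and>
        prob_space.indep_set M (sets (F s))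
          (sets (vimage_algebra (space M) (\<lambda>\<omega>. W t \<omega> - W s \<omega>) borel)))"

definition martingale ::
  "'a measure \<Rightarrow> (real \<Rightarrow> 'a measure) \<Rightarrow> (real \<Rightarrow> 'a \<Rightarrow> real) \<Rightarrow> bool" where
  "martingale M F X \<longleftrightarrow>
     adapted F X \<and> (\<forall>t\<ge>0. integrable M (X t)) \<and>
     (\<forall>s t. 0 \<le> s \<and> s \<le> t \<longrightarrow> (AE \<omega> in M. real_cond_exp M (F s) (X t) \<omega> = X s \<omega>))"

text \<open>
  The localizing stopping times are finite. This is no restriction: if stopping times \<open>T n\<close> with
  values in \<open>[0, \<infinity>]\<close> localize \<open>X\<close>, then so do the times \<open>min (T n) n\<close>.
\<close>

definition continuous_local_martingale ::
  "'a measure \<Rightarrow> (real \<Rightarrow> 'a measure) \<Rightarrow> (real \<Rightarrow> 'a \<Rightarrow> real) \<Rightarrow> bool" where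
  "continuous_local_martingale M F X \<longleftrightarrow>
     adapted F X \<and> continuous_process M X \<and>
     (\<exists>T :: nat \<Rightarrow> 'a \<Rightarrow> real.
        (\<forall>n. stopping_time F (T n) \<and> (\<forall>\<omega>\<in>space M. 0 \<le> T n \<omega>)) \<and>
        (AE \<omega> in M. incseq (\<lambda>n. T n \<omega>) \<and> filterlim (\<lambda>n. T n \<omega>) at_top sequentially) \<and>
        (\<forall>n. martingale M F (\<lambda>t \<omega>. X (min t (T n \<omega>)) \<omega> - X 0 \<omega>)))"

text \<open>The points \<open>p 0 \<le> \<dots> \<le> p n\<close> form a partition of \<open>[0, t]\<close>.\<close>

definition is_partition :: "real \<Rightarrow> nat \<Rightarrow> (nat \<Rightarrow> real) \<Rightarrow> bool" where
  "is_partition t n p \<longleftrightarrow> p 0 = 0 \<and> p n = t \<and> (\<forall>i<n. p i \<le> p (Suc i))"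

definition continuous_finite_variation_process ::
  "'a measure \<Rightarrow> (real \<Rightarrow> 'a measure) \<Rightarrow> (real \<Rightarrow> 'a \<Rightarrow> real) \<Rightarrow> bool" where
  "continuous_finite_variation_process M F A \<longleftrightarrow>
     adapted F A \<and> continuous_process M A \<and>
     (AE \<omega> in M. \<forall>t\<ge>0. \<exists>B. \<forall>n p. is_partition t n p \<longrightarrow>
        (\<Sum>i<n. \<bar>A (p (Suc i)) \<omega> - A (p i) \<omega>\<bar>) \<le> B)"

definition continuous_semimartingale ::
  "'a measure \<Rightarrow> (real \<Rightarrow> 'a measure) \<Rightarrow> (real \<Rightarrow> 'a \<Rightarrow> real) \<Rightarrow> bool" where
  "continuous_semimartingale M F X \<longleftrightarrow>
     adapted F X \<and> continuous_process M X \<and>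
     (\<exists>N A. continuous_local_martingale M F N \<and> continuous_finite_variation_process M F A \<and>
        (AE \<omega> in M. \<forall>t\<ge>0. X t \<omega> = N t \<omega> + A t \<omega>))"

definition continuous_complex_semimartingale ::
  "'a measure \<Rightarrow> (real \<Rightarrow> 'a measure) \<Rightarrow> (real \<Rightarrow> 'a \<Rightarrow> complex) \<Rightarrow> bool" where
  "continuous_complex_semimartingale M F X \<longleftrightarrow>
     continuous_semimartingale M F (\<lambda>t \<omega>. Re (X t \<omega>)) \<and>
     continuous_semimartingale M F (\<lambda>t \<omega>. Im (X t \<omega>))"

text \<open>
  The Stratonovich integral \<open>\<integral>\<^sub>0\<^sup>t X \<circ> dW\<close> of a continuous complex semimartingale: the limit in
  probability, as the mesh of the partition tends to \<open>0\<close>, of the trapezoidal sums.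
\<close>

definition trapezoidal_sum ::
  "(real \<Rightarrow> 'a \<Rightarrow> complex) \<Rightarrow> (real \<Rightarrow> 'a \<Rightarrow> real) \<Rightarrow> nat \<Rightarrow> (nat \<Rightarrow> real) \<Rightarrow> 'a \<Rightarrow> complex" where
  "trapezoidal_sum X W n p \<omega> =
     (\<Sum>i<n. (X (p i) \<omega> + X (p (Suc i)) \<omega>) / 2 * complex_of_real (W (p (Suc i)) \<omega> - W (p i) \<omega>))"

definition has_stratonovich_integral ::
  "'a measure \<Rightarrow> (real \<Rightarrow> 'a measure) \<Rightarrow> (real \<Rightarrow> 'a \<Rightarrow> real) \<Rightarrow> (real \<Rightarrow> 'a \<Rightarrow> complex) \<Rightarrow>
   real \<Rightarrow> ('a \<Rightarrow> complex) \<Rightarrow> bool" where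
  "has_stratonovich_integral M F W X t I \<longleftrightarrow>
     continuous_complex_semimartingale M F X \<and> I \<in> borel_measurable M \<and>
     (\<forall>e>0. \<forall>\<eta>>0. \<exists>\<delta>>0. \<forall>n p.
        is_partition t n p \<and> (\<forall>i<n. p (Suc i) - p i < \<delta>) \<longrightarrow>
        measure M {\<omega> \<in> space M. e < dist (trapezoidal_sum X W n p \<omega>) (I \<omega>)} < \<eta>)"

text \<open>
  \<open>h\<close> is a global solution of \<open>dh = b(h) dt + \<sigma>(h) \<circ> dW\<close>. All terms of the integral equation
  have continuous versions in \<open>t\<close>, so it is enough to state it almost surely for each \<open>t\<close>.
\<close>

definition stratonovich_solution ::
  "'a measure \<Rightarrow> (real \<Rightarrow> 'a measure) \<Rightarrow> (real \<Rightarrow> 'a \<Rightarrow> real) \<Rightarrow>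
   (complex \<Rightarrow> complex) \<Rightarrow> (complex \<Rightarrow> complex) \<Rightarrow> (real \<Rightarrow> 'a \<Rightarrow> complex) \<Rightarrow> bool" where
  "stratonovich_solution M F W b \<sigma> h \<longleftrightarrow>
     adapted F h \<and> continuous_process M h \<and>
     (\<exists>I. \<forall>t\<ge>0.
        has_stratonovich_integral M F W (\<lambda>s \<omega>. \<sigma> (h s \<omega>)) t (I t) \<and>
        (AE \<omega> in M. h t \<omega> = h 0 \<omega> + (LINT s:{0..t}|lborel. b (h s \<omega>)) + I t \<omega>))"

end

theory Submission
  imports Defs
begin

text \<open>
  Write \<open>w = sqrt 2 \<epsilon> W\<close>. The Stratonovich equation is equivalent to a pathwise one: \<open>cis (- w) h\<close> is
  continuously differentiable with derivative \<open>cis (- w) K (1 - h\<^sup>2)\<close>. To see this without stochastic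
  calculus, note that the trapezoidal sums converge along all partitions that are fine on some blocks
  and coarse on others, so every subsum of the local errors tends to \<open>0\<close> in probability; randomizing
  the signs shows that the sum of the squared local errors tends to \<open>0\<close> as well. This turns the
  trapezoidal sums into Ito sums of \<open>cis \<Delta>w - 1\<close>, and the defect \<open>D\<close> of the pathwise equation satisfies
  a linear homogeneous Ito equation, so that it vanishes by a Gronwall argument in \<open>L\<^sup>2\<close>.

  Pathwise, \<open>1 - \<bar>h\<bar>\<^sup>2\<close> is multiplied by \<open>exp (- 2 K \<integral> Re h)\<close> and stays positive. For suitable
  \<open>\<beta>, \<gamma>\<close> the generator applied to \<open>ln (1 - \<bar>h\<bar>\<^sup>2) + Re (\<beta> h + \<gamma> h\<^sup>2)\<close> is bounded above by a negative
  constant on the whole disc. Hence for small \<open>a\<close> and small time steps the expectation of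
  \<open>(1 - \<bar>h\<bar>\<^sup>2)\<^sup>a (1 + a Re (\<beta> h + \<gamma> h\<^sup>2))\<close> decays geometrically, so \<open>1 - \<bar>h\<bar>\<^sup>2\<close> tends to \<open>0\<close> almost
  surely along the steps, and it grows by at most a constant factor between them.
\<close>

subsection \<open>Riemann sums and uniform partitions\<close>

text \<open>The hypothesis only provides convergence of trapezoidal sums in probability, at each
  time separately and without a rate; convergence of the bracket of \<open>h\<close> and
  \<open>W\<close>, on which the usual conversion to Ito form rests, is not at hand. The integrator
  \<open>cis \<Delta>w - 1\<close> is dictated by what is explicit about Brownian motion: its
  conditional mean and mean square are exact, and \<open>cis w\<close> itself satisfies the discrete
  equation without error, so that the defect obeys a homogeneous one.

  On the disc the obstacle is that the drift \<open>- 2 K Re h\<close> of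
  \<open>ln (1 - |h|^2)\<close> has no sign. The corrector
  \<open>Re (\<beta> h + \<gamma> h^2)\<close> uses the damping of \<open>h\<close> and
  \<open>h^2\<close> by the random rotation to replace this drift by a negative one. A small power
  \<open>a\<close> takes the place of the logarithm because it is bounded and turns negative drift
  into geometric decay of an expectation, which is summable along the time steps.\<close>

abbreviation grid :: "real \<Rightarrow> nat \<Rightarrow> nat \<Rightarrow> real" where
  "grid t n i \<equiv> real i * t / real n"

lemma integral_uniform_partition:
  fixes f :: "real \<Rightarrow> 'b::banach"
  assumes "f integrable_on {0..t}" "n > 0" "t \<ge> 0" "k \<le> n"
  shows "(\<Sum>i<k. integral {grid t n i..grid t n (Suc i)} f) = integral {0..grid t n k} f"
  using assms(4)
proof (induction k)
  case (Suc k)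
  have le: "grid t n (Suc k) \<le> t"
    using mult_right_mono[of "real (Suc k)" "real n" t] assms Suc by (simp add: divide_simps mult.commute)
  have "f integrable_on {0..grid t n (Suc k)}"
    using assms(1) by (rule integrable_on_subinterval) (use le in auto)
  then have "integral {0..grid t n k} f + integral {grid t n k..grid t n (Suc k)} f
      = integral {0..grid t n (Suc k)} f"
    by (intro Henstock_Kurzweil_Integration.integral_combine) (use assms in \<open>auto simp: divide_simps mult_right_mono\<close>)
  with Suc show ?case by simp
qed auto

lemma uniform_partition_le:
  assumes "(n::nat) > 0" "t \<ge> (0::real)" "i < n"
  shows "0 \<le> grid t n i" "grid t n i \<le> grid t n (Suc i)" "grid t n (Suc i) \<le> t"
        "grid t n i \<le> t" "grid t n (Suc i) - grid t n i = t / real n"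
proof -
  show "grid t n (Suc i) \<le> t"
    using mult_right_mono[of "real (Suc i)" "real n" t] assms by (simp add: divide_simps mult.commute)
  moreover show "grid t n i \<le> grid t n (Suc i)" using assms by (auto simp: divide_simps mult_right_mono)
  ultimately show "grid t n i \<le> t" by simp
qed (use assms in \<open>auto simp: field_simps\<close>)

lemma uniform_oscillation:
  fixes f :: "real \<Rightarrow> 'b::metric_space"
  assumes "continuous_on {0..t} f" "t \<ge> 0" "e > 0"
  shows "\<forall>\<^sub>F n in sequentially. \<forall>i<n. \<forall>r\<in>{grid t n i..grid t n (Suc i)}.
      \<forall>s\<in>{grid t n i..grid t n (Suc i)}. dist (f r) (f s) < e"
proof -
  have "uniformly_continuous_on {0..t} f"
    using assms by (intro compact_uniformly_continuous) auto
  then obtain d where d: "d > 0" "\<And>r s. r \<in> {0..t} \<Longrightarrow> s \<in> {0..t} \<Longrightarrow> dist s r < d \<Longrightarrow> dist (f s) (f r) < e"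
    using assms(3) unfolding uniformly_continuous_on_def by meson
  have "(\<lambda>n. t / real n) \<longlonglongrightarrow> 0" by real_asymp
  then have "\<forall>\<^sub>F n in sequentially. t / real n < d" using d(1) order_tendstoD(2) by blast
  then show ?thesis
    using eventually_gt_at_top[of 0]
  proof eventually_elim
    case (elim n)
    show ?case
    proof (intro allI impI ballI)
      fix i r s assume i: "i < n" and r: "r \<in> {grid t n i..grid t n (Suc i)}"
        and s: "s \<in> {grid t n i..grid t n (Suc i)}"
      note u = uniform_partition_le[OF elim(2) assms(2) i]
      have "dist r s \<le> grid t n (Suc i) - grid t n i"
        using r s unfolding dist_real_def by auto
      also have "\<dots> < d" using u(5) elim(1) by simp
      finally show "dist (f r) (f s) < e" using d(2)[of s r] r s u by auto
    qed
  qed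
qed

text \<open>The integrand may be replaced by a different function on every block, as long as the
  replacement is uniformly close to \<open>f\<close>. Besides Riemann sums this covers sums in which
  only one factor of the integrand is frozen, as in \<open>null_in_prob_D\<close>.\<close>

lemma uniform_partition_sum_tendsto:
  fixes f :: "real \<Rightarrow> 'b::banach" and g :: "nat \<Rightarrow> nat \<Rightarrow> real \<Rightarrow> 'b"
  assumes f: "f integrable_on {0..t}" and t: "t \<ge> 0"
    and osc: "\<And>e. e > 0 \<Longrightarrow> \<forall>\<^sub>F n in sequentially. \<forall>i<n. \<forall>r\<in>{grid t n i..grid t n (Suc i)}.
       norm (g n i r - f r) \<le> e"
    and g: "\<And>n i. i < n \<Longrightarrow> g n i integrable_on {grid t n i..grid t n (Suc i)}"
  shows "(\<lambda>n. \<Sum>i<n. integral {grid t n i..grid t n (Suc i)} (g n i)) \<longlonglongrightarrow> integral {0..t} f"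
proof (rule metric_LIMSEQ_I)
  fix e :: real assume e: "e > 0"
  \<comment> \<open>\<open>t + 1\<close> instead of \<open>t\<close> allows \<open>t = 0\<close>;
    the total error is \<open>e' * t < e\<close>.\<close>
  define e' where "e' = e / (2 * (t + 1))"
  have e': "e' > 0" using e t by (auto simp: e'_def)
  have "\<forall>\<^sub>F n in sequentially. dist (\<Sum>i<n. integral {grid t n i..grid t n (Suc i)} (g n i)) (integral {0..t} f) < e"
    using osc[OF e'] eventually_gt_at_top[of 0]
  proof eventually_elim
    case (elim n)
    have fi: "f integrable_on {grid t n i..grid t n (Suc i)}" if "i < n" for i
      using f by (rule integrable_on_subinterval) (use uniform_partition_le[OF elim(2) t that] in auto)
    have "norm (integral {grid t n i..grid t n (Suc i)} (g n i) -
        integral {grid t n i..grid t n (Suc i)} f) \<le> e' * (t / real n)" if i: "i < n" for i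
    proof -
      note u = uniform_partition_le[OF elim(2) t i]
      have "norm (integral {grid t n i..grid t n (Suc i)} (g n i) -
        integral {grid t n i..grid t n (Suc i)} f) =
        norm (integral (cbox (grid t n i) (grid t n (Suc i))) (\<lambda>r. g n i r - f r))"
        using g[OF i] fi[OF i] by (simp add: integral_diff)
      also have "\<dots> \<le> e' * measure lborel (cbox (grid t n i) (grid t n (Suc i)))"
        using e' by (intro integrable_bound) (use elim(1) i g[OF i] fi[OF i] in \<open>auto intro!: integrable_diff\<close>)
      also have "measure lborel (cbox (grid t n i) (grid t n (Suc i))) = t / real n"
        using u by simp
      finally show ?thesis .
    qed
    then have "(\<Sum>i<n. norm (integral {grid t n i..grid t n (Suc i)} (g n i) -
        integral {grid t n i..grid t n (Suc i)} f)) \<le> (\<Sum>i<n. e' * (t / real n))"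
      by (intro sum_mono) auto
    also have "\<dots> = e' * t" using elim(2) by simp
    also have "\<dots> = e * (t / (2 * (t + 1)))" by (simp add: e'_def)
    also have "\<dots> < e * 1" using e t by (intro mult_strict_left_mono) (auto simp: divide_simps)
    also have "\<dots> = e" by simp
    finally have "norm (\<Sum>i<n. integral {grid t n i..grid t n (Suc i)} (g n i) -
        integral {grid t n i..grid t n (Suc i)} f) < e"
      using norm_sum[of "\<lambda>i. integral {grid t n i..grid t n (Suc i)} (g n i) -
        integral {grid t n i..grid t n (Suc i)} f" "{..<n}"] by linarith
    then show ?case
      using integral_uniform_partition[OF f elim(2) t order.refl] elim(2)
      by (simp add: dist_norm sum_subtractf)
  qed
  then show "\<exists>N. \<forall>n\<ge>N. dist (\<Sum>i<n. integral {grid t n i..grid t n (Suc i)} (g n i)) (integral {0..t} f) < e"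
    by (simp add: eventually_sequentially)
qed

lemma riemann_sum_tendsto:
  fixes f :: "real \<Rightarrow> 'b::banach"
  assumes f: "continuous_on {0..t} f" and t: "t \<ge> 0"
  shows "(\<lambda>n. \<Sum>i<n. (t / real n) *\<^sub>R f (grid t n i)) \<longlonglongrightarrow> integral {0..t} f"
proof -
  have "(\<lambda>n. \<Sum>i<n. integral {grid t n i..grid t n (Suc i)} (\<lambda>_. f (grid t n i))) \<longlonglongrightarrow> integral {0..t} f"
  proof (rule uniform_partition_sum_tendsto[OF _ t])
    show "f integrable_on {0..t}" using f by (rule integrable_continuous_interval)
    fix e :: real assume "e > 0"
    show "\<forall>\<^sub>F n in sequentially. \<forall>i<n. \<forall>r\<in>{grid t n i..grid t n (Suc i)}.
         norm (f (grid t n i) - f r) \<le> e"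
      using uniform_oscillation[OF f t \<open>e > 0\<close>] eventually_gt_at_top[of 0]
    proof eventually_elim
      case (elim n)
      show "\<forall>i<n. \<forall>r\<in>{grid t n i..grid t n (Suc i)}.
         norm (f (grid t n i) - f r) \<le> e"
      proof (intro allI impI ballI)
        fix i r assume i: "i < n" and r: "r \<in> {grid t n i..grid t n (Suc i)}"
        have "dist (f (grid t n i)) (f r) < e" using elim(1) i r uniform_partition_le(2)[OF elim(2) t i] by auto
        then show "norm (f (grid t n i) - f r) \<le> e" by (simp add: dist_norm)
      qed
    qed
  qed (auto intro: integrable_const_ivl)
  moreover have "(\<Sum>i<n. integral {grid t n i..grid t n (Suc i)} (\<lambda>_. f (grid t n i)))
     = (\<Sum>i<n. (t / real n) *\<^sub>R f (grid t n i))" for n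
  proof (rule sum.cong[OF refl])
    fix i assume "i \<in> {..<n}"
    then have "i < n" "n > 0" by auto
    note u = uniform_partition_le[OF this(2) t this(1)]
    show "integral {grid t n i..grid t n (Suc i)} (\<lambda>_. f (grid t n i)) = (t / real n) *\<^sub>R f (grid t n i)"
      using u by simp
  qed
  ultimately show ?thesis by simp
qed

text \<open>Uniform continuity packaged as one null sequence per path. The sequence is obtained
  separately for each outcome, which is the form that \<open>null_in_prob_dominated\<close>
  accepts.\<close>

lemma uniform_partition_modulus:
  fixes f :: "real \<Rightarrow> 'b::real_normed_vector"
  assumes "continuous_on {0..t} f" "t \<ge> 0"
  obtains A :: "nat \<Rightarrow> real" where "A \<longlonglongrightarrow> 0" "\<And>n. A n \<ge> 0"
    "\<And>n i. i < n \<Longrightarrow> norm (f (grid t n (Suc i)) - f (grid t n i)) \<le> A n"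
proof
  \<comment> \<open>The inserted 0 makes the maximum defined for \<open>n = 0\<close> and
    nonnegative for every \<open>n\<close>.\<close>
  define A where "A n = Max (insert 0 ((\<lambda>i. norm (f (grid t n (Suc i)) - f (grid t n i))) ` {..<n}))" for n
  show nonneg: "A n \<ge> 0" for n by (simp add: A_def)
  show "norm (f (grid t n (Suc i)) - f (grid t n i)) \<le> A n" if "i < n" for n i
    unfolding A_def using that by (intro Max_ge) auto
  show "A \<longlonglongrightarrow> 0"
  proof (rule metric_LIMSEQ_I)
    fix e :: real assume "e > 0"
    have "\<forall>\<^sub>F n in sequentially. dist (A n) 0 < e"
      using uniform_oscillation[OF assms \<open>e > 0\<close>] eventually_gt_at_top[of 0]
    proof eventually_elim
      case (elim n)
      have "norm (f (grid t n (Suc i)) - f (grid t n i)) < e" if i: "i < n" for i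
        using elim(1) i uniform_partition_le(2)[OF elim(2) assms(2) i] by (auto simp: dist_norm[symmetric])
      then have "A n < e" unfolding A_def using \<open>e > 0\<close> by (subst Max_less_iff) auto
      with nonneg[of n] show ?case by simp
    qed
    then show "\<exists>N. \<forall>n\<ge>N. dist (A n) 0 < e" by (simp add: eventually_sequentially)
  qed
qed

lemma uniform_point:
  assumes "i \<le> n" "0 \<le> t"
  shows "grid t n i \<in> {0..t}"
proof (cases "n = 0")
  case False
  then show ?thesis using mult_right_mono[of "real i" "real n" t] assms by (auto simp: divide_simps mult.commute)
qed (use assms in auto)

definition increment :: "real \<Rightarrow> nat \<Rightarrow> nat \<Rightarrow> (real \<Rightarrow> 'b::ab_group_add) \<Rightarrow> 'b" where
  "increment t n i X = X (grid t n (Suc i)) - X (grid t n i)"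

lemma continuous_on_integral_bound:
  fixes f :: "real \<Rightarrow> 'b::banach"
  assumes f: "continuous_on {0..t} f" and ab: "0 \<le> r" "r \<le> s" "s \<le> t" and B: "\<And>y. y \<in> {0..t} \<Longrightarrow> norm (f y) \<le> B"
  shows "norm (integral {0..s} f - integral {0..r} f) \<le> B * (s - r)"
proof -
  have "f integrable_on {0..s}"
    by (rule integrable_continuous_interval) (rule continuous_on_subset[OF f], use ab in auto)
  then have "integral {0..r} f + integral {r..s} f = integral {0..s} f"
    using ab by (intro Henstock_Kurzweil_Integration.integral_combine) auto
  then have "integral {0..s} f - integral {0..r} f = integral {r..s} f" by (simp add: algebra_simps)
  also have "norm \<dots> \<le> B * (s - r)"
    by (rule integral_bound) (use ab B in \<open>auto intro: continuous_on_subset[OF f]\<close>)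
  finally show ?thesis .
qed

lemma integral_eq_0_imp_eq_0:
  fixes f :: "real \<Rightarrow> real"
  assumes "continuous_on {0..t} f" "\<And>s. s \<in> {0..t} \<Longrightarrow> 0 \<le> f s" "integral {0..t} f = 0" "0 < t" "s \<in> {0..t}"
  shows "f s = 0"
  using integral_eq_0_iff[of 0 t f] assms by blast

lemma path_bounded:
  fixes X :: "real \<Rightarrow> 'b::real_normed_vector"
  assumes "continuous_on {0..t} X"
  obtains B where "B \<ge> 0" "\<And>s. s \<in> {0..t} \<Longrightarrow> norm (X s) \<le> B"
proof -
  have "bounded (X ` {0..t})" using compact_continuous_image[OF assms] compact_imp_bounded by blast
  then obtain B where B: "\<forall>y\<in>X ` {0..t}. norm y \<le> B" unfolding bounded_iff by blast
  show ?thesis by (rule that[of "max B 0"]) (use B in \<open>auto simp: le_max_iff_disj\<close>)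
qed

text \<open>A Gronwall lemma with Riemann sums in place of the integral of \<open>f\<close>; it is
  meant for a truncated second moment whose regularity in time is not established. Left Riemann sums
  of an exponential lie below its integral, so a bound \<open>C exp (l s)\<close> reproduces itself
  with \<open>C\<close> halved, and iteration gives 0. The error \<open>\<rho>\<close> may depend on
  \<open>s\<close>, since every round lets \<open>n\<close> tend to infinity at fixed
  \<open>s\<close>.\<close>

lemma discrete_gronwall:
  fixes f :: "real \<Rightarrow> real"
  assumes L: "L \<ge> 0" and t: "t \<in> {0..T}" and nonneg: "\<And>s. s \<in> {0..T} \<Longrightarrow> 0 \<le> f s" and B: "\<And>s. s \<in> {0..T} \<Longrightarrow> f s \<le> B"
    and ineq: "\<And>s. s \<in> {0..T} \<Longrightarrow> \<exists>\<rho>. \<rho> \<longlonglongrightarrow> 0 \<and> (\<forall>n>0. f s \<le> L * (\<Sum>i<n. (s / real n) * f (grid s n i)) + \<rho> n)"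
  shows "f t = 0"
proof -
  \<comment> \<open>\<open>L / l \<le> 1 / 2\<close> is the contraction factor of the iteration; the
    \<open>+ 1\<close> keeps \<open>l\<close> positive when \<open>L = 0\<close>.\<close>
  define l where "l = 2 * L + 1"
  have l: "l > 0" "L / l \<le> 1 / 2" using L by (auto simp: l_def divide_simps)
  have B0: "B \<ge> 0" using B[OF t] nonneg[OF t] by linarith
  have "\<forall>s\<in>{0..T}. f s \<le> B / 2 ^ k * exp (l * s)" for k
  proof (induction k)
    case 0
    show ?case
    proof
      fix s assume s: "s \<in> {0..T}"
      have "B * 1 \<le> B * exp (l * s)" using B0 l(1) s by (intro mult_left_mono) auto
      then show "f s \<le> B / 2 ^ 0 * exp (l * s)" using B[OF s] by simp
    qed
  next
    case (Suc k)
    show ?case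
    proof
      fix s assume s: "s \<in> {0..T}"
      define C where "C = B / 2 ^ k"
      have C: "C \<ge> 0" using B0 by (simp add: C_def)
      obtain \<rho> where \<rho>: "\<rho> \<longlonglongrightarrow> 0" "\<And>n. n > 0 \<Longrightarrow> f s \<le> L * (\<Sum>i<n. (s / real n) * f (grid s n i)) + \<rho> n"
        using ineq[OF s] by blast
      have "f s \<le> L * (C * (exp (l * s) / l)) + \<rho> n" if n: "n > 0" for n
      proof -
        \<comment> \<open>By \<open>y \<le> exp y - 1\<close> with \<open>y = l * (s / n)\<close>,
          each term is at most an increment of the exponential, and these increments
          telescope.\<close>
        have "(\<Sum>i<n. (s / real n) * f (grid s n i)) \<le> (\<Sum>i<n. (C / l) * (exp (l * (grid s n (Suc i))) - exp (l * (grid s n i))))"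
        proof (rule sum_mono)
          fix i assume "i \<in> {..<n}"
          then have i: "i < n" by simp
          have s0: "0 \<le> s" using s by simp
          note u = uniform_partition_le[OF n s0 i]
          have "f (grid s n i) \<le> C * exp (l * (grid s n i))"
          proof -
            have "grid s n i \<in> {0..T}" using u s by auto
            then show ?thesis using Suc unfolding C_def by blast
          qed
          then have "(s / real n) * f (grid s n i) \<le> (s / real n) * (C * exp (l * (grid s n i)))"
            using s by (intro mult_left_mono) auto
          also have "\<dots> = C / l * (exp (l * (grid s n i)) * (l * (s / real n)))" using l by simp
          also have "\<dots> \<le> C / l * (exp (l * (grid s n i)) * (exp (l * (s / real n)) - 1))"
          proof (intro mult_left_mono)
            show "l * (s / real n) \<le> exp (l * (s / real n)) - 1"
              using exp_ge_add_one_self[of "l * (s / real n)"] by linarith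
          qed (use C l in auto)
          also have "exp (l * (grid s n i)) * (exp (l * (s / real n)) - 1) = exp (l * (grid s n (Suc i))) - exp (l * (grid s n i))"
            by (simp add: algebra_simps add_divide_distrib flip: exp_add)
          finally show "(s / real n) * f (grid s n i) \<le> (C / l) * (exp (l * (grid s n (Suc i))) - exp (l * (grid s n i)))" .
        qed
        also have "\<dots> = C / l * (exp (l * s) - 1)"
          unfolding sum_distrib_left[symmetric] using sum_lessThan_telescope[of "\<lambda>i. exp (l * (grid s n i))" n] n by simp
        also have "\<dots> \<le> C / l * exp (l * s)" using C l by (intro mult_left_mono) auto
        finally have "L * (\<Sum>i<n. (s / real n) * f (grid s n i)) \<le> L * (C / l * exp (l * s))"
          using L by (rule mult_left_mono)
        with \<rho>(2)[OF n] show ?thesis by simp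
      qed
      then have "\<forall>\<^sub>F n in sequentially. f s \<le> L * (C * (exp (l * s) / l)) + \<rho> n"
        by (intro eventually_mono[OF eventually_gt_at_top[of 0]])
      moreover have "(\<lambda>n. L * (C * (exp (l * s) / l)) + \<rho> n) \<longlonglongrightarrow> L * (C * (exp (l * s) / l)) + 0"
        by (intro tendsto_intros \<rho>)
      ultimately have "f s \<le> L * (C * (exp (l * s) / l)) + 0"
        by (intro tendsto_lowerbound[of _ _ sequentially]) auto
      also have "\<dots> = (L / l) * (C * exp (l * s))" by simp
      also have "\<dots> \<le> (1 / 2) * (C * exp (l * s))" using l C by (intro mult_right_mono) auto
      finally show "f s \<le> B / 2 ^ Suc k * exp (l * s)" by (simp add: C_def)
    qed
  qed
  then have "f t \<le> B / 2 ^ k * exp (l * t)" for k using t by blast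
  moreover have "(\<lambda>k. B / 2 ^ k * exp (l * t)) \<longlonglongrightarrow> 0" by real_asymp
  ultimately have "f t \<le> 0" by (intro tendsto_lowerbound[of _ 0 sequentially]) auto
  then show ?thesis using nonneg[OF t] by linarith
qed

subsection \<open>Elementary inequalities\<close>

lemma cmod_cis_minus_1_le: "cmod (cis y - 1) \<le> \<bar>y\<bar>"
  using iexp_approx1[of y 0] by (simp add: cis_conv_exp)

text \<open>The price of using \<open>cis y - 1\<close> as integrator. Being of third order, it is
  negligible against a sum of squares of increments.\<close>

lemma cmod_cis_taylor: "cmod (\<i> * complex_of_real y - complex_of_real (y\<^sup>2 / 2) - (cis y - 1)) \<le> \<bar>y\<bar> ^ 3"
proof -
  have "cmod (cis y - (1 + \<i> * y + (\<i> * y)\<^sup>2 / 2)) \<le> \<bar>y\<bar> ^ 3 / 6"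
    using iexp_approx1[of y 2] by (simp add: cis_conv_exp eval_nat_numeral)
  also have "\<dots> \<le> \<bar>y\<bar> ^ 3" by simp
  also have "cis y - (1 + \<i> * y + (\<i> * y)\<^sup>2 / 2) = - (\<i> * complex_of_real y - complex_of_real (y\<^sup>2 / 2) - (cis y - 1))"
    by (simp add: power_mult_distrib)
  finally show ?thesis by (simp only: norm_minus_cancel)
qed

lemma cmod_cis_minus_1_power2: "(cmod (cis y - 1))\<^sup>2 = 2 - 2 * cos y"
proof -
  have "(cmod (cis y - 1))\<^sup>2 = (cos y - 1)\<^sup>2 + (sin y)\<^sup>2" by (simp add: cmod_power2)
  then show ?thesis using sin_cos_squared_add[of y] by (simp add: power2_eq_square algebra_simps)
qed

lemma cmod_cis_minus_1_le_2: "cmod (cis y - 1) \<le> 2"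
  using norm_triangle_ineq4[of "cis y" 1] by simp

lemma cis_measurable: "f \<in> borel_measurable N \<Longrightarrow> (\<lambda>\<omega>. cis (f \<omega>)) \<in> borel_measurable N"
  by (rule measurable_compose[where g = cis]) (auto intro!: borel_measurable_continuous_onI continuous_intros)

lemma cmod_add_power2: "(cmod (a + b))\<^sup>2 = (cmod a)\<^sup>2 + 2 * Re (cnj a * b) + (cmod b)\<^sup>2"
  unfolding cmod_power2 by (simp add: power2_eq_square algebra_simps)

lemma exp_le_quadratic:
  fixes y :: real
  assumes "\<bar>y\<bar> \<le> 1"
  shows "exp y \<le> 1 + y + y\<^sup>2"
proof (cases "y \<ge> 0")
  case True
  then show ?thesis using exp_bound[of y] assms by simp
next
  case False
  \<comment> \<open>In terms of \<open>t = - y\<close> the claim reads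
    \<open>1 \<le> (1 - t + t^2) exp t\<close>, and the quadratic Taylor bound for
    \<open>exp t\<close> is already enough for it.\<close>
  define t where "t = - y"
  have t: "0 \<le> t" using False by (simp add: t_def)
  have "1 \<le> 1 + t\<^sup>2 / 2 + t ^ 3 / 2 + t ^ 4 / 2" using t by simp
  also have "\<dots> = (1 - t + t\<^sup>2) * (1 + t + t\<^sup>2 / 2)" by (simp add: field_simps eval_nat_numeral)
  also have "\<dots> \<le> (1 - t + t\<^sup>2) * exp t"
  proof (rule mult_left_mono)
    show "1 + t + t\<^sup>2 / 2 \<le> exp t" using exp_lower_Taylor_quadratic[OF t] by simp
    have "0 \<le> (1 - t)\<^sup>2" by simp
    then show "0 \<le> 1 - t + t\<^sup>2" using t by (simp add: power2_diff)
  qed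
  finally have "1 * exp (- t) \<le> (1 - t + t\<^sup>2) * exp t * exp (- t)" by (rule mult_right_mono) simp
  then show ?thesis by (simp add: t_def mult.assoc flip: exp_add)
qed

lemma abs_exp_minus_one_le:
  fixes y :: real
  assumes "0 \<le> y"
  shows "\<bar>exp (- y) - 1\<bar> \<le> y" "\<bar>exp (- y) - 1 + y\<bar> \<le> y\<^sup>2"
proof -
  have 1: "1 - y \<le> exp (- y)" using exp_ge_add_one_self[of "- y"] by simp
  then show "\<bar>exp (- y) - 1\<bar> \<le> y" using assms by simp
  have "exp (- y) \<le> 1 - y + y\<^sup>2"
  proof (cases "y \<le> 1")
    case True
    then show ?thesis using exp_le_quadratic[of "- y"] assms by simp
  next
    case False
    then have "y \<le> y\<^sup>2" using mult_left_mono[of 1 y y] by (simp add: power2_eq_square)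
    moreover have "exp (- y) \<le> 1" using assms by simp
    ultimately show ?thesis by linarith
  qed
  then show "\<bar>exp (- y) - 1 + y\<bar> \<le> y\<^sup>2" using 1 by simp
qed

subsection \<open>Random signs\<close>

text \<open>The mean of the cosine of a sum with independent random signs, written out over the set
  \<open>S\<close> of plus signs. It factorizes because the mean of \<open>cos (a + e)\<close> and
  \<open>cos (a - e)\<close> is \<open>cos a cos e\<close>.\<close>

lemma sum_Pow_cos:
  fixes e :: "nat \<Rightarrow> real"
  shows "(\<Sum>S\<in>Pow {..<n}. cos (sum e S - sum e ({..<n} - S))) = 2 ^ n * (\<Prod>i<n. cos (e i))"
proof -
  \<comment> \<open>A phase \<open>a\<close> is carried along because fixing the sign of the last
    summand shifts the argument by \<open>e n\<close> or \<open>- e n\<close>.\<close>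
  have "(\<Sum>S\<in>Pow {..<n}. cos (a + (sum e S - sum e ({..<n} - S)))) = 2 ^ n * cos a * (\<Prod>i<n. cos (e i))" for a
  proof (induction n arbitrary: a)
    case (Suc n)
    have inj: "inj_on (insert n) (Pow {..<n})"
    proof (rule inj_onI)
      fix A B assume "A \<in> Pow {..<n}" "B \<in> Pow {..<n}" "insert n A = insert n B"
      moreover from this have "n \<notin> A" "n \<notin> B" by auto
      ultimately show "A = B" by (simp add: insert_ident)
    qed
    have "(\<Sum>S\<in>Pow {..<Suc n}. cos (a + (sum e S - sum e ({..<Suc n} - S)))) =
        (\<Sum>S\<in>Pow {..<n}. cos (a + (sum e S - sum e ({..<Suc n} - S)))) +
        (\<Sum>S\<in>insert n ` Pow {..<n}. cos (a + (sum e S - sum e ({..<Suc n} - S))))"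
      unfolding lessThan_Suc Pow_insert by (rule sum.union_disjoint) auto
    also have "(\<Sum>S\<in>insert n ` Pow {..<n}. cos (a + (sum e S - sum e ({..<Suc n} - S)))) =
       (\<Sum>S\<in>Pow {..<n}. cos (a + (sum e (insert n S) - sum e ({..<Suc n} - insert n S))))"
      by (subst sum.reindex[OF inj]) simp
    also have "\<dots> = (\<Sum>S\<in>Pow {..<n}. cos ((a + e n) + (sum e S - sum e ({..<n} - S))))"
    proof (rule sum.cong[OF refl])
      fix S assume S: "S \<in> Pow {..<n}"
      have "{..<Suc n} - insert n S = {..<n} - S" by auto
      moreover have "sum e (insert n S) = e n + sum e S"
        using S by (subst sum.insert) (auto intro: finite_subset)
      ultimately show "cos (a + (sum e (insert n S) - sum e ({..<Suc n} - insert n S))) = cos ((a + e n) + (sum e S - sum e ({..<n} - S)))"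
        by (simp add: algebra_simps)
    qed
    also have "(\<Sum>S\<in>Pow {..<n}. cos (a + (sum e S - sum e ({..<Suc n} - S)))) = (\<Sum>S\<in>Pow {..<n}. cos ((a - e n) + (sum e S - sum e ({..<n} - S))))"
    proof (rule sum.cong[OF refl])
      fix S assume S: "S \<in> Pow {..<n}"
      then have "{..<Suc n} - S = insert n ({..<n} - S)" by auto
      then have "sum e ({..<Suc n} - S) = e n + sum e ({..<n} - S)" by simp
      then show "cos (a + (sum e S - sum e ({..<Suc n} - S))) = cos ((a - e n) + (sum e S - sum e ({..<n} - S)))"
        by (simp add: algebra_simps)
    qed
    finally have "(\<Sum>S\<in>Pow {..<Suc n}. cos (a + (sum e S - sum e ({..<Suc n} - S)))) =
        2 ^ n * (cos (a - e n) + cos (a + e n)) * (\<Prod>i<n. cos (e i))"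
      unfolding Suc by (simp only: distrib_left distrib_right)
    also have "cos (a - e n) + cos (a + e n) = 2 * cos a * cos (e n)" by (simp add: cos_add cos_diff)
    finally show ?case by (simp add: mult_ac)
  qed simp
  from this[of 0] show ?thesis by simp
qed

lemma cos_le_exp:
  fixes x :: real
  assumes "\<bar>x\<bar> \<le> 1"
  shows "0 \<le> cos x" "cos x \<le> exp (- (x\<^sup>2 / 4))"
proof -
  show "0 \<le> cos x" using assms pi_half_gt_zero pi_gt3 by (intro cos_ge_zero) auto
  \<comment> \<open>This is \<open>sin y \<ge> 3/4 y\<close> at \<open>y = |x| / 2\<close>. Twice
    its square is \<open>9/32 x^2\<close>, which exceeds the required
    \<open>1/4 x^2\<close>.\<close>
  have s: "\<bar>sin (x/2)\<bar> \<ge> \<bar>x\<bar> * (3/8)"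
  proof -
    have *: "sin y \<ge> y * (3/4)" if "0 \<le> y" "y \<le> 1" for y :: real
    proof -
      have "\<bar>sin y - (\<Sum>m<3. sin_coeff m * y ^ m)\<bar> \<le> inverse (fact 3) * \<bar>y\<bar> ^ 3"
        by (rule Maclaurin_sin_bound)
      moreover have "(\<Sum>m<3. sin_coeff m * y ^ m) = y"
        by (simp add: eval_nat_numeral sin_coeff_def)
      ultimately have "y - y ^ 3 / 6 \<le> sin y" using that by (simp add: fact_numeral abs_if split: if_splits)
      moreover have "y ^ 3 \<le> y" using that power_decreasing[of 1 3 y] by simp
      ultimately show ?thesis using that by simp
    qed
    show ?thesis using *[of "x/2"] *[of "-(x/2)"] assms by (cases "x \<ge> 0") (auto simp: abs_if)
  qed
  have "(sin (x/2))\<^sup>2 \<ge> x\<^sup>2 * (9/64)"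
    using power_mono[OF s, of 2] by (simp add: power_mult_distrib power_divide)
  moreover have "cos x = 1 - 2 * (sin (x/2))\<^sup>2" using cos_double_sin[of "x/2"] by simp
  ultimately have "cos x \<le> 1 + (- (x\<^sup>2 / 4))" using zero_le_power2[of x] by linarith
  also have "\<dots> \<le> exp (- (x\<^sup>2 / 4))" by (rule exp_ge_add_one_self)
  finally show "cos x \<le> exp (- (x\<^sup>2 / 4))" .
qed

text \<open>With \<open>Q\<close> the sum of squares, the product is at most
  \<open>exp (- Q / 4)\<close>. Its distance to 1 is comparable with \<open>Q\<close> only while
  \<open>Q\<close> stays bounded, hence the truncation at 1.\<close>

lemma min_one_sum_squares_le:
  fixes e :: "nat \<Rightarrow> real"
  assumes "\<And>i. i < n \<Longrightarrow> \<bar>e i\<bar> \<le> 1"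
  shows "min 1 (\<Sum>i<n. (e i)\<^sup>2) \<le> 8 * (1 - (\<Prod>i<n. cos (e i)))"
proof -
  define Q where "Q = (\<Sum>i<n. (e i)\<^sup>2)"
  define m where "m = min 1 Q"
  have "Q \<ge> 0" unfolding Q_def by (intro sum_nonneg) auto
  then have m: "0 \<le> m" "m \<le> 1" by (auto simp: m_def)
  have "(\<Prod>i<n. cos (e i)) \<le> (\<Prod>i<n. exp (- ((e i)\<^sup>2 / 4)))"
    using cos_le_exp assms by (intro prod_mono) auto
  also have "\<dots> = exp (- (Q / 4))"
    unfolding Q_def by (simp add: exp_sum[symmetric] sum_negf sum_divide_distrib)
  also have "\<dots> \<le> exp (- (m / 4))" by (simp add: m_def)
  also have "\<dots> \<le> 1 / (1 + m / 4)"
  proof -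
    have "inverse (exp (m / 4)) \<le> inverse (1 + m / 4)"
      using m exp_ge_add_one_self[of "m / 4"] by (intro le_imp_inverse_le) auto
    then show ?thesis by (simp add: exp_minus inverse_eq_divide)
  qed
  also have "\<dots> \<le> 1 - m / 8"
  proof -
    have "m * m \<le> m * 1" using m by (intro mult_left_mono) auto
    moreover have "(1 - m / 8) * (1 + m / 4) = 1 + m / 8 - m * m / 32" by (simp add: field_simps)
    ultimately have "1 \<le> (1 - m / 8) * (1 + m / 4)" using m by linarith
    then show ?thesis using m by (subst pos_divide_le_eq) auto
  qed
  finally have "m \<le> 8 * (1 - (\<Prod>i<n. cos (e i)))" by (simp add: algebra_simps)
  then show ?thesis unfolding m_def Q_def .
qed

lemma one_minus_cos_le: "1 - cos (x::real) \<le> 2 * min 1 \<bar>x\<bar>"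
proof (cases "\<bar>x\<bar> \<le> 1")
  case True
  have "(sin (x/2))\<^sup>2 \<le> (x/2)\<^sup>2"
    using abs_sin_x_le_abs_x[of "x/2"] by (simp only: abs_le_square_iff)
  moreover have "cos x = 1 - 2 * (sin (x/2))\<^sup>2" using cos_double_sin[of "x/2"] by simp
  ultimately have "1 - cos x \<le> x\<^sup>2 / 2" by (simp add: power_divide)
  also have "x\<^sup>2 \<le> \<bar>x\<bar>" using True mult_mono[of "\<bar>x\<bar>" 1 "\<bar>x\<bar>" "\<bar>x\<bar>"] by (simp add: power2_eq_square)
  finally show ?thesis using True by simp
next
  case False
  then show ?thesis using cos_ge_minus_one[of x] by simp
qed

subsection \<open>Convergence to zero in probability\<close>

lemma min_one_norm_triangle: "min 1 (norm (a + b)) \<le> min 1 (norm a) + min 1 (norm b)"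
  for a b :: "'b::real_normed_vector"
  using norm_triangle_ineq[of a b] norm_ge_zero[of a] norm_ge_zero[of b]
  unfolding min_def by (auto simp del: norm_ge_zero)

context prob_space
begin

text \<open>The expectation of \<open>min 1 (norm X)\<close> metrizes convergence in probability. It
  is subadditive in \<open>X\<close> and accessible to dominated convergence, so estimates of sums
  involve no splitting of thresholds.\<close>

definition null_in_prob :: "(nat \<Rightarrow> 'a \<Rightarrow> 'b::{banach, second_countable_topology}) \<Rightarrow> bool" where
  "null_in_prob X \<longleftrightarrow> (\<forall>n. X n \<in> borel_measurable M) \<and>
     (\<lambda>n. expectation (\<lambda>\<omega>. min 1 (norm (X n \<omega>)))) \<longlonglongrightarrow> 0"

lemma integrable_min_norm [simp, intro]:
  fixes X :: "'a \<Rightarrow> 'b::{banach, second_countable_topology}"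
  assumes "X \<in> borel_measurable M"
  shows "integrable M (\<lambda>\<omega>. min 1 (norm (X \<omega>)))"
  by (rule integrable_const_bound[of _ 1]) (use assms in auto)

lemma null_in_prob_AE:
  fixes X :: "nat \<Rightarrow> 'a \<Rightarrow> 'b::{banach, second_countable_topology}"
  assumes [measurable]: "\<And>n. X n \<in> borel_measurable M" and lim: "AE \<omega> in M. (\<lambda>n. X n \<omega>) \<longlonglongrightarrow> 0"
  shows "null_in_prob X"
proof -
  have "(\<lambda>n. expectation (\<lambda>\<omega>. min 1 (norm (X n \<omega>)))) \<longlonglongrightarrow> expectation (\<lambda>_. 0)"
  proof (rule integral_dominated_convergence[where w = "\<lambda>_. 1"])
    show "AE \<omega> in M. (\<lambda>n. min 1 (norm (X n \<omega>))) \<longlonglongrightarrow> 0"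
      using lim
    proof eventually_elim
      case (elim \<omega>)
      have "(\<lambda>n. min 1 (norm (X n \<omega>))) \<longlonglongrightarrow> min 1 (norm (0::'b))"
        using elim by (intro tendsto_min tendsto_norm tendsto_const)
      then show ?case by simp
    qed
  qed auto
  then show ?thesis by (simp add: null_in_prob_def)
qed

lemma null_in_prob_eventually_le:
  fixes X :: "nat \<Rightarrow> 'a \<Rightarrow> 'b::{banach, second_countable_topology}"
    and Y :: "nat \<Rightarrow> 'a \<Rightarrow> 'c::{banach, second_countable_topology}"
  assumes X: "null_in_prob X" and Y [measurable]: "\<And>n. Y n \<in> borel_measurable M"
    and le: "\<forall>\<^sub>F n in sequentially. AE \<omega> in M. norm (Y n \<omega>) \<le> norm (X n \<omega>)"
  shows "null_in_prob Y"
proof -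
  have [measurable]: "X n \<in> borel_measurable M" for n using X by (simp add: null_in_prob_def)
  have "(\<lambda>n. expectation (\<lambda>\<omega>. min 1 (norm (Y n \<omega>)))) \<longlonglongrightarrow> 0"
  proof (rule tendsto_sandwich[OF _ _ tendsto_const])
    show "(\<lambda>n. expectation (\<lambda>\<omega>. min 1 (norm (X n \<omega>)))) \<longlonglongrightarrow> 0" using X by (simp add: null_in_prob_def)
    show "\<forall>\<^sub>F n in sequentially. expectation (\<lambda>\<omega>. min 1 (norm (Y n \<omega>))) \<le> expectation (\<lambda>\<omega>. min 1 (norm (X n \<omega>)))"
      using le
    proof eventually_elim
      case (elim n)
      show ?case
      proof (rule integral_mono_AE)
        show "AE \<omega> in M. min 1 (norm (Y n \<omega>)) \<le> min 1 (norm (X n \<omega>))"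
          using elim by eventually_elim auto
      qed auto
    qed
  qed (auto intro!: always_eventually integral_nonneg_AE)
  then show ?thesis by (simp add: null_in_prob_def)
qed

lemma null_in_prob_le:
  fixes X :: "nat \<Rightarrow> 'a \<Rightarrow> 'b::{banach, second_countable_topology}"
    and Y :: "nat \<Rightarrow> 'a \<Rightarrow> 'c::{banach, second_countable_topology}"
  assumes "null_in_prob X" and "\<And>n. Y n \<in> borel_measurable M"
    and "\<And>n. AE \<omega> in M. norm (Y n \<omega>) \<le> norm (X n \<omega>)"
  shows "null_in_prob Y"
  using assms by (intro null_in_prob_eventually_le[of X Y] always_eventually) auto

lemma null_in_prob_add:
  fixes X Y :: "nat \<Rightarrow> 'a \<Rightarrow> 'b::{banach, second_countable_topology}"
  assumes "null_in_prob X" "null_in_prob Y"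
  shows "null_in_prob (\<lambda>n \<omega>. X n \<omega> + Y n \<omega>)"
proof -
  have [measurable]: "X n \<in> borel_measurable M" "Y n \<in> borel_measurable M" for n
    using assms by (auto simp: null_in_prob_def)
  have "(\<lambda>n. expectation (\<lambda>\<omega>. min 1 (norm (X n \<omega> + Y n \<omega>)))) \<longlonglongrightarrow> 0"
  proof (rule tendsto_sandwich[OF _ _ tendsto_const])
    show "(\<lambda>n. expectation (\<lambda>\<omega>. min 1 (norm (X n \<omega>))) + expectation (\<lambda>\<omega>. min 1 (norm (Y n \<omega>)))) \<longlonglongrightarrow> 0"
      using assms tendsto_add[of _ 0 sequentially _ "0::real"] by (simp add: null_in_prob_def)
    show "\<forall>\<^sub>F n in sequentially. expectation (\<lambda>\<omega>. min 1 (norm (X n \<omega> + Y n \<omega>))) \<le> expectation (\<lambda>\<omega>. min 1 (norm (X n \<omega>))) + expectation (\<lambda>\<omega>. min 1 (norm (Y n \<omega>)))"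
    proof (rule always_eventually, rule allI)
      fix n
      have "expectation (\<lambda>\<omega>. min 1 (norm (X n \<omega> + Y n \<omega>))) \<le> expectation (\<lambda>\<omega>. min 1 (norm (X n \<omega>)) + min 1 (norm (Y n \<omega>)))"
      proof (rule integral_mono)
        fix \<omega> show "min 1 (norm (X n \<omega> + Y n \<omega>)) \<le> min 1 (norm (X n \<omega>)) + min 1 (norm (Y n \<omega>))"
          by (rule min_one_norm_triangle)
      qed auto
      then show "expectation (\<lambda>\<omega>. min 1 (norm (X n \<omega> + Y n \<omega>))) \<le> expectation (\<lambda>\<omega>. min 1 (norm (X n \<omega>))) + expectation (\<lambda>\<omega>. min 1 (norm (Y n \<omega>)))"
        by simp
    qed
  qed (auto intro!: always_eventually integral_nonneg_AE)
  then show ?thesis by (simp add: null_in_prob_def)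
qed

text \<open>Boundedness in L^1 gives tightness: on \<open>|T| \<le> m\<close> the factor costs at
  most \<open>m\<close>, and the remaining event has probability at most \<open>C / m\<close> by
  Markov's inequality. Both cases are merged into one pointwise inequality.\<close>

lemma null_in_prob_mult_L1_bounded:
  fixes X T :: "nat \<Rightarrow> 'a \<Rightarrow> real"
  assumes X: "null_in_prob X" and T: "\<And>n. integrable M (T n)" "\<And>n. expectation (\<lambda>\<omega>. \<bar>T n \<omega>\<bar>) \<le> C"
  shows "null_in_prob (\<lambda>n \<omega>. X n \<omega> * T n \<omega>)"
proof -
  have [measurable]: "X n \<in> borel_measurable M" "T n \<in> borel_measurable M" for n
    using X T(1)[of n] by (auto simp: null_in_prob_def)
  have bound: "expectation (\<lambda>\<omega>. min 1 \<bar>X n \<omega> * T n \<omega>\<bar>) \<le> C / m + m * expectation (\<lambda>\<omega>. min 1 \<bar>X n \<omega>\<bar>)" if m: "m \<ge> 1" for n m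
  proof -
    have "expectation (\<lambda>\<omega>. min 1 \<bar>X n \<omega> * T n \<omega>\<bar>) \<le> expectation (\<lambda>\<omega>. \<bar>T n \<omega>\<bar> / m + m * min 1 \<bar>X n \<omega>\<bar>)"
    proof (rule integral_mono)
      fix \<omega>
      show "min 1 \<bar>X n \<omega> * T n \<omega>\<bar> \<le> \<bar>T n \<omega>\<bar> / m + m * min 1 \<bar>X n \<omega>\<bar>"
      proof (cases "\<bar>T n \<omega>\<bar> \<le> m")
        case True
        have "min 1 \<bar>X n \<omega> * T n \<omega>\<bar> \<le> m * min 1 \<bar>X n \<omega>\<bar>"
        proof (cases "\<bar>X n \<omega>\<bar> \<le> 1")
          case True2: True
          have "\<bar>X n \<omega> * T n \<omega>\<bar> \<le> \<bar>X n \<omega>\<bar> * m" unfolding abs_mult using True by (intro mult_left_mono) auto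
          then show ?thesis using True2 by (simp add: mult.commute)
        next
          case False then show ?thesis using m by simp
        qed
        moreover have "0 \<le> \<bar>T n \<omega>\<bar> / m" using m by simp
        ultimately show ?thesis by linarith
      next
        case False
        then have "1 \<le> \<bar>T n \<omega>\<bar> / m" using m by simp
        moreover have "0 \<le> m * min 1 \<bar>X n \<omega>\<bar>" using m by simp
        ultimately show ?thesis by linarith
      qed
    next
      show "integrable M (\<lambda>\<omega>. min 1 \<bar>X n \<omega> * T n \<omega>\<bar>)"
        using integrable_min_norm[of "\<lambda>\<omega>. X n \<omega> * T n \<omega>"] by simp
      show "integrable M (\<lambda>\<omega>. \<bar>T n \<omega>\<bar> / m + m * min 1 \<bar>X n \<omega>\<bar>)"
        using integrable_min_norm[of "X n"] T(1)[of n] by simp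
    qed
    also have "\<dots> = expectation (\<lambda>\<omega>. \<bar>T n \<omega>\<bar>) / m + m * expectation (\<lambda>\<omega>. min 1 \<bar>X n \<omega>\<bar>)"
      using integrable_min_norm[of "X n"] T(1)[of n] by simp
    also have "\<dots> \<le> C / m + m * expectation (\<lambda>\<omega>. min 1 \<bar>X n \<omega>\<bar>)"
      using T(2)[of n] m by (simp add: divide_right_mono)
    finally show ?thesis .
  qed
  have "(\<lambda>n. expectation (\<lambda>\<omega>. min 1 \<bar>X n \<omega> * T n \<omega>\<bar>)) \<longlonglongrightarrow> 0"
  proof (rule LIMSEQ_I)
    fix e :: real assume e: "e > 0"
    have C: "C \<ge> 0" using T(2)[of 0] by (rule order_trans[rotated]) simp
    \<comment> \<open>Large enough for \<open>C / m < e / 2\<close>, and at least 1 as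
      \<open>bound\<close> requires.\<close>
    define m where "m = max 1 (2 * C / e + 1)"
    have m: "m \<ge> 1" "2 * C / e < m" by (auto simp: m_def)
    then have Cm: "C / m < e / 2" using e by (simp add: field_simps)
    have "\<forall>\<^sub>F n in sequentially. expectation (\<lambda>\<omega>. min 1 \<bar>X n \<omega>\<bar>) < e / (2 * m)"
      using X e m(1) by (intro order_tendstoD(2)[of _ 0]) (auto simp: null_in_prob_def)
    then have "\<forall>\<^sub>F n in sequentially. norm (expectation (\<lambda>\<omega>. min 1 \<bar>X n \<omega> * T n \<omega>\<bar>) - 0) < e"
    proof eventually_elim
      case (elim n)
      then have "m * expectation (\<lambda>\<omega>. min 1 \<bar>X n \<omega>\<bar>) < e / 2" using m(1) by (simp add: field_simps)
      then have "expectation (\<lambda>\<omega>. min 1 \<bar>X n \<omega> * T n \<omega>\<bar>) < e" using bound[OF m(1), of n] Cm by linarith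
      moreover have "expectation (\<lambda>\<omega>. min 1 \<bar>X n \<omega> * T n \<omega>\<bar>) \<ge> 0" by (intro integral_nonneg_AE) auto
      ultimately show ?case by simp
    qed
    then show "\<exists>N. \<forall>n\<ge>N. norm (expectation (\<lambda>\<omega>. min 1 \<bar>X n \<omega> * T n \<omega>\<bar>) - 0) < e"
      by (simp add: eventually_sequentially)
  qed
  then show ?thesis by (simp add: null_in_prob_def)
qed

text \<open>The null sequence \<open>A\<close> is chosen for each outcome and carries no
  measurability. It is eliminated by passing to the quotient of \<open>norm (X n)\<close> and
  \<open>|T n|\<close>, which is measurable and tends to 0 almost surely.\<close>

lemma null_in_prob_dominated:
  fixes X :: "nat \<Rightarrow> 'a \<Rightarrow> 'b::{banach, second_countable_topology}" and T :: "nat \<Rightarrow> 'a \<Rightarrow> real"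
  assumes [measurable]: "\<And>n. X n \<in> borel_measurable M"
    and T: "\<And>n. integrable M (T n)" "\<And>n. expectation (\<lambda>\<omega>. \<bar>T n \<omega>\<bar>) \<le> C"
    and dom: "AE \<omega> in M. \<exists>A. A \<longlonglongrightarrow> 0 \<and> (\<forall>n. norm (X n \<omega>) \<le> A n * \<bar>T n \<omega>\<bar>)"
  shows "null_in_prob X"
proof -
  have [measurable]: "T n \<in> borel_measurable M" for n using T(1)[of n] by auto
  \<comment> \<open>Where \<open>T n\<close> vanishes the quotient is 0 by convention, and
    \<open>X n\<close> vanishes there as well by \<open>dom\<close>.\<close>
  have "null_in_prob (\<lambda>n \<omega>. norm (X n \<omega>) / \<bar>T n \<omega>\<bar>)"
  proof (rule null_in_prob_AE)
    show "AE \<omega> in M. (\<lambda>n. norm (X n \<omega>) / \<bar>T n \<omega>\<bar>) \<longlonglongrightarrow> 0"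
      using dom
    proof eventually_elim
      case (elim \<omega>)
      then obtain A where A: "A \<longlonglongrightarrow> 0" "\<And>n. norm (X n \<omega>) \<le> A n * \<bar>T n \<omega>\<bar>" by blast
      show ?case
      proof (rule Lim_null_comparison)
        show "(\<lambda>n. \<bar>A n\<bar>) \<longlonglongrightarrow> 0" using A(1) by (rule tendsto_rabs_zero)
        have "norm (norm (X n \<omega>) / \<bar>T n \<omega>\<bar>) \<le> \<bar>A n\<bar>" for n
        proof (cases "T n \<omega> = 0")
          case False
          then have "norm (X n \<omega>) / \<bar>T n \<omega>\<bar> \<le> A n" using A(2)[of n] by (simp add: divide_simps)
          then show ?thesis by simp
        qed simp
        then show "\<forall>\<^sub>F n in sequentially. norm (norm (X n \<omega>) / \<bar>T n \<omega>\<bar>) \<le> \<bar>A n\<bar>" by simp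
      qed
    qed
  qed auto
  then have "null_in_prob (\<lambda>n \<omega>. norm (X n \<omega>) / \<bar>T n \<omega>\<bar> * T n \<omega>)"
    using T by (rule null_in_prob_mult_L1_bounded)
  then show ?thesis
  proof (rule null_in_prob_le)
    fix n
    show "AE \<omega> in M. norm (X n \<omega>) \<le> norm (norm (X n \<omega>) / \<bar>T n \<omega>\<bar> * T n \<omega>)"
      using dom
    proof eventually_elim
      case (elim \<omega>)
      then obtain A where A: "\<And>n. norm (X n \<omega>) \<le> A n * \<bar>T n \<omega>\<bar>" by blast
      show ?case using A[of n] by (cases "T n \<omega> = 0") (auto simp: abs_mult)
    qed
  qed auto
qed

text \<open>For \<open>Y = min 1 (sqrt Q)\<close> one has \<open>Y^2 = min 1 Q\<close>, and
  nonnegativity of the variance bounds the mean of \<open>Y\<close> by the root of the mean of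
  \<open>Y^2\<close>.\<close>

lemma null_in_prob_sqrt:
  fixes Q :: "nat \<Rightarrow> 'a \<Rightarrow> real"
  assumes Q: "null_in_prob Q" and nonneg: "\<And>n \<omega>. Q n \<omega> \<ge> 0"
  shows "null_in_prob (\<lambda>n \<omega>. sqrt (Q n \<omega>))"
proof -
  have [measurable]: "Q n \<in> borel_measurable M" for n using Q by (auto simp: null_in_prob_def)
  have "(\<lambda>n. expectation (\<lambda>\<omega>. min 1 (sqrt (Q n \<omega>)))) \<longlonglongrightarrow> 0"
  proof (rule tendsto_sandwich[OF _ _ tendsto_const])
    have "(\<lambda>n. sqrt (expectation (\<lambda>\<omega>. min 1 (Q n \<omega>)))) \<longlonglongrightarrow> sqrt 0"
      using Q nonneg by (intro tendsto_real_sqrt) (simp add: null_in_prob_def)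
    then show "(\<lambda>n. sqrt (expectation (\<lambda>\<omega>. min 1 (Q n \<omega>)))) \<longlonglongrightarrow> 0" by simp
    show "\<forall>\<^sub>F n in sequentially. expectation (\<lambda>\<omega>. min 1 (sqrt (Q n \<omega>))) \<le> sqrt (expectation (\<lambda>\<omega>. min 1 (Q n \<omega>)))"
    proof (rule always_eventually, rule allI)
      fix n
      have sq: "(min 1 (sqrt (Q n \<omega>)))\<^sup>2 = min 1 (Q n \<omega>)" for \<omega>
        using nonneg[of n \<omega>] by (auto simp: min_def)
      have int: "integrable M (\<lambda>\<omega>. min 1 (Q n \<omega>))"
        using integrable_min_norm[of "Q n"] nonneg by simp
      have int': "integrable M (\<lambda>\<omega>. min 1 (sqrt (Q n \<omega>)))"
        using integrable_min_norm[of "\<lambda>\<omega>. sqrt (Q n \<omega>)"] nonneg by simp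
      have "(expectation (\<lambda>\<omega>. min 1 (sqrt (Q n \<omega>))))\<^sup>2 \<le> expectation (\<lambda>\<omega>. (min 1 (sqrt (Q n \<omega>)))\<^sup>2)"
      proof -
        have "0 \<le> variance (\<lambda>\<omega>. min 1 (sqrt (Q n \<omega>)))" by (rule variance_positive)
        also have "\<dots> = expectation (\<lambda>\<omega>. (min 1 (sqrt (Q n \<omega>)))\<^sup>2) - (expectation (\<lambda>\<omega>. min 1 (sqrt (Q n \<omega>))))\<^sup>2"
          using int' int by (intro variance_eq) (simp_all add: sq)
        finally show ?thesis by simp
      qed
      then show "expectation (\<lambda>\<omega>. min 1 (sqrt (Q n \<omega>))) \<le> sqrt (expectation (\<lambda>\<omega>. min 1 (Q n \<omega>)))"
        unfolding sq by (rule real_le_rsqrt)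
    qed
  qed (auto intro!: always_eventually integral_nonneg_AE simp: nonneg)
  then show ?thesis using nonneg by (simp add: null_in_prob_def)
qed

text \<open>
  Averaging \<open>cos (\<Sum>i<n. \<plusminus> e i)\<close> over all choices of signs gives \<open>\<Prod>i<n. cos (e i)\<close>, which is
  close to \<open>1\<close> only if \<open>\<Sum>i<n. (e i)\<^sup>2\<close> is small.
\<close>

lemma null_in_prob_sum_squares:
  fixes e :: "nat \<Rightarrow> nat \<Rightarrow> 'a \<Rightarrow> real"
  assumes meas [measurable]: "\<And>n i. e n i \<in> borel_measurable M"
    and r: "r \<longlonglongrightarrow> 0"
    and subsums: "\<And>n S. S \<subseteq> {..<n} \<Longrightarrow> expectation (\<lambda>\<omega>. min 1 \<bar>\<Sum>i\<in>S. e n i \<omega>\<bar>) \<le> r n"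
    and small: "AE \<omega> in M. \<forall>\<^sub>F n in sequentially. \<forall>i<n. \<bar>e n i \<omega>\<bar> \<le> 1"
  shows "null_in_prob (\<lambda>n \<omega>. \<Sum>i<n. (e n i \<omega>)\<^sup>2)"
proof -
  define B where "B n \<omega> = (if \<forall>i<n. \<bar>e n i \<omega>\<bar> \<le> 1 then 0 else 1::real)" for n \<omega>
  have [measurable]: "B n \<in> borel_measurable M" for n
    unfolding B_def by measurable
  have "null_in_prob B"
  proof (rule null_in_prob_AE)
    show "AE \<omega> in M. (\<lambda>n. B n \<omega>) \<longlonglongrightarrow> 0"
      using small
    proof eventually_elim
      case (elim \<omega>)
      then have "\<forall>\<^sub>F n in sequentially. B n \<omega> = 0" by eventually_elim (simp add: B_def)
      then show ?case by (rule tendsto_eventually)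
    qed
  qed auto
  then have "(\<lambda>n. expectation (\<lambda>\<omega>. min 1 (norm (B n \<omega>)))) \<longlonglongrightarrow> 0" by (simp add: null_in_prob_def)
  moreover have "min 1 (norm (B n \<omega>)) = B n \<omega>" for n \<omega> by (simp add: B_def)
  ultimately have B: "(\<lambda>n. expectation (B n)) \<longlonglongrightarrow> 0" by simp
  have intB: "integrable M (B n)" for n by (rule integrable_const_bound[of _ 1]) (auto simp: B_def)
  define P where "P n \<omega> = (\<Prod>i<n. cos (e n i \<omega>))" for n \<omega>
  have [measurable]: "P n \<in> borel_measurable M" for n unfolding P_def by measurable
  have P1: "\<bar>P n \<omega>\<bar> \<le> 1" for n \<omega>
    unfolding P_def abs_prod by (rule prod_le_1) auto
  have intP: "integrable M (P n)" for n by (rule integrable_const_bound[of _ 1]) (auto simp: P1)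
  \<comment> \<open>Each choice of signs is the difference of two complementary subsums, and
    \<open>1 - cos x \<le> 2 min 1 |x|\<close> charges \<open>2 r n\<close> for either of
    them.\<close>
  have P: "expectation (\<lambda>\<omega>. 1 - P n \<omega>) \<le> 4 * r n" for n
  proof -
    define c where "c S \<omega> = cos ((\<Sum>i\<in>S. e n i \<omega>) - (\<Sum>i\<in>{..<n}-S. e n i \<omega>))" for S \<omega>
    have [measurable]: "c S \<in> borel_measurable M" for S unfolding c_def by measurable
    have intc: "integrable M (c S)" for S by (rule integrable_const_bound[of _ 1]) (auto simp: c_def)
    have "1 - expectation (c S) \<le> 4 * r n" if S: "S \<subseteq> {..<n}" for S
    proof -
      have i1: "integrable M (\<lambda>\<omega>. min 1 \<bar>\<Sum>i\<in>S'. e n i \<omega>\<bar>)" for S'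
        using integrable_min_norm[of "\<lambda>\<omega>. \<Sum>i\<in>S'. e n i \<omega>"] by simp
      have "1 - expectation (c S) = expectation (\<lambda>\<omega>. 1 - c S \<omega>)" using intc by (simp add: prob_space)
      also have "\<dots> \<le> expectation (\<lambda>\<omega>. 2 * min 1 \<bar>\<Sum>i\<in>S. e n i \<omega>\<bar> + 2 * min 1 \<bar>\<Sum>i\<in>{..<n}-S. e n i \<omega>\<bar>)"
      proof (rule integral_mono)
        fix \<omega>
        have "1 - c S \<omega> \<le> 2 * min 1 \<bar>(\<Sum>i\<in>S. e n i \<omega>) - (\<Sum>i\<in>{..<n}-S. e n i \<omega>)\<bar>"
          unfolding c_def by (rule one_minus_cos_le)
        then show "1 - c S \<omega> \<le> 2 * min 1 \<bar>\<Sum>i\<in>S. e n i \<omega>\<bar> + 2 * min 1 \<bar>\<Sum>i\<in>{..<n}-S. e n i \<omega>\<bar>"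
          using min_one_norm_triangle[of "\<Sum>i\<in>S. e n i \<omega>" "- (\<Sum>i\<in>{..<n}-S. e n i \<omega>)"] by simp
      qed (use intc i1 in auto)
      also have "\<dots> = 2 * expectation (\<lambda>\<omega>. min 1 \<bar>\<Sum>i\<in>S. e n i \<omega>\<bar>) + 2 * expectation (\<lambda>\<omega>. min 1 \<bar>\<Sum>i\<in>{..<n}-S. e n i \<omega>\<bar>)"
        using i1 by simp
      also have "\<dots> \<le> 4 * r n" using subsums[OF S] subsums[of "{..<n}-S" n] by auto
      finally show ?thesis .
    qed
    then have "(\<Sum>S\<in>Pow {..<n}. 1 - expectation (c S)) \<le> (\<Sum>S\<in>Pow {..<n}. 4 * r n)"
      by (intro sum_mono) auto
    also have "(\<Sum>S\<in>Pow {..<n}. 1 - expectation (c S)) = 2 ^ n - expectation (\<lambda>\<omega>. \<Sum>S\<in>Pow {..<n}. c S \<omega>)"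
      using intc by (simp add: sum_subtractf card_Pow)
    also have "(\<lambda>\<omega>. \<Sum>S\<in>Pow {..<n}. c S \<omega>) = (\<lambda>\<omega>. 2 ^ n * P n \<omega>)"
      unfolding c_def P_def by (intro ext sum_Pow_cos)
    finally have "2 ^ n * (1 - expectation (P n)) \<le> 2 ^ n * (4 * r n)"
      by (simp add: card_Pow algebra_simps)
    then show ?thesis using intP by (simp add: prob_space)
  qed
  have "(\<lambda>n. expectation (\<lambda>\<omega>. min 1 (\<Sum>i<n. (e n i \<omega>)\<^sup>2))) \<longlonglongrightarrow> 0"
  proof (rule tendsto_sandwich[OF _ _ tendsto_const])
    \<comment> \<open>32 is the factor 8 of \<open>min_one_sum_squares_le\<close> times the factor 4
      of \<open>P\<close>.\<close>
    show "(\<lambda>n. 32 * r n + expectation (B n)) \<longlonglongrightarrow> 0"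
      using tendsto_add[OF tendsto_mult_right_zero[OF r, of 32] B] by (simp add: mult.commute)
    show "\<forall>\<^sub>F n in sequentially. expectation (\<lambda>\<omega>. min 1 (\<Sum>i<n. (e n i \<omega>)\<^sup>2)) \<le> 32 * r n + expectation (B n)"
    proof (rule always_eventually, rule allI)
      fix n
      have "expectation (\<lambda>\<omega>. min 1 (\<Sum>i<n. (e n i \<omega>)\<^sup>2)) \<le> expectation (\<lambda>\<omega>. 8 * (1 - P n \<omega>) + B n \<omega>)"
      proof (rule integral_mono)
        fix \<omega>
        show "min 1 (\<Sum>i<n. (e n i \<omega>)\<^sup>2) \<le> 8 * (1 - P n \<omega>) + B n \<omega>"
          using min_one_sum_squares_le[of n "\<lambda>i. e n i \<omega>"] P1[of n \<omega>]
          unfolding B_def P_def by auto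
        have "integrable M (\<lambda>\<omega>. min 1 (norm (\<Sum>i<n. (e n i \<omega>)\<^sup>2)))" by (rule integrable_min_norm) measurable
        then show "integrable M (\<lambda>\<omega>. min 1 (\<Sum>i<n. (e n i \<omega>)\<^sup>2))" by (simp add: sum_nonneg)
      qed (use intP intB in auto)
      also have "\<dots> = 8 * expectation (\<lambda>\<omega>. 1 - P n \<omega>) + expectation (B n)" using intP intB by simp
      also have "\<dots> \<le> 32 * r n + expectation (B n)" using P[of n] by simp
      finally show "expectation (\<lambda>\<omega>. min 1 (\<Sum>i<n. (e n i \<omega>)\<^sup>2)) \<le> 32 * r n + expectation (B n)" .
    qed
  qed (auto intro!: always_eventually integral_nonneg_AE sum_nonneg)
  then show ?thesis by (simp add: null_in_prob_def sum_nonneg)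
qed

end

lemma (in prob_space) expectation_min_one_sum_le:
  fixes X :: "'i \<Rightarrow> 'a \<Rightarrow> 'b::{banach, second_countable_topology}"
  assumes X: "\<And>i. i \<in> A \<Longrightarrow> X i \<in> borel_measurable M"
  shows "expectation (\<lambda>\<omega>. min 1 (norm (\<Sum>i\<in>A. X i \<omega>))) \<le> (\<Sum>i\<in>A. expectation (\<lambda>\<omega>. min 1 (norm (X i \<omega>))))"
proof -
  have *: "min 1 (norm (\<Sum>i\<in>A. X i \<omega>)) \<le> (\<Sum>i\<in>A. min 1 (norm (X i \<omega>)))" for \<omega>
  proof (induction A rule: infinite_finite_induct)
    case (insert i A)
    then show ?case using min_one_norm_triangle[of "X i \<omega>" "\<Sum>i\<in>A. X i \<omega>"] by simp
  qed auto
  have "expectation (\<lambda>\<omega>. min 1 (norm (\<Sum>i\<in>A. X i \<omega>))) \<le> expectation (\<lambda>\<omega>. \<Sum>i\<in>A. min 1 (norm (X i \<omega>)))"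
    using X by (intro integral_mono * integrable_min_norm Bochner_Integration.integrable_sum borel_measurable_sum)
  also have "\<dots> = (\<Sum>i\<in>A. expectation (\<lambda>\<omega>. min 1 (norm (X i \<omega>))))"
    using X by (intro Bochner_Integration.integral_sum integrable_min_norm)
  finally show ?thesis .
qed

text \<open>Turns the deviation probabilities in \<open>has_stratonovich_integral\<close> into the
  metric behind \<open>null_in_prob\<close>.\<close>

lemma (in prob_space) expectation_min_one_norm_le:
  fixes X :: "'a \<Rightarrow> 'b::{banach, second_countable_topology}"
  assumes X [measurable]: "X \<in> borel_measurable M" and e: "0 \<le> e"
  shows "expectation (\<lambda>\<omega>. min 1 (norm (X \<omega>))) \<le> e + prob {\<omega> \<in> space M. e < norm (X \<omega>)}"
proof -
  let ?A = "{\<omega> \<in> space M. e < norm (X \<omega>)}"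
  have A: "?A \<in> events" by measurable
  have iA: "integrable M (indicator ?A :: 'a \<Rightarrow> real)"
    by (rule integrable_const_bound[of _ 1]) (use A in auto)
  have "expectation (\<lambda>\<omega>. min 1 (norm (X \<omega>))) \<le> expectation (\<lambda>\<omega>. e + indicator ?A \<omega>)"
  proof (rule integral_mono)
    fix \<omega> assume "\<omega> \<in> space M"
    then show "min 1 (norm (X \<omega>)) \<le> e + indicator ?A \<omega>" using e by (auto simp: indicator_def min_def)
  qed (use iA in auto)
  also have "\<dots> = e + prob ?A" using A iA by (simp add: prob_space)
  finally show ?thesis .
qed

text \<open>The sum of the expectations is finite, so the series of the \<open>X n\<close> converges
  almost surely and its terms tend to 0.\<close>

lemma (in prob_space) geometric_decay_AE:
  fixes X :: "nat \<Rightarrow> 'a \<Rightarrow> real"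
  assumes X: "\<And>n. integrable M (X n)" "\<And>n. AE \<omega> in M. 0 \<le> X n \<omega>" and le: "\<And>n. expectation (X n) \<le> C * \<rho> ^ n"
    and \<rho>: "0 \<le> \<rho>" "\<rho> < 1"
  shows "AE \<omega> in M. (\<lambda>n. X n \<omega>) \<longlonglongrightarrow> 0"
proof -
  have [measurable]: "X n \<in> borel_measurable M" for n using X(1)[of n] by auto
  have C: "0 \<le> C" using order_trans[OF integral_nonneg_AE[OF X(2)[of 0]] le[of 0]] by simp
  have "(\<integral>\<^sup>+\<omega>. (\<Sum>n. ennreal (X n \<omega>)) \<partial>M) = (\<Sum>n. \<integral>\<^sup>+\<omega>. ennreal (X n \<omega>) \<partial>M)"
    by (rule nn_integral_suminf) measurable
  also have "\<dots> = (\<Sum>n. ennreal (expectation (X n)))"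
    by (intro suminf_cong nn_integral_eq_integral X)
  also have "\<dots> \<le> (\<Sum>n. ennreal (C * \<rho> ^ n))"
    by (intro suminf_le ennreal_leI le) auto
  finally have le': "(\<integral>\<^sup>+\<omega>. (\<Sum>n. ennreal (X n \<omega>)) \<partial>M) \<le> (\<Sum>n. ennreal (C * \<rho> ^ n))" .
  have "(\<Sum>n. ennreal (C * \<rho> ^ n)) < \<infinity>"
  proof -
    have "summable (\<lambda>n. C * \<rho> ^ n)" using \<rho> by (intro summable_mult summable_geometric) auto
    then have "(\<Sum>n. ennreal (C * \<rho> ^ n)) = ennreal (\<Sum>n. C * \<rho> ^ n)" using C \<rho> by (intro suminf_ennreal2) auto
    then show ?thesis by simp
  qed
  with le' have "(\<integral>\<^sup>+\<omega>. (\<Sum>n. ennreal (X n \<omega>)) \<partial>M) \<noteq> \<infinity>" by (metis le_less_trans less_irrefl)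
  then have "AE \<omega> in M. (\<Sum>n. ennreal (X n \<omega>)) \<noteq> \<infinity>" by (intro nn_integral_PInf_AE) measurable
  moreover have "AE \<omega> in M. \<forall>n. 0 \<le> X n \<omega>" unfolding AE_all_countable using X(2) by blast
  ultimately show ?thesis
  proof eventually_elim
    case (elim \<omega>)
    then have "summable (\<lambda>n. X n \<omega>)" by (intro summable_suminf_not_top) auto
    then show ?case by (rule summable_LIMSEQ_zero)
  qed
qed

subsection \<open>The pathwise equation\<close>

text \<open>
  Here \<open>w = sqrt 2 \<epsilon> W\<close> and \<open>v = \<epsilon>\<^sup>2\<close>. Continuity and the initial values are required for every outcome,
  which is achieved by modifying the processes on a null set.
\<close>

locale rotation_equation = prob_space M for M :: "'a measure" +
  fixes F :: "real \<Rightarrow> 'a measure" and w :: "real \<Rightarrow> 'a \<Rightarrow> real" and h :: "real \<Rightarrow> 'a \<Rightarrow> complex"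
    and b :: "complex \<Rightarrow> complex" and v :: real and x :: complex
  assumes subalgebra: "0 \<le> t \<Longrightarrow> subalgebra M (F t)"
    and sets_mono: "0 \<le> s \<Longrightarrow> s \<le> t \<Longrightarrow> sets (F s) \<subseteq> sets (F t)"
    and w_adapted: "0 \<le> t \<Longrightarrow> w t \<in> borel_measurable (F t)"
    and h_adapted: "0 \<le> t \<Longrightarrow> h t \<in> borel_measurable (F t)"
    and w_continuous: "continuous_on {0..} (\<lambda>t. w t \<omega>)"
    and h_continuous: "continuous_on {0..} (\<lambda>t. h t \<omega>)"
    and w_0: "w 0 \<omega> = 0"
    and h_0: "h 0 \<omega> = x"
    and b_continuous: "continuous_on UNIV b"
    and v_nonneg: "v \<ge> 0"
    and expectation_cis_increment: "0 \<le> s \<Longrightarrow> s \<le> t \<Longrightarrow> Y \<in> borel_measurable (F s) \<Longrightarrow> integrable M Y \<Longrightarrow>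
      expectation (\<lambda>\<omega>. Y \<omega> * cis (k * (w t \<omega> - w s \<omega>))) = expectation Y * exp (- (k\<^sup>2 * v * (t - s)))"
    and square_increment_integrable: "0 \<le> s \<Longrightarrow> s \<le> t \<Longrightarrow> integrable M (\<lambda>\<omega>. (w t \<omega> - w s \<omega>)\<^sup>2)"
    and expectation_square_increment: "0 \<le> s \<Longrightarrow> s \<le> t \<Longrightarrow> expectation (\<lambda>\<omega>. (w t \<omega> - w s \<omega>)\<^sup>2) = 2 * v * (t - s)"
    and trapezoidal: "0 \<le> t \<Longrightarrow> 0 < e \<Longrightarrow> \<exists>\<delta>>0. \<forall>n p. is_partition t n p \<and> (\<forall>i<n. p (Suc i) - p i < \<delta>) \<longrightarrow>
      expectation (\<lambda>\<omega>. min 1 (cmod ((\<Sum>i<n. (h (p i) \<omega> + h (p (Suc i)) \<omega>) / 2 * (\<i> * complex_of_real (w (p (Suc i)) \<omega> - w (p i) \<omega>)))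
        - (h t \<omega> - x - integral {0..t} (\<lambda>s. b (h s \<omega>)))))) < e"
begin

lemma measurable_F_M: "f \<in> borel_measurable (F t) \<Longrightarrow> 0 \<le> t \<Longrightarrow> f \<in> borel_measurable M"
  using measurable_from_subalg[OF subalgebra] by blast

lemma measurable_F_mono:
  assumes "f \<in> borel_measurable (F s)" "0 \<le> s" "s \<le> t"
  shows "f \<in> borel_measurable (F t)"
proof -
  have "subalgebra (F t) (F s)"
    using subalgebra[of s] subalgebra[of t] sets_mono[of s t] assms by (auto simp: subalgebra_def)
  then show ?thesis using assms(1) measurable_from_subalg by blast
qed

lemma w_measurable: "0 \<le> t \<Longrightarrow> w t \<in> borel_measurable M"
  using w_adapted measurable_F_M by blast

lemma h_measurable: "0 \<le> t \<Longrightarrow> h t \<in> borel_measurable M"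
  using h_adapted measurable_F_M by blast

text \<open>The path integral is a limit of Riemann sums, and these use values of \<open>X\<close>
  up to time \<open>t\<close> only.\<close>

lemma integral_adapted:
  fixes X :: "real \<Rightarrow> 'a \<Rightarrow> 'b::{banach, second_countable_topology}"
  assumes X: "\<And>s. 0 \<le> s \<Longrightarrow> X s \<in> borel_measurable (F s)" "\<And>\<omega>. continuous_on {0..t} (\<lambda>s. X s \<omega>)" and t: "0 \<le> t"
  shows "(\<lambda>\<omega>. integral {0..t} (\<lambda>s. X s \<omega>)) \<in> borel_measurable (F t)"
proof (rule borel_measurable_LIMSEQ_metric)
  show "(\<lambda>n. \<Sum>i<n. (t / real n) *\<^sub>R X (grid t n i) \<omega>) \<longlonglongrightarrow> integral {0..t} (\<lambda>s. X s \<omega>)" for \<omega>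
    by (rule riemann_sum_tendsto[OF X(2) t])
  show "(\<lambda>\<omega>. \<Sum>i<n. (t / real n) *\<^sub>R X (grid t n i) \<omega>) \<in> borel_measurable (F t)" for n
  proof (intro borel_measurable_sum borel_measurable_scaleR borel_measurable_const)
    fix i assume "i \<in> {..<n}"
    then have "i < n" "n > 0" by auto
    from uniform_partition_le[OF this(2) t this(1)] show "X (grid t n i) \<in> borel_measurable (F t)"
      by (intro measurable_F_mono[OF X(1)]) auto
  qed
qed

text \<open>By the equation, \<open>R t\<close> is the Stratonovich integral \<open>\<integral>\<^sub>0\<^sup>t \<i> h \<circ> dw\<close>.\<close>

definition J :: "real \<Rightarrow> 'a \<Rightarrow> complex" where "J t \<omega> = integral {0..t} (\<lambda>s. b (h s \<omega>))"

definition R :: "real \<Rightarrow> 'a \<Rightarrow> complex" where "R t \<omega> = h t \<omega> - x - J t \<omega>"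

definition trap :: "real \<Rightarrow> real \<Rightarrow> 'a \<Rightarrow> complex" where
  "trap r s \<omega> = (h r \<omega> + h s \<omega>) / 2 * (\<i> * complex_of_real (w s \<omega> - w r \<omega>))"

definition err :: "real \<Rightarrow> nat \<Rightarrow> nat \<Rightarrow> 'a \<Rightarrow> complex" where
  "err t n i \<omega> = R (grid t n (Suc i)) \<omega> - R (grid t n i) \<omega>
     - trap (grid t n i) (grid t n (Suc i)) \<omega>"

lemma b_h_continuous: "continuous_on {0..} (\<lambda>t. b (h t \<omega>))"
  using continuous_on_compose2[OF b_continuous h_continuous] by auto

lemma b_measurable: "b \<in> borel_measurable borel"
  using b_continuous by (rule borel_measurable_continuous_onI)

lemma J_adapted: "0 \<le> t \<Longrightarrow> J t \<in> borel_measurable (F t)"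
  unfolding J_def by (intro integral_adapted continuous_on_subset[OF b_h_continuous] measurable_compose[OF h_adapted b_measurable]) auto

lemma J_continuous: "continuous_on {0..t} (\<lambda>s. J s \<omega>)"
  unfolding J_def
  by (intro indefinite_integral_continuous_1 integrable_continuous_interval continuous_on_subset[OF b_h_continuous]) auto

lemma R_measurable: "0 \<le> t \<Longrightarrow> R t \<in> borel_measurable M"
  unfolding R_def using h_measurable measurable_F_M[OF J_adapted] by simp

lemma R_continuous: "continuous_on {0..t} (\<lambda>s. R s \<omega>)"
  unfolding R_def by (intro continuous_intros J_continuous continuous_on_subset[OF h_continuous]) auto

lemma R_0 [simp]: "R 0 \<omega> = 0" by (simp add: R_def J_def h_0)

lemma trap_measurable: "0 \<le> r \<Longrightarrow> 0 \<le> s \<Longrightarrow> trap r s \<in> borel_measurable M"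
  unfolding trap_def using h_measurable[of r] h_measurable[of s] w_measurable[of r] w_measurable[of s] by simp

lemma trap_refl [simp]: "trap r r \<omega> = 0" by (simp add: trap_def)

lemma err_measurable: "0 \<le> t \<Longrightarrow> err t n i \<in> borel_measurable M"
  unfolding err_def by (intro borel_measurable_diff R_measurable trap_measurable) auto

section \<open>Local errors of the trapezoidal rule\<close>

lemma trapezoidal':
  assumes "0 \<le> t" "0 < e"
  obtains \<delta> where "\<delta> > 0" "\<And>n p. is_partition t n p \<Longrightarrow> (\<And>i. i < n \<Longrightarrow> p (Suc i) - p i < \<delta>) \<Longrightarrow>
     expectation (\<lambda>\<omega>. min 1 (cmod ((\<Sum>i<n. trap (p i) (p (Suc i)) \<omega>) - R t \<omega>))) < e"
  using trapezoidal[OF assms] unfolding trap_def R_def J_def by blast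

text \<open>
  The integral over a union of blocks is compared with the trapezoidal sum of a partition that
  is coarse (one step per block) on \<open>S\<close> and fine on the other blocks; the coarse steps are
  encoded with repeated points so that every block has \<open>N\<close> steps.
\<close>

lemma expectation_err_subsum:
  assumes t: "t \<ge> 0" and \<eta>: "\<eta> > 0"
  shows "\<forall>\<^sub>F n in sequentially. \<forall>S\<subseteq>{..<n}. expectation (\<lambda>\<omega>. min 1 (cmod (\<Sum>i\<in>S. err t n i \<omega>))) \<le> \<eta>"
proof -
  obtain \<delta> where \<delta>: "\<delta> > 0" "\<And>n p. is_partition t n p \<Longrightarrow> (\<And>i. i < n \<Longrightarrow> p (Suc i) - p i < \<delta>) \<Longrightarrow>
     expectation (\<lambda>\<omega>. min 1 (cmod ((\<Sum>i<n. trap (p i) (p (Suc i)) \<omega>) - R t \<omega>))) < \<eta> / 2"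
    using trapezoidal'[OF t, of "\<eta>/2"] \<eta> by auto
  have "(\<lambda>n. t / real n) \<longlonglongrightarrow> 0" by real_asymp
  then have "\<forall>\<^sub>F n in sequentially. t / real n < \<delta>" using \<delta>(1) order_tendstoD(2) by blast
  then show ?thesis
    using eventually_gt_at_top[of 0]
  proof eventually_elim
    case (elim n)
    note n = elim(2)
    show ?case
    proof (intro allI impI)
      fix S assume S: "S \<subseteq> {..<n}"
      \<comment> \<open>\<open>q N\<close> splits each of the \<open>n\<close> blocks into
        \<open>N\<close> steps. \<open>U N i\<close> is the error of the fine trapezoidal sum over
        the first \<open>i\<close> blocks, so the difference of two consecutive ones is the error on
        a single block.\<close>
      define q where "q N k = real k * t / real (n * N)" for N k
      define U where "U N i \<omega> = (\<Sum>k<i * N. trap (q N k) (q N (Suc k)) \<omega>) - R (grid t n i) \<omega>" for N i \<omega>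
      have q_nonneg: "0 \<le> q N k" for N k using t by (simp add: q_def)
      have U_meas: "U N i \<in> borel_measurable M" for N i
        unfolding U_def using t q_nonneg by (intro borel_measurable_diff borel_measurable_sum R_measurable trap_measurable) auto
      \<comment> \<open>Here \<open>n\<close> is fixed, so finitely many instances of the hypothesis
        yield a common \<open>N\<close>. Every fine block costs two of the \<open>U\<close>, which
        adds up to at most \<open>\<eta> / 2\<close> over all blocks.\<close>
      have "\<forall>\<^sub>F N in sequentially. \<forall>i\<in>{..n}. expectation (\<lambda>\<omega>. min 1 (cmod (U N i \<omega>))) < \<eta> / (4 * real n)"
      proof (rule eventually_ball_finite)
        show "\<forall>i\<in>{..n}. \<forall>\<^sub>F N in sequentially. expectation (\<lambda>\<omega>. min 1 (cmod (U N i \<omega>))) < \<eta> / (4 * real n)"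
        proof
          fix i assume "i \<in> {..n}"
          have "0 \<le> grid t n i" "0 < \<eta> / (4 * real n)" using t \<eta> n by auto
          then obtain d where d: "d > 0" "\<And>m p. is_partition (grid t n i) m p \<Longrightarrow> (\<And>k. k < m \<Longrightarrow> p (Suc k) - p k < d) \<Longrightarrow>
             expectation (\<lambda>\<omega>. min 1 (cmod ((\<Sum>k<m. trap (p k) (p (Suc k)) \<omega>) - R (grid t n i) \<omega>))) < \<eta> / (4 * real n)"
            using trapezoidal' by blast
          have "(\<lambda>N. t / (real n * real N)) \<longlonglongrightarrow> 0" using n by real_asymp
          then have "\<forall>\<^sub>F N in sequentially. t / (real n * real N) < d" using d(1) order_tendstoD(2) by blast
          then show "\<forall>\<^sub>F N in sequentially. expectation (\<lambda>\<omega>. min 1 (cmod (U N i \<omega>))) < \<eta> / (4 * real n)"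
            using eventually_gt_at_top[of 0]
          proof eventually_elim
            case (elim N)
            have step: "q N (Suc k) - q N k = t / (real n * real N)" for k
              by (simp add: q_def add_divide_distrib distrib_right)
            have "is_partition (grid t n i) (i * N) (q N)"
              unfolding is_partition_def q_def using elim n t by (auto simp: divide_right_mono mult_right_mono)
            then show ?case unfolding U_def using elim step by (intro d(2)) auto
          qed
        qed
      qed auto
      from eventually_happens'[OF sequentially_bot eventually_conj[OF this eventually_gt_at_top[of 0]]]
      obtain N where N: "N > 0" "\<And>i. i \<le> n \<Longrightarrow> expectation (\<lambda>\<omega>. min 1 (cmod (U N i \<omega>))) < \<eta> / (4 * real n)"
        by auto
      \<comment> \<open>On a block in \<open>S\<close> all points stay at its left end, and the last
        step jumps across the whole block; on the other blocks \<open>p\<close> is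
        \<open>q N\<close>.\<close>
      define p where "p k = (if k div N \<in> S then real (k div N) * t / real n else q N k)" for k
      have q_block: "q N (i * N) = grid t n i" for i using N by (simp add: q_def)
      have p_block: "p (i * N) = grid t n i" for i
        using N q_block by (simp add: p_def)
      have p_in: "p (i * N + j) = (if i \<in> S then grid t n i else q N (i * N + j))" if "j < N" for i j
        using that N by (simp add: p_def)
      have q_mono: "q N k \<le> q N l" if "k \<le> l" for k l
        using that t by (auto simp: q_def intro!: divide_right_mono mult_right_mono)
      \<comment> \<open>\<open>p k\<close> and \<open>p (Suc k)\<close> lie between the ends of one
        block, so no step is longer than \<open>t / n\<close>, which is below
        \<open>\<delta>\<close>.\<close>
      have p_steps: "p k \<le> p (Suc k) \<and> p (Suc k) - p k < \<delta>" for k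
      proof -
        define i j where "i = k div N" and "j = k mod N"
        have k: "k = i * N + j" and j: "j < N" using N by (auto simp: i_def j_def)
        have lo: "grid t n i \<le> p k"
          unfolding k p_in[OF j] using q_mono[of "i * N" "i * N + j"] q_block[of i] by auto
        have hi: "p k \<le> q N k"
          unfolding k p_in[OF j] using q_mono[of "i * N" "i * N + j"] q_block[of i] by auto
        have sk: "q N (Suc k) \<le> grid t n (Suc i)"
          unfolding q_block[symmetric] by (rule q_mono) (use k j in auto)
        have hi': "p (Suc k) \<le> grid t n (Suc i) \<and> p k \<le> p (Suc k)"
        proof (cases "Suc j < N")
          case True
          have "p (Suc k) = (if i \<in> S then grid t n i else q N (Suc k))" using p_in[OF True, of i] k by simp
          moreover have "p k = (if i \<in> S then grid t n i else q N k)" using p_in[OF j, of i] k by simp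
          moreover have "grid t n i \<le> grid t n (Suc i)"
            using t by (intro divide_right_mono mult_right_mono) auto
          ultimately show ?thesis using sk q_mono[of k "Suc k"] by auto
        next
          case False
          with j k have "Suc k = Suc i * N" by simp
          then have "p (Suc k) = grid t n (Suc i)" using p_block by metis
          moreover have "q N k \<le> q N (Suc k)" by (rule q_mono) simp
          ultimately show ?thesis using hi sk by linarith
        qed
        have "grid t n (Suc i) - grid t n i = t / real n" by (simp add: distrib_right add_divide_distrib)
        then show ?thesis using hi' lo elim(1) by linarith
      qed
      have "is_partition t (n * N) p"
        unfolding is_partition_def using p_steps p_block[of 0] p_block[of n] n by auto
      then have main: "expectation (\<lambda>\<omega>. min 1 (cmod ((\<Sum>k<n * N. trap (p k) (p (Suc k)) \<omega>) - R t \<omega>))) < \<eta> / 2"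
        using p_steps by (intro \<delta>(2)) auto
      \<comment> \<open>On a coarse block the stationary steps contribute 0 and one trapezoid
        remains; on a fine block the sum is expressed by the errors \<open>U\<close> and the
        increment of \<open>R\<close>.\<close>
      have block: "(\<Sum>k\<in>{i * N..<i * N + N}. trap (p k) (p (Suc k)) \<omega>) =
          (if i \<in> S then trap (grid t n i) (grid t n (Suc i)) \<omega>
           else U N (Suc i) \<omega> - U N i \<omega> + R (grid t n (Suc i)) \<omega> - R (grid t n i) \<omega>)" for i \<omega>
      proof (cases "i \<in> S")
        case True
        obtain N' where N': "N = Suc N'" using N by (cases N) auto
        have e1: "p (i * N + j) = grid t n i" if "j \<le> N'" for j using p_in[of j i] that N' True by simp
        have e2: "p (Suc (i * N + N')) = grid t n (Suc i)"
          using p_block[of "Suc i"] N' by (simp add: add.commute add.left_commute)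
        have "(\<Sum>k\<in>{i * N..<i * N + N}. trap (p k) (p (Suc k)) \<omega>) = (\<Sum>j<Suc N'. trap (p (i * N + j)) (p (Suc (i * N + j))) \<omega>)"
          unfolding N' using sum.shift_bounds_nat_ivl[of "\<lambda>k. trap (p k) (p (Suc k)) \<omega>" 0 "i * Suc N'" "Suc N'"]
          by (simp add: lessThan_atLeast0 add.commute)
        also have "\<dots> = (\<Sum>j<N'. trap (p (i * N + j)) (p (Suc (i * N + j))) \<omega>) + trap (grid t n i) (grid t n (Suc i)) \<omega>"
          using e1[of N'] e2 by simp
        also have "(\<Sum>j<N'. trap (p (i * N + j)) (p (Suc (i * N + j))) \<omega>) = 0"
        proof (rule sum.neutral, rule ballI)
          fix j assume "j \<in> {..<N'}"
          then have "p (i * N + j) = grid t n i" "p (Suc (i * N + j)) = grid t n i"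
            using e1[of j] e1[of "Suc j"] by auto
          then show "trap (p (i * N + j)) (p (Suc (i * N + j))) \<omega> = 0" by simp
        qed
        finally show ?thesis using True by simp
      next
        case False
        have "(\<Sum>k\<in>{i * N..<i * N + N}. trap (p k) (p (Suc k)) \<omega>) = (\<Sum>k\<in>{i * N..<i * N + N}. trap (q N k) (q N (Suc k)) \<omega>)"
        proof (rule sum.cong[OF refl])
          fix k assume "k \<in> {i * N..<i * N + N}"
          then obtain j where j: "k = i * N + j" "j < N" by (metis atLeastLessThan_iff le_add_diff_inverse nat_add_left_cancel_less)
          have "p k = q N k" unfolding j(1) p_in[OF j(2)] using False by simp
          moreover have "p (Suc k) = q N (Suc k)"
          proof (cases "Suc j < N")
            case True
            then show ?thesis using p_in[OF True, of i] j(1) False by simp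
          next
            case False
            then have "Suc k = Suc i * N" using j by simp
            then show ?thesis using p_block q_block by metis
          qed
          ultimately show "trap (p k) (p (Suc k)) \<omega> = trap (q N k) (q N (Suc k)) \<omega>" by simp
        qed
        also have "\<dots> = (\<Sum>k<Suc i * N. trap (q N k) (q N (Suc k)) \<omega>) - (\<Sum>k<i * N. trap (q N k) (q N (Suc k)) \<omega>)"
          using sum_diff_nat_ivl[of 0 "i * N" "i * N + N" "\<lambda>k. trap (q N k) (q N (Suc k)) \<omega>"]
          by (simp add: lessThan_atLeast0 add.commute)
        finally show ?thesis using False by (simp add: U_def)
      qed
      define V where "V i \<omega> = U N (Suc i) \<omega> - U N i \<omega>" for i \<omega>
      have V_meas: "V i \<in> borel_measurable M" for i unfolding V_def using U_meas by auto
      have tele: "(\<Sum>i<n. R (grid t n (Suc i)) \<omega> - R (grid t n i) \<omega>) = R t \<omega>" for \<omega>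
        using sum_lessThan_telescope[of "\<lambda>i. R (grid t n i) \<omega>" n] n by simp
      \<comment> \<open>Solved for the subsum in question: what remains is the error of the mixed
        partition and the errors \<open>V i\<close> of the fine blocks.\<close>
      have decomp: "(\<Sum>i\<in>S. err t n i \<omega>) = - ((\<Sum>k<n * N. trap (p k) (p (Suc k)) \<omega>) - R t \<omega>) + (\<Sum>i\<in>{..<n}-S. V i \<omega>)" for \<omega>
      proof -
        have "(\<Sum>k<n * N. trap (p k) (p (Suc k)) \<omega>) = (\<Sum>i<n. \<Sum>k\<in>{i * N..<i * N + N}. trap (p k) (p (Suc k)) \<omega>)"
          by (rule sum.nat_group[symmetric])
        also have "\<dots> = (\<Sum>i<n. (R (grid t n (Suc i)) \<omega> - R (grid t n i) \<omega>) + (if i \<in> S then - err t n i \<omega> else V i \<omega>))"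
          unfolding block by (rule sum.cong[OF refl]) (auto simp: err_def V_def)
        also have "\<dots> = R t \<omega> + (\<Sum>i<n. (if i \<in> S then - err t n i \<omega> else V i \<omega>))"
          by (simp only: sum.distrib tele)
        also have "(\<Sum>i<n. (if i \<in> S then - err t n i \<omega> else V i \<omega>)) = - (\<Sum>i\<in>S. err t n i \<omega>) + (\<Sum>i\<in>{..<n}-S. V i \<omega>)"
        proof -
          have "{..<n} \<inter> {i. i \<in> S} = S" "{..<n} \<inter> - {i. i \<in> S} = {..<n} - S" using S by auto
          then show ?thesis by (simp add: sum.If_cases sum_negf)
        qed
        finally show ?thesis by simp
      qed
      have V_small: "expectation (\<lambda>\<omega>. min 1 (cmod (V i \<omega>))) \<le> \<eta> / (2 * real n)" if "i < n" for i
      proof -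
        have "expectation (\<lambda>\<omega>. min 1 (cmod (V i \<omega>))) \<le> expectation (\<lambda>\<omega>. min 1 (cmod (U N (Suc i) \<omega>)) + min 1 (cmod (U N i \<omega>)))"
        proof (rule integral_mono)
          fix \<omega> show "min 1 (cmod (V i \<omega>)) \<le> min 1 (cmod (U N (Suc i) \<omega>)) + min 1 (cmod (U N i \<omega>))"
            using min_one_norm_triangle[of "U N (Suc i) \<omega>" "- U N i \<omega>"] by (simp add: V_def)
        qed (use U_meas V_meas in auto)
        also have "\<dots> = expectation (\<lambda>\<omega>. min 1 (cmod (U N (Suc i) \<omega>))) + expectation (\<lambda>\<omega>. min 1 (cmod (U N i \<omega>)))"
          using U_meas by simp
        also have "\<dots> \<le> \<eta> / (4 * real n) + \<eta> / (4 * real n)"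
          using N(2)[of i] N(2)[of "Suc i"] that by simp
        finally show ?thesis by (simp add: field_simps)
      qed
      have p_nonneg: "0 \<le> p k" for k using q_nonneg t by (simp add: p_def)
      define Z where "Z \<omega> = (\<Sum>k<n * N. trap (p k) (p (Suc k)) \<omega>) - R t \<omega>" for \<omega>
      have Z_meas: "Z \<in> borel_measurable M"
        unfolding Z_def using p_nonneg t by (intro borel_measurable_diff borel_measurable_sum R_measurable trap_measurable) auto
      have VS_meas: "(\<lambda>\<omega>. \<Sum>i\<in>{..<n}-S. V i \<omega>) \<in> borel_measurable M" using V_meas by simp
      have "expectation (\<lambda>\<omega>. min 1 (cmod (\<Sum>i\<in>S. err t n i \<omega>))) \<le> expectation (\<lambda>\<omega>. min 1 (cmod (Z \<omega>)) + min 1 (cmod (\<Sum>i\<in>{..<n}-S. V i \<omega>)))"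
      proof (rule integral_mono)
        fix \<omega> show "min 1 (cmod (\<Sum>i\<in>S. err t n i \<omega>)) \<le> min 1 (cmod (Z \<omega>)) + min 1 (cmod (\<Sum>i\<in>{..<n}-S. V i \<omega>))"
          using min_one_norm_triangle[of "- Z \<omega>" "\<Sum>i\<in>{..<n}-S. V i \<omega>"] unfolding decomp Z_def norm_minus_cancel .
        show "integrable M (\<lambda>\<omega>. min 1 (cmod (\<Sum>i\<in>S. err t n i \<omega>)))"
          using err_measurable[OF t] by (intro integrable_min_norm borel_measurable_sum) auto
      qed (use Z_meas VS_meas in auto)
      also have "\<dots> = expectation (\<lambda>\<omega>. min 1 (cmod (Z \<omega>))) + expectation (\<lambda>\<omega>. min 1 (cmod (\<Sum>i\<in>{..<n}-S. V i \<omega>)))"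
        using Z_meas VS_meas by (simp del: sum_subtractf)
      also have "expectation (\<lambda>\<omega>. min 1 (cmod (\<Sum>i\<in>{..<n}-S. V i \<omega>))) \<le> (\<Sum>i\<in>{..<n}-S. \<eta> / (2 * real n))"
        by (rule order_trans[OF expectation_min_one_sum_le sum_mono]) (use V_meas V_small in auto)
      also have "\<dots> \<le> (\<Sum>i\<in>{..<n}. \<eta> / (2 * real n))" using \<eta> by (intro sum_mono2) auto
      also have "\<dots> = \<eta> / 2" using n by simp
      finally show "expectation (\<lambda>\<omega>. min 1 (cmod (\<Sum>i\<in>S. err t n i \<omega>))) \<le> \<eta>"
        using main unfolding Z_def by linarith
    qed
  qed
qed

lemma err_small:
  assumes t: "0 \<le> t"
  shows "\<forall>\<^sub>F n in sequentially. \<forall>i<n. cmod (err t n i \<omega>) \<le> 1"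
proof -
  obtain A1 where A1: "A1 \<longlonglongrightarrow> 0" "\<And>n. A1 n \<ge> 0"
    "\<And>n i. i < n \<Longrightarrow> norm (R (grid t n (Suc i)) \<omega> - R (grid t n i) \<omega>) \<le> A1 n"
    using uniform_partition_modulus[OF R_continuous t] by blast
  obtain A2 where A2: "A2 \<longlonglongrightarrow> 0" "\<And>n. A2 n \<ge> 0"
    "\<And>n i. i < n \<Longrightarrow> norm (w (grid t n (Suc i)) \<omega> - w (grid t n i) \<omega>) \<le> A2 n"
    using uniform_partition_modulus[OF continuous_on_subset[OF w_continuous] t] by (metis atLeastAtMost_iff atLeast_iff subsetI)
  obtain H where H: "H \<ge> 0" "\<And>s. s \<in> {0..t} \<Longrightarrow> cmod (h s \<omega>) \<le> H"
    using path_bounded[OF continuous_on_subset[OF h_continuous]] by (metis atLeastAtMost_iff atLeast_iff subsetI)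
  have "(\<lambda>n. A1 n + H * A2 n) \<longlonglongrightarrow> 0 + H * 0" by (intro tendsto_intros A1 A2)
  then have "\<forall>\<^sub>F n in sequentially. A1 n + H * A2 n < 1" using order_tendstoD(2)[of _ "0 + H * 0" _ 1] by simp
  then show ?thesis
  proof eventually_elim
    case (elim n)
    show ?case
    proof (intro allI impI)
      fix i assume i: "i < n"
      let ?r = "grid t n i" and ?s = "grid t n (Suc i)"
      have rs: "?r \<in> {0..t}" "?s \<in> {0..t}" using uniform_point[of i n] uniform_point[of "Suc i" n] i t by auto
      have "cmod ((h ?r \<omega> + h ?s \<omega>) / 2) \<le> H"
        using norm_triangle_ineq[of "h ?r \<omega>" "h ?s \<omega>"] H(2)[OF rs(1)] H(2)[OF rs(2)] by simp
      then have "cmod (trap ?r ?s \<omega>) \<le> H * A2 n"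
        unfolding trap_def norm_mult using A2(3)[OF i] H by (intro mult_mono) (auto simp: simp flip: of_real_diff)
      then have "cmod (err t n i \<omega>) \<le> A1 n + H * A2 n"
        unfolding err_def using A1(3)[OF i] norm_triangle_ineq4[of "R ?s \<omega> - R ?r \<omega>" "trap ?r ?s \<omega>"] by linarith
      then show "cmod (err t n i \<omega>) \<le> 1" using elim by linarith
    qed
  qed
qed

text \<open>The maximum over the finitely many subsets is one rate valid for all of them, as
  \<open>null_in_prob_sum_squares\<close> demands.\<close>

lemma err_subsum_bound:
  assumes t: "t \<ge> 0"
  obtains r where "r \<longlonglongrightarrow> 0" "\<And>n S. S \<subseteq> {..<n} \<Longrightarrow> expectation (\<lambda>\<omega>. min 1 (cmod (\<Sum>i\<in>S. err t n i \<omega>))) \<le> r n"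
proof
  define g where "g n S = expectation (\<lambda>\<omega>. min 1 (cmod (\<Sum>i\<in>S. err t n i \<omega>)))" for n S
  define r where "r n = Max (g n ` Pow {..<n})" for n
  show le: "expectation (\<lambda>\<omega>. min 1 (cmod (\<Sum>i\<in>S. err t n i \<omega>))) \<le> r n" if "S \<subseteq> {..<n}" for n S
    unfolding r_def g_def[symmetric] using that by (intro Max_ge) auto
  have "0 \<le> g n {}" for n by (simp add: g_def)
  then have r0: "0 \<le> r n" for n using le[of "{}" n] by (simp add: g_def)
  show "r \<longlonglongrightarrow> 0"
  proof (rule metric_LIMSEQ_I)
    fix e :: real assume "e > 0"
    then have "\<forall>\<^sub>F n in sequentially. \<forall>S\<subseteq>{..<n}. g n S \<le> e / 2"
      unfolding g_def by (intro expectation_err_subsum t) auto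
    then have "\<forall>\<^sub>F n in sequentially. dist (r n) 0 < e"
    proof eventually_elim
      case (elim n)
      then have "r n \<le> e / 2" unfolding r_def by (subst Max_le_iff) auto
      then show ?case using r0[of n] \<open>e > 0\<close> by simp
    qed
    then show "\<exists>N. \<forall>n\<ge>N. dist (r n) 0 < e" by (simp add: eventually_sequentially)
  qed
qed

lemma null_in_prob_sum_err:
  assumes t: "t \<ge> 0"
  shows "null_in_prob (\<lambda>n \<omega>. \<Sum>i<n. err t n i \<omega>)"
proof -
  obtain r where r: "r \<longlonglongrightarrow> 0" "\<And>n S. S \<subseteq> {..<n} \<Longrightarrow> expectation (\<lambda>\<omega>. min 1 (cmod (\<Sum>i\<in>S. err t n i \<omega>))) \<le> r n"
    using err_subsum_bound[OF t] by blast
  have "(\<lambda>n. expectation (\<lambda>\<omega>. min 1 (cmod (\<Sum>i<n. err t n i \<omega>)))) \<longlonglongrightarrow> 0"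
    by (rule tendsto_sandwich[OF _ _ tendsto_const r(1)]) (use r(2) in \<open>auto intro!: always_eventually integral_nonneg_AE\<close>)
  then show ?thesis unfolding null_in_prob_def using err_measurable[OF t] by simp
qed

lemma null_in_prob_sum_square_err:
  assumes t: "t \<ge> 0"
  shows "null_in_prob (\<lambda>n \<omega>. \<Sum>i<n. (cmod (err t n i \<omega>))\<^sup>2)"
proof -
  obtain r where r: "r \<longlonglongrightarrow> 0" "\<And>n S. S \<subseteq> {..<n} \<Longrightarrow> expectation (\<lambda>\<omega>. min 1 (cmod (\<Sum>i\<in>S. err t n i \<omega>))) \<le> r n"
    using err_subsum_bound[OF t] by blast
  have em: "err t n i \<in> borel_measurable M" for n i by (rule err_measurable[OF t])
  \<comment> \<open>\<open>f\<close> stands for \<open>Re\<close> or \<open>Im\<close>: the argument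
    with random signs concerns real summands, so the two parts are treated separately.\<close>
  have part: "null_in_prob (\<lambda>n \<omega>. \<Sum>i<n. (f (err t n i \<omega>))\<^sup>2)"
    if f: "\<And>z. \<bar>f z\<bar> \<le> cmod z" "\<And>A g. f (sum g (A :: nat set)) = (\<Sum>i\<in>A. f (g i))" "f \<in> borel_measurable borel"
    for f :: "complex \<Rightarrow> real"
  proof (rule null_in_prob_sum_squares[OF _ r(1)])
    show fm: "(\<lambda>\<omega>. f (err t n i \<omega>)) \<in> borel_measurable M" for n i
      using measurable_compose[OF em f(3)] .
    show "AE \<omega> in M. \<forall>\<^sub>F n in sequentially. \<forall>i<n. \<bar>f (err t n i \<omega>)\<bar> \<le> 1"
    proof (rule AE_I2)
      fix \<omega> show "\<forall>\<^sub>F n in sequentially. \<forall>i<n. \<bar>f (err t n i \<omega>)\<bar> \<le> 1"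
        using err_small[OF t, of \<omega>] by eventually_elim (meson f(1) order_trans)
    qed
    fix n :: nat and S assume S: "S \<subseteq> {..<n}"
    have "expectation (\<lambda>\<omega>. min 1 \<bar>\<Sum>i\<in>S. f (err t n i \<omega>)\<bar>) \<le> expectation (\<lambda>\<omega>. min 1 (cmod (\<Sum>i\<in>S. err t n i \<omega>)))"
    proof (rule integral_mono)
      show "integrable M (\<lambda>\<omega>. min 1 \<bar>\<Sum>i\<in>S. f (err t n i \<omega>)\<bar>)"
        using integrable_min_norm[OF borel_measurable_sum[of S "\<lambda>i \<omega>. f (err t n i \<omega>)"]] fm by simp
      show "integrable M (\<lambda>\<omega>. min 1 (cmod (\<Sum>i\<in>S. err t n i \<omega>)))"
        using em by (intro integrable_min_norm borel_measurable_sum) auto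
      fix \<omega> show "min 1 \<bar>\<Sum>i\<in>S. f (err t n i \<omega>)\<bar> \<le> min 1 (cmod (\<Sum>i\<in>S. err t n i \<omega>))"
        using f(1)[of "\<Sum>i\<in>S. err t n i \<omega>"] unfolding f(2) by linarith
    qed
    then show "expectation (\<lambda>\<omega>. min 1 \<bar>\<Sum>i\<in>S. f (err t n i \<omega>)\<bar>) \<le> r n" using r(2)[OF S] by linarith
  qed
  have "null_in_prob (\<lambda>n \<omega>. (\<Sum>i<n. (Re (err t n i \<omega>))\<^sup>2) + (\<Sum>i<n. (Im (err t n i \<omega>))\<^sup>2))"
    by (intro null_in_prob_add part) (auto simp: abs_Re_le_cmod abs_Im_le_cmod)
  then show ?thesis by (simp add: cmod_power2 sum.distrib)
qed

section \<open>Quadratic variation and the equation in Ito form\<close>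

definition qv :: "real \<Rightarrow> nat \<Rightarrow> 'a \<Rightarrow> real" where
  "qv t n \<omega> = (\<Sum>i<n. (w (grid t n (Suc i)) \<omega> - w (grid t n i) \<omega>)\<^sup>2)"

lemma qv_nonneg: "0 \<le> qv t n \<omega>"
  unfolding qv_def by (intro sum_nonneg) auto

lemma qv_integrable:
  assumes t: "t \<ge> 0"
  shows "integrable M (qv t n)"
  unfolding qv_def
  using t by (intro Bochner_Integration.integrable_sum square_increment_integrable divide_right_mono mult_right_mono) auto

text \<open>The bound is uniform in \<open>n\<close>. It makes \<open>qv t n + 1\<close> the factor
  \<open>T\<close> in \<open>null_in_prob_mult_L1_bounded\<close> and
  \<open>null_in_prob_dominated\<close>.\<close>

lemma expectation_qv_le:
  assumes t: "t \<ge> 0"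
  shows "expectation (qv t n) \<le> 2 * v * t"
proof (cases "n = 0")
  case False
  have "expectation (qv t n) = (\<Sum>i<n. 2 * v * (grid t n (Suc i) - grid t n i))"
    unfolding qv_def using t
    by (subst Bochner_Integration.integral_sum)
       (auto intro!: square_increment_integrable sum.cong expectation_square_increment divide_right_mono mult_right_mono)
  also have "\<dots> = 2 * v * t"
    unfolding sum_distrib_left[symmetric] using sum_lessThan_telescope[of "\<lambda>i. grid t n i" n] False by simp
  finally show ?thesis by simp
qed (use t v_nonneg in \<open>simp add: qv_def[abs_def]\<close>)

abbreviation cis_inc :: "real \<Rightarrow> nat \<Rightarrow> nat \<Rightarrow> 'a \<Rightarrow> complex" where
  "cis_inc t n i \<omega> \<equiv> cis (w (grid t n (Suc i)) \<omega> - w (grid t n i) \<omega>) - 1"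

text \<open>The equation in Ito form, with \<open>cis \<Delta>w - 1\<close> in place of \<open>\<i> \<Delta>w - \<Delta>w\<^sup>2 / 2\<close>.\<close>

lemma ito_form:
  assumes t: "t \<ge> 0"
  shows "null_in_prob (\<lambda>n \<omega>. R t \<omega> - (\<Sum>i<n. h (grid t n i) \<omega> * cis_inc t n i \<omega>))"
proof -
  define dw where "dw n i \<omega> = increment t n i (\<lambda>s. w s \<omega>)" for n i \<omega>
  have dw_meas: "dw n i \<in> borel_measurable M" for n i
    unfolding dw_def increment_def using t by (intro borel_measurable_diff w_measurable) auto
  have hm: "h (grid t n i) \<in> borel_measurable M" for i n using t by (intro h_measurable) auto
  \<comment> \<open>Inserting \<open>\<Delta>h = \<Delta>R + \<Delta>J\<close> once into the
    trapezoidal expression for \<open>\<Delta>R\<close> produces \<open>err\<close>, the term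
    \<open>\<i> / 2 * \<Delta>w * err\<close>, the Ito term
    \<open>h * (\<i> * \<Delta>w - \<Delta>w\<^sup>2 / 2)\<close> and small remainders.
    \<open>X1\<close> and \<open>X2\<close> collect the terms with \<open>err\<close>,
    \<open>X3\<close> is the rest.\<close>
  define X1 where "X1 n \<omega> = (\<Sum>i<n. err t n i \<omega>)" for n \<omega>
  define X2 where "X2 n \<omega> = (\<Sum>i<n. \<i> / 2 * dw n i \<omega> * err t n i \<omega>)" for n \<omega>
  define X3 where "X3 n \<omega> = R t \<omega> - (\<Sum>i<n. h (grid t n i) \<omega> * cis_inc t n i \<omega>) - X1 n \<omega> - X2 n \<omega>" for n \<omega>
  have cis_inc_meas: "cis_inc t n i \<in> borel_measurable M" for n i
    using cis_measurable[OF dw_meas[of n i]] unfolding dw_def increment_def by simp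
  have X1: "null_in_prob X1" unfolding X1_def by (rule null_in_prob_sum_err[OF t])
  have [measurable]: "X1 n \<in> borel_measurable M" "X2 n \<in> borel_measurable M" for n
    unfolding X1_def X2_def using err_measurable[OF t] dw_meas by simp_all
  have X3_meas [measurable]: "X3 n \<in> borel_measurable M" for n
    unfolding X3_def using R_measurable[OF t] hm cis_inc_meas by simp
  have qT: "integrable M (\<lambda>\<omega>. qv t n \<omega> + 1)" "expectation (\<lambda>\<omega>. \<bar>qv t n \<omega> + 1\<bar>) \<le> 2 * v * t + 1" for n
  proof -
    have "\<bar>qv t n \<omega> + 1\<bar> = qv t n \<omega> + 1" for \<omega> using qv_nonneg[of t n \<omega>] by simp
    then show "integrable M (\<lambda>\<omega>. qv t n \<omega> + 1)" "expectation (\<lambda>\<omega>. \<bar>qv t n \<omega> + 1\<bar>) \<le> 2 * v * t + 1"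
      using qv_integrable[OF t, of n] expectation_qv_le[OF t, of n] by (simp_all add: prob_space)
  qed
  have X2: "null_in_prob X2"
  proof (rule null_in_prob_le)
    \<comment> \<open>Cauchy-Schwarz separates the errors from the increments of \<open>w\<close>,
      and \<open>sqrt q \<le> q + 1\<close> brings the second factor into a form bounded in
      L^1.\<close>
    show "null_in_prob (\<lambda>n \<omega>. sqrt (\<Sum>i<n. (cmod (err t n i \<omega>))\<^sup>2) * (qv t n \<omega> + 1))"
      by (intro null_in_prob_mult_L1_bounded[OF null_in_prob_sqrt[OF null_in_prob_sum_square_err[OF t]] qT] sum_nonneg) auto
    fix n
    show "AE \<omega> in M. norm (X2 n \<omega>) \<le> norm (sqrt (\<Sum>i<n. (cmod (err t n i \<omega>))\<^sup>2) * (qv t n \<omega> + 1))"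
    proof (rule AE_I2)
      fix \<omega>
      have "norm (X2 n \<omega>) \<le> (\<Sum>i<n. \<bar>cmod (err t n i \<omega>)\<bar> * \<bar>dw n i \<omega>\<bar>)"
        unfolding X2_def by (rule sum_norm_le) (simp add: norm_mult mult.commute mult_left_le)
      also have "\<dots> \<le> L2_set (\<lambda>i. cmod (err t n i \<omega>)) {..<n} * L2_set (\<lambda>i. dw n i \<omega>) {..<n}"
        by (rule L2_set_mult_ineq)
      also have "\<dots> = sqrt (\<Sum>i<n. (cmod (err t n i \<omega>))\<^sup>2) * sqrt (qv t n \<omega>)"
        by (simp add: L2_set_def qv_def dw_def increment_def)
      also have "\<dots> \<le> sqrt (\<Sum>i<n. (cmod (err t n i \<omega>))\<^sup>2) * (qv t n \<omega> + 1)"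
      proof (intro mult_left_mono real_sqrt_ge_zero sum_nonneg)
        show "sqrt (qv t n \<omega>) \<le> qv t n \<omega> + 1"
        proof (rule real_le_lsqrt)
          show "qv t n \<omega> \<le> (qv t n \<omega> + 1)\<^sup>2" using qv_nonneg[of t n \<omega>] by (simp add: power2_eq_square algebra_simps)
        qed (use qv_nonneg[of t n \<omega>] in auto)
      qed auto
      finally show "norm (X2 n \<omega>) \<le> norm (sqrt (\<Sum>i<n. (cmod (err t n i \<omega>))\<^sup>2) * (qv t n \<omega> + 1))" by simp
    qed
  qed auto
  have X3: "null_in_prob X3"
  proof (rule null_in_prob_dominated[OF _ qT])
    show "AE \<omega> in M. \<exists>A. A \<longlonglongrightarrow> 0 \<and> (\<forall>n. norm (X3 n \<omega>) \<le> A n * \<bar>qv t n \<omega> + 1\<bar>)"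
    proof (rule AE_I2)
      fix \<omega>
      have hc: "continuous_on {0..t} (\<lambda>s. h s \<omega>)" by (rule continuous_on_subset[OF h_continuous]) auto
      have wc: "continuous_on {0..t} (\<lambda>s. w s \<omega>)" by (rule continuous_on_subset[OF w_continuous]) auto
      have bc: "continuous_on {0..t} (\<lambda>s. b (h s \<omega>))" by (rule continuous_on_subset[OF b_h_continuous]) auto
      obtain A1 where A1: "A1 \<longlonglongrightarrow> 0" "\<And>n. A1 n \<ge> 0" "\<And>n i. i < n \<Longrightarrow> cmod (increment t n i (\<lambda>s. h s \<omega>)) \<le> A1 n"
        unfolding increment_def using uniform_partition_modulus[OF hc t] by blast
      obtain A2 where A2: "A2 \<longlonglongrightarrow> 0" "\<And>n. A2 n \<ge> 0" "\<And>n i. i < n \<Longrightarrow> \<bar>dw n i \<omega>\<bar> \<le> A2 n"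
        unfolding dw_def increment_def real_norm_def[symmetric] using uniform_partition_modulus[OF wc t] by blast
      obtain H where H: "H \<ge> 0" "\<And>s. s \<in> {0..t} \<Longrightarrow> cmod (h s \<omega>) \<le> H" using path_bounded[OF hc] by blast
      obtain B where B: "B \<ge> 0" "\<And>s. s \<in> {0..t} \<Longrightarrow> cmod (b (h s \<omega>)) \<le> B" using path_bounded[OF bc] by blast
      \<comment> \<open>For \<open>n = 0\<close> every sum is empty and \<open>X3\<close> is
        \<open>R t\<close>, so this one value of \<open>A\<close> is set by hand.\<close>
      define A where "A n = (if n = 0 then cmod (R t \<omega>) else A2 n * (B * t) + A1 n + H * A2 n)" for n
      have "(\<lambda>n. A2 n * (B * t) + A1 n + H * A2 n) \<longlonglongrightarrow> 0"
        using tendsto_add[OF tendsto_add[OF tendsto_mult_left_zero[OF A2(1), of "B * t"] A1(1)] tendsto_mult_right_zero[OF A2(1), of H]] by simp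
      then have A: "A \<longlonglongrightarrow> 0"
        by (rule Lim_transform_eventually) (use eventually_gt_at_top[of 0] in \<open>eventually_elim, simp add: A_def\<close>)
      have "norm (X3 n \<omega>) \<le> A n * \<bar>qv t n \<omega> + 1\<bar>" for n
      proof (cases "n = 0")
        case True
        then show ?thesis by (simp add: X3_def X1_def X2_def A_def qv_def)
      next
        case False
        \<comment> \<open>Three remainders: a drift increment times \<open>\<Delta>w\<close>, an
          increment of \<open>h\<close> times \<open>\<Delta>w\<^sup>2\<close>, and the Taylor
          remainder of \<open>cis\<close>. The first one is bounded without a factor
          \<open>\<Delta>w\<^sup>2\<close>, by a null sequence times \<open>t\<close>, which is why
          1 is added to \<open>qv\<close>.\<close>
        define z where "z i = \<i> / 2 * dw n i \<omega> * increment t n i (\<lambda>s. J s \<omega>) - increment t n i (\<lambda>s. h s \<omega>) * (dw n i \<omega>)\<^sup>2 / 4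
           + h (grid t n i) \<omega> * (\<i> * dw n i \<omega> - complex_of_real ((dw n i \<omega>)\<^sup>2 / 2) - (cis (dw n i \<omega>) - 1))" for i
        have tele: "R t \<omega> = (\<Sum>i<n. increment t n i (\<lambda>s. R s \<omega>))"
          using sum_lessThan_telescope[of "\<lambda>i. R (grid t n i) \<omega>" n] False by (simp add: increment_def)
        have zi: "increment t n i (\<lambda>s. R s \<omega>) - h (grid t n i) \<omega> * cis_inc t n i \<omega> - err t n i \<omega> - \<i> / 2 * dw n i \<omega> * err t n i \<omega> = z i" for i
        proof -
          define a a' d k j j' where "a = h (grid t n i) \<omega>" and "a' = h (grid t n (Suc i)) \<omega>"
            and "d = complex_of_real (dw n i \<omega>)" and "k = cis_inc t n i \<omega>"
            and "j = J (grid t n i) \<omega>" and "j' = J (grid t n (Suc i)) \<omega>"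
          have e: "err t n i \<omega> = (a' - j') - (a - j) - (a + a') / 2 * (\<i> * d)"
            by (simp add: err_def R_def trap_def a_def a'_def d_def j_def j'_def dw_def increment_def del: of_nat_Suc)
          have k: "cis (dw n i \<omega>) - 1 = k" by (simp add: k_def dw_def increment_def)
          have "(a' - j') - (a - j) - a * k - err t n i \<omega> - \<i> / 2 * d * err t n i \<omega> =
             \<i> / 2 * d * (j' - j) - (a' - a) * d\<^sup>2 / 4 + a * (\<i> * d - d\<^sup>2 / 2 - k)"
          proof -
            have ii: "\<i> * (\<i> * z) = - z" for z by (simp add: mult.assoc[symmetric])
            show ?thesis unfolding e by (simp add: field_simps power2_eq_square ii)
          qed
          moreover have "increment t n i (\<lambda>s. R s \<omega>) = (a' - j') - (a - j)" "increment t n i (\<lambda>s. J s \<omega>) = j' - j"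
            "increment t n i (\<lambda>s. h s \<omega>) = a' - a"
            by (simp_all add: increment_def R_def a_def a'_def j_def j'_def del: of_nat_Suc)
          ultimately show ?thesis
            unfolding z_def k by (simp add: a_def[symmetric] d_def[symmetric] k_def[symmetric] del: of_nat_Suc)
        qed
        have "X3 n \<omega> = (\<Sum>i<n. z i)"
          unfolding X3_def X1_def X2_def tele zi[symmetric] by (simp only: sum_subtractf)
        also have "cmod \<dots> \<le> (\<Sum>i<n. A2 n * (B * (t / real n)) + (A1 n + H * A2 n) * (dw n i \<omega>)\<^sup>2)"
        proof (rule sum_norm_le)
          fix i assume "i \<in> {..<n}"
          then have i: "i < n" by simp
          note u = uniform_partition_le[OF _ t i]
          have n: "0 < n" using i by simp
          have J': "cmod (increment t n i (\<lambda>s. J s \<omega>)) \<le> B * (t / real n)"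
            unfolding increment_def J_def u(5)[OF n, symmetric]
            by (rule continuous_on_integral_bound[OF bc]) (use u[OF n] B in auto)
          have 1: "cmod (\<i> / 2 * dw n i \<omega> * increment t n i (\<lambda>s. J s \<omega>)) \<le> A2 n * (B * (t / real n))"
          proof -
            have "cmod (\<i> / 2 * dw n i \<omega> * increment t n i (\<lambda>s. J s \<omega>)) \<le> \<bar>dw n i \<omega>\<bar> * cmod (increment t n i (\<lambda>s. J s \<omega>))"
              by (simp add: norm_mult)
            also have "\<dots> \<le> A2 n * (B * (t / real n))" using A2(2,3) i J' by (intro mult_mono) auto
            finally show ?thesis .
          qed
          have 2: "cmod (increment t n i (\<lambda>s. h s \<omega>) * (dw n i \<omega>)\<^sup>2 / 4) \<le> A1 n * (dw n i \<omega>)\<^sup>2"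
          proof -
            have "cmod (increment t n i (\<lambda>s. h s \<omega>) * (dw n i \<omega>)\<^sup>2 / 4) \<le> cmod (increment t n i (\<lambda>s. h s \<omega>)) * (dw n i \<omega>)\<^sup>2"
              by (simp add: norm_mult norm_divide norm_power)
            also have "\<dots> \<le> A1 n * (dw n i \<omega>)\<^sup>2" using A1(3)[OF i] by (intro mult_right_mono) auto
            finally show ?thesis .
          qed
          have 3: "cmod (h (grid t n i) \<omega> * (\<i> * dw n i \<omega> - complex_of_real ((dw n i \<omega>)\<^sup>2 / 2) - (cis (dw n i \<omega>) - 1))) \<le> H * (A2 n * (dw n i \<omega>)\<^sup>2)"
            unfolding norm_mult
          proof (rule mult_mono)
            show "cmod (h (grid t n i) \<omega>) \<le> H" using u[OF n] by (intro H) auto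
            have "cmod (\<i> * dw n i \<omega> - complex_of_real ((dw n i \<omega>)\<^sup>2 / 2) - (cis (dw n i \<omega>) - 1)) \<le> \<bar>dw n i \<omega>\<bar> ^ 3"
              by (rule cmod_cis_taylor)
            also have "\<dots> = \<bar>dw n i \<omega>\<bar> * (dw n i \<omega>)\<^sup>2" by (simp add: power3_eq_cube power2_eq_square)
            also have "\<dots> \<le> A2 n * (dw n i \<omega>)\<^sup>2" using A2(3)[OF i] by (intro mult_right_mono) auto
            finally show "cmod (\<i> * dw n i \<omega> - complex_of_real ((dw n i \<omega>)\<^sup>2 / 2) - (cis (dw n i \<omega>) - 1)) \<le> A2 n * (dw n i \<omega>)\<^sup>2" .
          qed (use H in auto)
          show "cmod (z i) \<le> A2 n * (B * (t / real n)) + (A1 n + H * A2 n) * (dw n i \<omega>)\<^sup>2"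
            unfolding z_def by (rule order_trans[OF norm_triangle_le[OF add_mono[OF order_trans[OF norm_triangle_ineq4 add_mono[OF 1 2]] 3]]])
              (auto simp: algebra_simps)
        qed
        also have "\<dots> = A2 n * (B * t) + (A1 n + H * A2 n) * qv t n \<omega>"
          using False by (simp add: sum.distrib sum_distrib_left[symmetric] qv_def dw_def increment_def)
        also have "\<dots> \<le> A n * (qv t n \<omega> + 1)"
        proof -
          have "0 \<le> A2 n * (B * t) * qv t n \<omega>" "0 \<le> A1 n" "0 \<le> H * A2 n" using A1(2) A2(2) H(1) B(1) t qv_nonneg by simp_all
          then show ?thesis using False unfolding A_def by (simp add: algebra_simps)
        qed
        finally show ?thesis using qv_nonneg[of t n \<omega>] by simp
      qed
      then show "\<exists>A. A \<longlonglongrightarrow> 0 \<and> (\<forall>n. norm (X3 n \<omega>) \<le> A n * \<bar>qv t n \<omega> + 1\<bar>)" using A by blast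
    qed
  qed auto
  have "null_in_prob (\<lambda>n \<omega>. X1 n \<omega> + X2 n \<omega> + X3 n \<omega>)" by (intro null_in_prob_add X1 X2 X3)
  then show ?thesis by (simp add: X3_def)
qed

section \<open>The defect of the pathwise equation\<close>

definition c :: "real \<Rightarrow> 'a \<Rightarrow> complex" where
  "c t \<omega> = x + integral {0..t} (\<lambda>s. cis (- w s \<omega>) * b (h s \<omega>))"

text \<open>The goal is \<open>D = 0\<close>, which is the pathwise equation.\<close>

definition D :: "real \<Rightarrow> 'a \<Rightarrow> complex" where
  "D t \<omega> = h t \<omega> - cis (w t \<omega>) * c t \<omega>"

lemma c_integrand_continuous: "continuous_on {0..} (\<lambda>s. cis (- w s \<omega>) * b (h s \<omega>))"
  by (intro continuous_intros b_h_continuous w_continuous)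

lemma c_adapted: "0 \<le> t \<Longrightarrow> c t \<in> borel_measurable (F t)"
  unfolding c_def
  by (intro borel_measurable_add borel_measurable_const integral_adapted continuous_on_subset[OF c_integrand_continuous] borel_measurable_times
      cis_measurable borel_measurable_uminus w_adapted measurable_compose[OF h_adapted b_measurable]) auto

lemma c_continuous: "continuous_on {0..t} (\<lambda>s. c s \<omega>)"
  unfolding c_def
  by (intro continuous_intros indefinite_integral_continuous_1 integrable_continuous_interval continuous_on_subset[OF c_integrand_continuous]) auto

lemma D_adapted: "0 \<le> t \<Longrightarrow> D t \<in> borel_measurable (F t)"
  unfolding D_def by (intro borel_measurable_diff borel_measurable_times h_adapted cis_measurable w_adapted c_adapted)

lemma D_continuous: "continuous_on {0..t} (\<lambda>s. D s \<omega>)"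
  unfolding D_def
  by (intro continuous_intros c_continuous continuous_on_subset[OF h_continuous] continuous_on_subset[OF w_continuous]) auto

lemma D_0: "D 0 \<omega> = 0" by (simp add: D_def c_def h_0 w_0)

text \<open>The part \<open>h\<close> is expanded by \<open>ito_form\<close> and the part
  \<open>cis w * c\<close> by a discrete product rule. Both have the same drift \<open>J\<close>,
  which cancels in the difference and leaves a homogeneous equation.\<close>

lemma null_in_prob_D:
  assumes t: "t \<ge> 0"
  shows "null_in_prob (\<lambda>n \<omega>. D t \<omega> - (\<Sum>i<n. D (grid t n i) \<omega> * cis_inc t n i \<omega>))"
proof -
  define Y where "Y n \<omega> = J t \<omega> - (\<Sum>i<n. cis (w (grid t n (Suc i)) \<omega>) * increment t n i (\<lambda>s. c s \<omega>))" for n \<omega>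
  have Y_lim: "(\<lambda>n. Y n \<omega>) \<longlonglongrightarrow> 0" for \<omega>
  proof -
    \<comment> \<open>The factor at the right end of the block undoes the rotation inside
      \<open>c\<close>, up to the oscillation of \<open>w\<close> on that block.\<close>
    define g where "g n i r = cis (w (grid t n (Suc i)) \<omega>) * (cis (- w r \<omega>) * b (h r \<omega>))" for n i r
    have C0: "continuous_on {0..t} (\<lambda>s. cis (- w s \<omega>) * b (h s \<omega>))" by (rule continuous_on_subset[OF c_integrand_continuous]) auto
    have wc: "continuous_on {0..t} (\<lambda>s. w s \<omega>)" by (rule continuous_on_subset[OF w_continuous]) auto
    have bc: "continuous_on {0..t} (\<lambda>s. b (h s \<omega>))" by (rule continuous_on_subset[OF b_h_continuous]) auto
    obtain B where B: "B \<ge> 0" "\<And>s. s \<in> {0..t} \<Longrightarrow> cmod (b (h s \<omega>)) \<le> B" using path_bounded[OF bc] by blast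
    have "(\<lambda>n. \<Sum>i<n. integral {grid t n i..grid t n (Suc i)} (g n i)) \<longlonglongrightarrow> integral {0..t} (\<lambda>s. b (h s \<omega>))"
    proof (rule uniform_partition_sum_tendsto[OF _ t])
      show "(\<lambda>s. b (h s \<omega>)) integrable_on {0..t}" using bc by (rule integrable_continuous_interval)
      fix e :: real assume e: "e > 0"
      define e' where "e' = e / (B + 1)"
      have e': "e' > 0" using e B by (simp add: e'_def)
      show "\<forall>\<^sub>F n in sequentially. \<forall>i<n. \<forall>r\<in>{grid t n i..grid t n (Suc i)}. norm (g n i r - b (h r \<omega>)) \<le> e"
        using uniform_oscillation[OF wc t e'] eventually_gt_at_top[of 0]
      proof eventually_elim
        case (elim n)
        show ?case
        proof (intro allI impI ballI)
          fix i r assume i: "i < n" and r: "r \<in> {grid t n i..grid t n (Suc i)}"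
          note u = uniform_partition_le[OF elim(2) t i]
          have "g n i r - b (h r \<omega>) = (cis (w (grid t n (Suc i)) \<omega> - w r \<omega>) - 1) * b (h r \<omega>)"
            by (simp add: g_def algebra_simps cis_mult flip: mult.assoc)
          also have "cmod \<dots> \<le> e' * B" unfolding norm_mult
          proof (rule mult_mono)
            have "dist (w (grid t n (Suc i)) \<omega>) (w r \<omega>) < e'" using elim(1) i r u by auto
            then show "cmod (cis (w (grid t n (Suc i)) \<omega> - w r \<omega>) - 1) \<le> e'"
              using cmod_cis_minus_1_le[of "w (grid t n (Suc i)) \<omega> - w r \<omega>"] by (simp add: dist_real_def)
          qed (use B e' r u in auto)
          also have "\<dots> \<le> e" using e B by (simp add: e'_def field_simps)
          finally show "norm (g n i r - b (h r \<omega>)) \<le> e" .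
        qed
      qed
    next
      fix n i :: nat assume i: "i < n"
      then have n: "n > 0" by simp
      show "g n i integrable_on {grid t n i..grid t n (Suc i)}"
        unfolding g_def using uniform_partition_le[OF n t i]
        by (intro integrable_continuous_interval continuous_intros continuous_on_subset[OF C0]
            continuous_on_subset[OF b_h_continuous] continuous_on_subset[OF w_continuous]) auto
    qed
    moreover have "(\<Sum>i<n. integral {grid t n i..grid t n (Suc i)} (g n i)) =
       (\<Sum>i<n. cis (w (grid t n (Suc i)) \<omega>) * increment t n i (\<lambda>s. c s \<omega>))" for n
    proof (rule sum.cong[OF refl])
      fix i assume "i \<in> {..<n}"
      then have i: "i < n" and n: "n > 0" by auto
      note u = uniform_partition_le[OF n t i]
      have int: "(\<lambda>s. cis (- w s \<omega>) * b (h s \<omega>)) integrable_on {0..grid t n (Suc i)}"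
        by (intro integrable_continuous_interval continuous_on_subset[OF C0]) (use u in auto)
      have "integral {0..grid t n i} (\<lambda>s. cis (- w s \<omega>) * b (h s \<omega>)) + integral {grid t n i..grid t n (Suc i)} (\<lambda>s. cis (- w s \<omega>) * b (h s \<omega>))
         = integral {0..grid t n (Suc i)} (\<lambda>s. cis (- w s \<omega>) * b (h s \<omega>))"
        using u int by (intro Henstock_Kurzweil_Integration.integral_combine)
      then have "increment t n i (\<lambda>s. c s \<omega>) = integral {grid t n i..grid t n (Suc i)} (\<lambda>s. cis (- w s \<omega>) * b (h s \<omega>))"
        by (simp add: increment_def c_def algebra_simps del: of_nat_Suc)
      then show "integral {grid t n i..grid t n (Suc i)} (g n i) = cis (w (grid t n (Suc i)) \<omega>) * increment t n i (\<lambda>s. c s \<omega>)"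
        unfolding g_def by simp
    qed
    ultimately have "(\<lambda>n. J t \<omega> - (\<Sum>i<n. cis (w (grid t n (Suc i)) \<omega>) * increment t n i (\<lambda>s. c s \<omega>))) \<longlonglongrightarrow> J t \<omega> - J t \<omega>"
      unfolding J_def by (intro tendsto_intros) simp
    then show ?thesis by (simp add: Y_def)
  qed
  have cm: "c s \<in> borel_measurable M" if "0 \<le> s" for s using measurable_F_M[OF c_adapted[OF that] that] .
  have Jm: "J t \<in> borel_measurable M" using measurable_F_M[OF J_adapted[OF t] t] .
  have wm: "w (grid t n i) \<in> borel_measurable M" for i n using t by (intro w_measurable) auto
  have Ym: "Y n \<in> borel_measurable M" for n
    unfolding Y_def increment_def using t
    by (intro borel_measurable_diff borel_measurable_sum borel_measurable_times cm Jm cis_measurable wm) auto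
  have "null_in_prob (\<lambda>n \<omega>. (R t \<omega> - (\<Sum>i<n. h (grid t n i) \<omega> * cis_inc t n i \<omega>)) + Y n \<omega>)"
    using Y_lim Ym by (intro null_in_prob_add ito_form[OF t] null_in_prob_AE AE_I2)
  then show ?thesis
  proof (rule null_in_prob_eventually_le)
    show "(\<lambda>\<omega>. D t \<omega> - (\<Sum>i<n. D (grid t n i) \<omega> * cis_inc t n i \<omega>)) \<in> borel_measurable M" for n
      using t by (intro borel_measurable_diff borel_measurable_sum borel_measurable_times cis_measurable wm borel_measurable_const
          measurable_F_M[OF D_adapted]) auto
    \<comment> \<open>Only eventually, because the last grid point equals \<open>t\<close> for
      positive \<open>n\<close> only.\<close>
    show "\<forall>\<^sub>F n in sequentially. AE \<omega> in M. norm (D t \<omega> - (\<Sum>i<n. D (grid t n i) \<omega> * cis_inc t n i \<omega>)) \<le>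
       norm ((R t \<omega> - (\<Sum>i<n. h (grid t n i) \<omega> * cis_inc t n i \<omega>)) + Y n \<omega>)"
      using eventually_gt_at_top[of 0]
    proof eventually_elim
      case n: (elim n)
      have "D t \<omega> - (\<Sum>i<n. D (grid t n i) \<omega> * cis_inc t n i \<omega>) =
        R t \<omega> - (\<Sum>i<n. h (grid t n i) \<omega> * cis_inc t n i \<omega>) + Y n \<omega>" for \<omega>
      proof -
        define E C where "E i = cis (w (grid t n i) \<omega>)" and "C i = c (grid t n i) \<omega>" for i
        have "(\<Sum>i<n. E (Suc i) * C (Suc i) - E i * C i) = E n * C n - E 0 * C 0"
          by (rule sum_lessThan_telescope)
        then have "cis (w t \<omega>) * c t \<omega> = x + (\<Sum>i<n. E (Suc i) * C (Suc i) - E i * C i)"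
          using n by (simp add: E_def C_def w_0 c_def)
        \<comment> \<open>With \<open>E\<close> taken at the right end in the first product, the
          second one contains exactly \<open>cis \<Delta>w - 1\<close>.\<close>
        also have "(\<Sum>i<n. E (Suc i) * C (Suc i) - E i * C i) = (\<Sum>i<n. E (Suc i) * (C (Suc i) - C i) + E i * C i * cis_inc t n i \<omega>)"
        proof (rule sum.cong[OF refl])
          fix i
          have "E (Suc i) = E i * cis (w (grid t n (Suc i)) \<omega> - w (grid t n i) \<omega>)"
            unfolding E_def cis_mult by simp
          then show "E (Suc i) * C (Suc i) - E i * C i = E (Suc i) * (C (Suc i) - C i) + E i * C i * cis_inc t n i \<omega>"
            by (simp add: algebra_simps)
        qed
        finally have 1: "cis (w t \<omega>) * c t \<omega> = x + (\<Sum>i<n. E (Suc i) * (C (Suc i) - C i)) + (\<Sum>i<n. E i * C i * cis_inc t n i \<omega>)"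
          by (simp add: sum.distrib)
        have 2: "(\<Sum>i<n. D (grid t n i) \<omega> * cis_inc t n i \<omega>) = (\<Sum>i<n. h (grid t n i) \<omega> * cis_inc t n i \<omega>) - (\<Sum>i<n. E i * C i * cis_inc t n i \<omega>)"
          unfolding D_def E_def C_def sum_subtractf[symmetric] by (simp add: left_diff_distrib)
        have 3: "Y n \<omega> = J t \<omega> - (\<Sum>i<n. E (Suc i) * (C (Suc i) - C i))"
          unfolding Y_def E_def C_def increment_def by simp
        have "h t \<omega> - (x + p + q) - (r - q) = h t \<omega> - x - J t \<omega> - r + (J t \<omega> - p)" for p q r by simp
        then show ?thesis unfolding 2 3 unfolding D_def 1 R_def .
      qed
      then show ?case by simp
    qed
  qed
qed

section \<open>Mean square estimate and vanishing of the defect\<close>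

lemma expectation_cos_increment:
  assumes "0 \<le> s" "s \<le> t" "Y \<in> borel_measurable (F s)" "integrable M Y"
  shows "expectation (\<lambda>\<omega>. Y \<omega> * cos (k * (w t \<omega> - w s \<omega>))) = expectation Y * exp (- (k\<^sup>2 * v * (t - s)))"
proof -
  have wm: "w s \<in> borel_measurable M" "w t \<in> borel_measurable M" using assms w_measurable by auto
  have Ym: "Y \<in> borel_measurable M" using assms by auto
  have int: "integrable M (\<lambda>\<omega>. complex_of_real (Y \<omega>) * cis (k * (w t \<omega> - w s \<omega>)))"
    by (rule Bochner_Integration.integrable_bound[OF assms(4)])
      (use wm Ym in \<open>auto intro!: borel_measurable_times cis_measurable simp: norm_mult\<close>)
  have "expectation (\<lambda>\<omega>. Re (complex_of_real (Y \<omega>) * cis (k * (w t \<omega> - w s \<omega>)))) = Re (expectation (\<lambda>\<omega>. complex_of_real (Y \<omega>) * cis (k * (w t \<omega> - w s \<omega>))))"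
    by (rule integral_Re[OF int])
  also have "expectation (\<lambda>\<omega>. complex_of_real (Y \<omega>) * cis (k * (w t \<omega> - w s \<omega>))) = expectation (\<lambda>\<omega>. complex_of_real (Y \<omega>)) * exp (- (k\<^sup>2 * v * (t - s)))"
    using assms by (intro expectation_cis_increment) auto
  finally show ?thesis using assms(4) by simp
qed

text \<open>A substitute for the Ito isometry. The factors \<open>cis \<Delta>w - 1\<close> are not
  centred, so the mixed terms survive; but their conditional mean is of the order of the step
  length, and the mixed terms only add the factor \<open>exp (v * t)\<close>.\<close>

lemma expectation_sum_cis_inc:
  assumes t: "t \<ge> 0" and n: "n > 0"
    and X: "\<And>i. i < n \<Longrightarrow> X i \<in> borel_measurable (F (grid t n i))"
    and bound: "\<And>i \<omega>. i < n \<Longrightarrow> cmod (X i \<omega>) \<le> m"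
  shows "expectation (\<lambda>\<omega>. (cmod (\<Sum>i<n. X i \<omega> * cis_inc t n i \<omega>))\<^sup>2) \<le>
    3 * v * exp (v * t) * (\<Sum>i<n. (t / real n) * expectation (\<lambda>\<omega>. (cmod (X i \<omega>))\<^sup>2))"
proof -
  define \<delta> where "\<delta> = t / real n"
  have \<delta>: "\<delta> \<ge> 0" using t by (simp add: \<delta>_def)
  define S where "S k \<omega> = (\<Sum>i<k. X i \<omega> * cis_inc t n i \<omega>)" for k \<omega>
  define a where "a k = expectation (\<lambda>\<omega>. (cmod (S k \<omega>))\<^sup>2)" for k
  define y where "y i = expectation (\<lambda>\<omega>. (cmod (X i \<omega>))\<^sup>2)" for i
  have m: "0 \<le> m" using bound[OF n] norm_ge_zero order_trans by blast
  have y0: "0 \<le> y i" for i unfolding y_def by (intro integral_nonneg_AE) auto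
  have cis_inc_meas: "cis_inc t n i \<in> borel_measurable (F (grid t n k))" if "Suc i \<le> k" for i k
    using that t
    by (intro borel_measurable_diff cis_measurable borel_measurable_const measurable_F_mono[OF w_adapted]) (auto simp: divide_right_mono mult_right_mono)
  have S_meas: "S k \<in> borel_measurable (F (grid t n k))" if "k \<le> n" for k
    unfolding S_def using that t
    by (intro borel_measurable_sum borel_measurable_times cis_inc_meas measurable_F_mono[OF X]) (auto simp: divide_right_mono mult_right_mono)
  have M: "f \<in> borel_measurable M" if "f \<in> borel_measurable (F (grid t n k))" for f :: "'a \<Rightarrow> complex" and k
    using measurable_F_M[OF that] t by simp
  have S_bound: "cmod (S k \<omega>) \<le> 2 * m * real k" if "k \<le> n" for k \<omega>
  proof -
    have "cmod (S k \<omega>) \<le> (\<Sum>i<k. m * 2)"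
      unfolding S_def using that m by (intro sum_norm_le) (auto simp: norm_mult intro!: mult_mono bound cmod_cis_minus_1_le_2)
    then show ?thesis by (simp add: mult_ac)
  qed
  \<comment> \<open>The mixed term costs at most \<open>v * \<delta> * (a k + y k)\<close>, by the
    inequality of arithmetic and geometric means, and the new square at most
    \<open>2 * v * \<delta> * y k\<close>; this explains the 3.\<close>
  have rec: "a (Suc k) \<le> (1 + v * \<delta>) * a k + 3 * v * \<delta> * y k" if k: "k < n" for k
  proof -
    let ?K = "cis_inc t n k"
    let ?p = "grid t n k" and ?q = "grid t n (Suc k)"
    note u = uniform_partition_le[OF n t k]
    have Sm: "S k \<in> borel_measurable M" using M[OF S_meas] k by simp
    have Xm: "X k \<in> borel_measurable M" using M[OF X] k by simp
    have Km: "?K \<in> borel_measurable M" using M[OF cis_inc_meas[OF order.refl]] .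
    have Sb: "cmod (S k \<omega>) \<le> 2 * m * real k" for \<omega> using S_bound k by simp
    have Xb: "cmod (X k \<omega>) \<le> m" for \<omega> using bound[OF k] .
    have iS: "integrable M (\<lambda>\<omega>. (cmod (S k \<omega>))\<^sup>2)"
      by (rule integrable_const_bound[of _ "(2 * m * real k)\<^sup>2"]) (use Sm Sb in \<open>auto intro!: power_mono\<close>)
    have iX: "integrable M (\<lambda>\<omega>. (cmod (X k \<omega>))\<^sup>2)"
      by (rule integrable_const_bound[of _ "m\<^sup>2"]) (use Xm Xb in \<open>auto intro!: power_mono\<close>)
    define Z where "Z \<omega> = cnj (S k \<omega>) * X k \<omega>" for \<omega>
    have Zm: "Z \<in> borel_measurable (F ?p)"
    proof -
      have "cnj \<in> borel_measurable borel" by (intro borel_measurable_continuous_onI continuous_intros)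
      then show ?thesis unfolding Z_def using S_meas[of k] X[OF k] k
        by (intro borel_measurable_times measurable_compose[OF _ \<open>cnj \<in> borel_measurable borel\<close>]) auto
    qed
    have Zb: "cmod (Z \<omega>) \<le> 2 * m * real k * m" for \<omega>
      unfolding Z_def norm_mult using Sb Xb m by (intro mult_mono) auto
    have iZ: "integrable M Z"
      by (rule integrable_const_bound[of _ "2 * m * real k * m"]) (use Zb M[OF Zm] in auto)
    have iZK: "integrable M (\<lambda>\<omega>. Z \<omega> * ?K \<omega>)"
    proof (rule integrable_const_bound[of _ "2 * m * real k * m * 2"])
      have "cmod (Z \<omega> * ?K \<omega>) \<le> 2 * m * real k * m * 2" for \<omega>
        unfolding norm_mult by (intro mult_mono Zb cmod_cis_minus_1_le_2) (use m in auto)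
      then show "AE \<omega> in M. cmod (Z \<omega> * ?K \<omega>) \<le> 2 * m * real k * m * 2" by simp
      show "(\<lambda>\<omega>. Z \<omega> * ?K \<omega>) \<in> borel_measurable M" using M[OF Zm] Km by (rule borel_measurable_times)
    qed
    have iZc: "integrable M (\<lambda>\<omega>. Z \<omega> * cis (1 * (w ?q \<omega> - w ?p \<omega>)))"
      using Bochner_Integration.integrable_add[OF iZK iZ] by (simp add: algebra_simps)
    have "expectation (\<lambda>\<omega>. Z \<omega> * ?K \<omega>) = expectation (\<lambda>\<omega>. Z \<omega> * cis (1 * (w ?q \<omega> - w ?p \<omega>))) - expectation Z"
      using iZc iZ by (simp add: algebra_simps)
    also have "expectation (\<lambda>\<omega>. Z \<omega> * cis (1 * (w ?q \<omega> - w ?p \<omega>))) = expectation Z * exp (- (1\<^sup>2 * v * (?q - ?p)))"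
      by (rule expectation_cis_increment[OF u(1,2) Zm iZ])
    also have "\<dots> - expectation Z = expectation Z * complex_of_real (exp (- (v * \<delta>)) - 1)"
      unfolding u(5) \<delta>_def[symmetric] by (simp add: algebra_simps)
    finally have EZK: "expectation (\<lambda>\<omega>. Z \<omega> * ?K \<omega>) = expectation Z * complex_of_real (exp (- (v * \<delta>)) - 1)" .
    have "2 * expectation (\<lambda>\<omega>. Re (Z \<omega> * ?K \<omega>)) = 2 * Re (expectation (\<lambda>\<omega>. Z \<omega> * ?K \<omega>))"
      by (simp only: integral_Re[OF iZK])
    also have "\<dots> \<le> 2 * cmod (expectation (\<lambda>\<omega>. Z \<omega> * ?K \<omega>))" using complex_Re_le_cmod by simp
    also have "\<dots> = 2 * (cmod (expectation Z) * \<bar>exp (- (v * \<delta>)) - 1\<bar>)"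
      unfolding EZK norm_mult norm_of_real ..
    also have "\<dots> \<le> 2 * (((a k + y k) / 2) * (v * \<delta>))"
    proof (intro mult_left_mono mult_mono)
      have "cmod (expectation Z) \<le> expectation (\<lambda>\<omega>. cmod (Z \<omega>))" by (rule integral_norm_bound)
      also have "\<dots> \<le> expectation (\<lambda>\<omega>. ((cmod (S k \<omega>))\<^sup>2 + (cmod (X k \<omega>))\<^sup>2) / 2)"
      proof (rule integral_mono)
        fix \<omega> show "cmod (Z \<omega>) \<le> ((cmod (S k \<omega>))\<^sup>2 + (cmod (X k \<omega>))\<^sup>2) / 2"
          using sum_squares_bound[of "cmod (S k \<omega>)" "cmod (X k \<omega>)"] by (simp add: Z_def norm_mult)
      qed (use iZ iS iX in auto)
      also have "\<dots> = (a k + y k) / 2" using iS iX by (simp add: a_def y_def)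
      finally show "cmod (expectation Z) \<le> (a k + y k) / 2" .
      show "\<bar>exp (- (v * \<delta>)) - 1\<bar> \<le> v * \<delta>"
        using exp_ge_add_one_self[of "- (v * \<delta>)"] mult_nonneg_nonneg[OF v_nonneg \<delta>] by (simp add: abs_if)
      show "0 \<le> (a k + y k) / 2" using y0[of k] by (simp add: a_def)
    qed auto
    also have "2 * (((a k + y k) / 2) * (v * \<delta>)) = v * \<delta> * (a k + y k)" by simp
    finally have cross: "2 * expectation (\<lambda>\<omega>. Re (Z \<omega> * ?K \<omega>)) \<le> v * \<delta> * (a k + y k)" .
    have sqK: "(cmod (X k \<omega> * ?K \<omega>))\<^sup>2 = 2 * (cmod (X k \<omega>))\<^sup>2 - 2 * ((cmod (X k \<omega>))\<^sup>2 * cos (1 * (w ?q \<omega> - w ?p \<omega>)))" for \<omega>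
      unfolding norm_mult power_mult_distrib cmod_cis_minus_1_power2 by (simp add: algebra_simps)
    have X2m: "(\<lambda>\<omega>. (cmod (X k \<omega>))\<^sup>2) \<in> borel_measurable (F ?p)" using X[OF k] by simp
    have iXc: "integrable M (\<lambda>\<omega>. (cmod (X k \<omega>))\<^sup>2 * cos (1 * (w ?q \<omega> - w ?p \<omega>)))"
    proof (rule Bochner_Integration.integrable_bound[OF iX])
      show "AE \<omega> in M. norm ((cmod (X k \<omega>))\<^sup>2 * cos (1 * (w ?q \<omega> - w ?p \<omega>))) \<le> norm ((cmod (X k \<omega>))\<^sup>2)"
        by (intro AE_I2) (auto simp: abs_mult intro!: mult_left_le)
    qed (use Xm w_measurable[of ?p] w_measurable[of ?q] u t in auto)
    have "expectation (\<lambda>\<omega>. (cmod (X k \<omega> * ?K \<omega>))\<^sup>2) = 2 * y k - 2 * (y k * exp (- (1\<^sup>2 * v * (?q - ?p))))"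
      unfolding sqK using iX iXc expectation_cos_increment[OF u(1,2) X2m iX, of 1] by (simp add: y_def)
    also have "\<dots> = y k * (2 * (1 - exp (- (v * \<delta>))))"
      unfolding u(5) \<delta>_def[symmetric] by (simp add: algebra_simps)
    also have "\<dots> \<le> y k * (2 * (v * \<delta>))"
      using exp_ge_add_one_self[of "- (v * \<delta>)"] y0[of k] by (intro mult_left_mono) auto
    finally have sq: "expectation (\<lambda>\<omega>. (cmod (X k \<omega> * ?K \<omega>))\<^sup>2) \<le> y k * (2 * (v * \<delta>))" .
    have iXK: "integrable M (\<lambda>\<omega>. (cmod (X k \<omega> * ?K \<omega>))\<^sup>2)" unfolding sqK using iX iXc by auto
    have "a (Suc k) = expectation (\<lambda>\<omega>. (cmod (S k \<omega>))\<^sup>2 + 2 * Re (Z \<omega> * ?K \<omega>) + (cmod (X k \<omega> * ?K \<omega>))\<^sup>2)"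
      unfolding a_def S_def sum.lessThan_Suc cmod_add_power2 Z_def by (simp add: mult.assoc)
    also have "\<dots> = a k + 2 * expectation (\<lambda>\<omega>. Re (Z \<omega> * ?K \<omega>)) + expectation (\<lambda>\<omega>. (cmod (X k \<omega> * ?K \<omega>))\<^sup>2)"
    proof -
      have "expectation (\<lambda>\<omega>. A \<omega> + 2 * B \<omega> + C \<omega>) = expectation A + 2 * expectation B + expectation C"
        if "integrable M A" "integrable M B" "integrable M C" for A B C :: "'a \<Rightarrow> real"
        using that by simp
      from this[OF iS integrable_Re[OF iZK] iXK] show ?thesis unfolding a_def .
    qed
    also have "\<dots> \<le> a k + v * \<delta> * (a k + y k) + y k * (2 * (v * \<delta>))" using cross sq by linarith
    finally show ?thesis by (simp add: algebra_simps)
  qed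
  have "a k \<le> (1 + v * \<delta>) ^ k * (3 * v * \<delta> * (\<Sum>i<k. y i))" if "k \<le> n" for k
    using that
  proof (induction k)
    case (Suc k)
    have ge1: "1 \<le> 1 + v * \<delta>" using v_nonneg \<delta> by simp
    have "a (Suc k) \<le> (1 + v * \<delta>) * a k + 3 * v * \<delta> * y k" using rec Suc by simp
    also have "\<dots> \<le> (1 + v * \<delta>) * ((1 + v * \<delta>) ^ k * (3 * v * \<delta> * (\<Sum>i<k. y i))) + (1 + v * \<delta>) ^ Suc k * (3 * v * \<delta> * y k)"
    proof (intro add_mono mult_left_mono)
      show "3 * v * \<delta> * y k \<le> (1 + v * \<delta>) ^ Suc k * (3 * v * \<delta> * y k)"
        using one_le_power[OF ge1, of "Suc k"] v_nonneg \<delta> y0[of k] mult_right_mono[of 1 "(1 + v * \<delta>) ^ Suc k" "3 * v * \<delta> * y k"] by simp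
    qed (use Suc ge1 in auto)
    also have "\<dots> = (1 + v * \<delta>) ^ Suc k * (3 * v * \<delta> * (\<Sum>i<Suc k. y i))" by (simp add: algebra_simps)
    finally show ?case .
  qed (simp add: a_def S_def)
  from this[OF order.refl] have "a n \<le> (1 + v * \<delta>) ^ n * (3 * v * \<delta> * (\<Sum>i<n. y i))" .
  also have "\<dots> \<le> exp (v * t) * (3 * v * \<delta> * (\<Sum>i<n. y i))"
  proof (rule mult_right_mono)
    have "(1 + v * \<delta>) ^ n \<le> exp (v * \<delta>) ^ n" using v_nonneg \<delta> by (intro power_mono exp_ge_add_one_self) auto
    also have "\<dots> = exp (v * t)" using n by (simp add: exp_of_nat_mult[symmetric] \<delta>_def)
    finally show "(1 + v * \<delta>) ^ n \<le> exp (v * t)" .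
  qed (use v_nonneg \<delta> y0 in \<open>auto intro!: mult_nonneg_nonneg sum_nonneg\<close>)
  finally show ?thesis unfolding a_def S_def y_def \<delta>_def by (simp add: sum_distrib_left mult_ac)
qed

text \<open>Localization by an event in place of a stopping time: \<open>G m t\<close> shrinks as
  \<open>t\<close> grows, so on \<open>G m s\<close> no earlier value of \<open>D\<close> has been
  cut off.\<close>

definition G :: "real \<Rightarrow> real \<Rightarrow> 'a set" where
  "G m t = {\<omega>. \<forall>s\<in>{0..t}. cmod (D s \<omega>) \<le> m}"

text \<open>The event ranges over uncountably many times. By continuity it says that the integral of
  the excess of \<open>cmod (D s)\<close> over \<open>m\<close> vanishes, and this integral is
  adapted.\<close>

lemma indicator_G_adapted:
  assumes "0 \<le> t" "0 \<le> m"
  shows "(\<lambda>\<omega>. indicator (G m t) \<omega> :: real) \<in> borel_measurable (F t)"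
proof (cases "t = 0")
  \<comment> \<open>The integral over a single point would carry no information; this case is
    settled by \<open>D 0 = 0\<close>.\<close>
  case True
  then have "G m t = UNIV" using assms by (auto simp: G_def D_0)
  then show ?thesis by simp
next
  case False
  define f where "f s \<omega> = max (cmod (D s \<omega>) - m) 0" for s \<omega>
  have cont: "continuous_on {0..u} (\<lambda>s. f s \<omega>)" for u \<omega>
    unfolding f_def by (intro continuous_intros D_continuous)
  have "(\<lambda>\<omega>. integral {0..t} (\<lambda>s. f s \<omega>)) \<in> borel_measurable (F t)"
    using assms(1) cont unfolding f_def
    by (intro integral_adapted borel_measurable_max borel_measurable_diff borel_measurable_const measurable_compose[OF D_adapted borel_measurable_norm]) auto
  moreover have "indicator (G m t) \<omega> = (indicator {0} (integral {0..t} (\<lambda>s. f s \<omega>)) :: real)" for \<omega>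
  proof -
    have "integral {0..t} (\<lambda>s. f s \<omega>) = 0 \<longleftrightarrow> (\<forall>s\<in>{0..t}. f s \<omega> = 0)"
      using assms False cont by (intro integral_eq_0_iff) (auto simp: f_def)
    also have "\<dots> \<longleftrightarrow> \<omega> \<in> G m t" by (auto simp: f_def G_def max_def)
    finally show ?thesis by (auto simp: indicator_def)
  qed
  ultimately show ?thesis by (simp add: measurable_compose[where g = "indicator {0}"])
qed

lemma D_truncated_eq_0:
  assumes t: "0 \<le> t" and m: "0 \<le> m"
  shows "expectation (\<lambda>\<omega>. (cmod (D t \<omega>))\<^sup>2 * indicator (G m t) \<omega>) = 0"
proof -
  define X where "X s \<omega> = D s \<omega> * complex_of_real (indicator (G m s) \<omega>)" for s \<omega>
  define f where "f s = expectation (\<lambda>\<omega>. (cmod (X s \<omega>))\<^sup>2)" for s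
  have X_adapted: "X s \<in> borel_measurable (F s)" if "0 \<le> s" for s
    unfolding X_def using D_adapted[OF that] indicator_G_adapted[OF that m] by measurable
  have X_meas: "X s \<in> borel_measurable M" if "0 \<le> s" for s using measurable_F_M[OF X_adapted[OF that] that] .
  have X_bound: "cmod (X s \<omega>) \<le> m" if "0 \<le> s" for s \<omega>
    using that m by (auto simp: X_def G_def indicator_def norm_mult)
  have iX: "integrable M (\<lambda>\<omega>. (cmod (X s \<omega>))\<^sup>2)" if "0 \<le> s" for s
    by (rule integrable_const_bound[of _ "m\<^sup>2"]) (use X_meas[OF that] X_bound[OF that] in \<open>auto intro!: power_mono\<close>)
  have "f t = 0"
  proof (rule discrete_gronwall[where f = f and t = t and T = t and L = "6 * v * exp (v * t)" and B = "m\<^sup>2"])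
    \<comment> \<open>The 6 is the 3 of \<open>expectation_sum_cis_inc\<close> times the 2 from
      squaring \<open>S + Z n\<close>.\<close>
    show "0 \<le> 6 * v * exp (v * t)" using v_nonneg by simp
    show "t \<in> {0..t}" using t by simp
    show "0 \<le> f s" if "s \<in> {0..t}" for s unfolding f_def by (intro integral_nonneg_AE) auto
    show "f s \<le> m\<^sup>2" if "s \<in> {0..t}" for s
    proof -
      have "f s \<le> expectation (\<lambda>_. m\<^sup>2)"
        unfolding f_def using that iX X_bound by (intro integral_mono) (auto intro!: power_mono)
      then show ?thesis by (simp add: prob_space)
    qed
    fix s assume s: "s \<in> {0..t}"
    then have s0: "0 \<le> s" by simp
    define Z where "Z n \<omega> = D s \<omega> - (\<Sum>i<n. D (grid s n i) \<omega> * cis_inc s n i \<omega>)" for n \<omega>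
    have Z: "null_in_prob Z" unfolding Z_def by (rule null_in_prob_D[OF s0])
    then have Zm: "Z n \<in> borel_measurable M" for n by (simp add: null_in_prob_def)
    \<comment> \<open>The 2 serves the case \<open>cmod (Z n \<omega>) \<le> 1\<close>, where the
      square of \<open>Z n\<close> is at most \<open>cmod (Z n \<omega>)\<close>; otherwise the
      bound \<open>m\<^sup>2\<close> on the square of \<open>X s\<close> is used.\<close>
    define \<rho> where "\<rho> n = (2 + m\<^sup>2) * expectation (\<lambda>\<omega>. min 1 (cmod (Z n \<omega>)))" for n
    have "\<rho> \<longlonglongrightarrow> 0" unfolding \<rho>_def using Z by (intro tendsto_mult_right_zero) (simp add: null_in_prob_def)
    moreover have "f s \<le> 6 * v * exp (v * t) * (\<Sum>i<n. (s / real n) * f (grid s n i)) + \<rho> n" if n: "n > 0" for n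
    proof -
      define S where "S \<omega> = (\<Sum>i<n. X (grid s n i) \<omega> * cis_inc s n i \<omega>)" for \<omega>
      have p: "0 \<le> grid s n i" for i using s0 by simp
      have cis_inc_meas: "cis_inc s n i \<in> borel_measurable M" for i
        using p by (intro borel_measurable_diff cis_measurable w_measurable borel_measurable_const)
      have Sm: "S \<in> borel_measurable M"
        unfolding S_def by (intro borel_measurable_sum borel_measurable_times X_meas cis_inc_meas p)
      have "cmod (S \<omega>) \<le> (\<Sum>i<n. m * 2)" for \<omega>
        unfolding S_def using m p by (intro sum_norm_le) (auto simp: norm_mult intro!: mult_mono X_bound cmod_cis_minus_1_le_2)
      then have iS: "integrable M (\<lambda>\<omega>. (cmod (S \<omega>))\<^sup>2)"
        by (intro integrable_const_bound[of _ "(\<Sum>i<n. m * 2)\<^sup>2"]) (use Sm in \<open>auto intro!: power_mono\<close>)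
      have "f s \<le> expectation (\<lambda>\<omega>. 2 * (cmod (S \<omega>))\<^sup>2 + (2 + m\<^sup>2) * min 1 (cmod (Z n \<omega>)))"
        unfolding f_def
      proof (rule integral_mono)
        fix \<omega>
        have rhs0: "0 \<le> 2 * (cmod (S \<omega>))\<^sup>2 + (2 + m\<^sup>2) * min 1 (cmod (Z n \<omega>))" by simp
        show "(cmod (X s \<omega>))\<^sup>2 \<le> 2 * (cmod (S \<omega>))\<^sup>2 + (2 + m\<^sup>2) * min 1 (cmod (Z n \<omega>))"
        \<comment> \<open>Off \<open>G m s\<close> the left side is 0; on it the truncation is
          inactive at all earlier grid points, and \<open>X s = S + Z n\<close> holds
          exactly.\<close>
        proof (cases "\<omega> \<in> G m s")
          case False
          then show ?thesis using rhs0 by (simp add: X_def)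
        next
          case True
          have "X (grid s n i) \<omega> = D (grid s n i) \<omega>" if "i < n" for i
          proof -
            have "\<omega> \<in> G m (grid s n i)"
              using True uniform_partition_le[OF n s0 that] by (auto simp: G_def)
            then show ?thesis by (simp add: X_def)
          qed
          then have "S \<omega> = (\<Sum>i<n. D (grid s n i) \<omega> * cis_inc s n i \<omega>)" unfolding S_def by simp
          then have XS: "X s \<omega> = S \<omega> + Z n \<omega>" using True by (simp add: Z_def X_def)
          show ?thesis
          proof (cases "cmod (Z n \<omega>) \<le> 1")
            case True
            have "cmod (X s \<omega>) \<le> cmod (S \<omega>) + cmod (Z n \<omega>)" unfolding XS by (rule norm_triangle_ineq)
            then have "(cmod (X s \<omega>))\<^sup>2 \<le> (cmod (S \<omega>) + cmod (Z n \<omega>))\<^sup>2" by (intro power_mono) auto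
            also have "\<dots> \<le> 2 * (cmod (S \<omega>))\<^sup>2 + 2 * (cmod (Z n \<omega>))\<^sup>2"
              using sum_squares_bound[of "cmod (S \<omega>)" "cmod (Z n \<omega>)"] by (simp add: power2_sum)
            also have "(cmod (Z n \<omega>))\<^sup>2 \<le> cmod (Z n \<omega>)"
              using True mult_left_mono[of "cmod (Z n \<omega>)" 1 "cmod (Z n \<omega>)"] by (simp add: power2_eq_square)
            finally have "(cmod (X s \<omega>))\<^sup>2 \<le> 2 * (cmod (S \<omega>))\<^sup>2 + 2 * cmod (Z n \<omega>)" by simp
            also have "\<dots> \<le> 2 * (cmod (S \<omega>))\<^sup>2 + (2 + m\<^sup>2) * cmod (Z n \<omega>)"
              by (intro add_left_mono mult_right_mono) auto
            finally show ?thesis using True by simp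
          next
            case False
            have "(cmod (X s \<omega>))\<^sup>2 \<le> m\<^sup>2" using X_bound[OF s0] by (intro power_mono) auto
            then show ?thesis using False by (simp add: add_increasing)
          qed
        qed
      qed (use iX[OF s0] iS Zm in \<open>auto intro!: Bochner_Integration.integrable_add integrable_mult_right integrable_min_norm\<close>)
      also have "\<dots> = 2 * expectation (\<lambda>\<omega>. (cmod (S \<omega>))\<^sup>2) + \<rho> n"
        unfolding \<rho>_def using iS integrable_min_norm[OF Zm[of n]] by simp
      also have "expectation (\<lambda>\<omega>. (cmod (S \<omega>))\<^sup>2) \<le> 3 * v * exp (v * s) * (\<Sum>i<n. (s / real n) * f (grid s n i))"
        unfolding S_def f_def by (intro expectation_sum_cis_inc[where m = m] s0 n X_adapted X_bound p)
      also have "\<dots> \<le> 3 * v * exp (v * t) * (\<Sum>i<n. (s / real n) * f (grid s n i))"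
        using v_nonneg s by (intro mult_right_mono mult_left_mono sum_nonneg mult_nonneg_nonneg)
          (auto intro!: mult_left_mono integral_nonneg_AE simp: f_def)
      finally show ?thesis by simp
    qed
    ultimately show "\<exists>\<rho>. \<rho> \<longlonglongrightarrow> 0 \<and> (\<forall>n>0. f s \<le> 6 * v * exp (v * t) * (\<Sum>i<n. (s / real n) * f (grid s n i)) + \<rho> n)"
      by blast
  qed
  moreover have "(cmod (X t \<omega>))\<^sup>2 = (cmod (D t \<omega>))\<^sup>2 * indicator (G m t) \<omega>" for \<omega>
    by (simp add: X_def indicator_def)
  ultimately show ?thesis by (simp add: f_def)
qed

lemma D_eq_0_AE:
  assumes t: "0 \<le> t"
  shows "AE \<omega> in M. D t \<omega> = 0"
proof -
  have "AE \<omega> in M. (cmod (D t \<omega>))\<^sup>2 * indicator (G (real m) t) \<omega> = 0" for m :: nat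
  proof -
    have meas: "(\<lambda>\<omega>. (cmod (D t \<omega>))\<^sup>2 * indicator (G (real m) t) \<omega>) \<in> borel_measurable M"
      using t by (intro borel_measurable_times borel_measurable_power measurable_compose[OF measurable_F_M[OF D_adapted] borel_measurable_norm] measurable_F_M[OF indicator_G_adapted]) auto
    have "integrable M (\<lambda>\<omega>. (cmod (D t \<omega>))\<^sup>2 * indicator (G (real m) t) \<omega>)"
      by (rule integrable_const_bound[of _ "(real m)\<^sup>2"]) (use meas t in \<open>auto simp: G_def indicator_def intro!: power_mono\<close>)
    then show ?thesis
      using integral_nonneg_eq_0_iff_AE[of M "\<lambda>\<omega>. (cmod (D t \<omega>))\<^sup>2 * indicator (G (real m) t) \<omega>"] D_truncated_eq_0[OF t, of "real m"]
      by simp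
  qed
  then have "AE \<omega> in M. \<forall>m::nat. (cmod (D t \<omega>))\<^sup>2 * indicator (G (real m) t) \<omega> = 0"
    unfolding AE_all_countable by blast
  then show ?thesis
  proof eventually_elim
    case (elim \<omega>)
    \<comment> \<open>The path of \<open>D\<close> is bounded on \<open>{0..t}\<close>, so some
      integer truncation level leaves \<open>D t\<close> untouched.\<close>
    obtain B where B: "\<And>s. s \<in> {0..t} \<Longrightarrow> cmod (D s \<omega>) \<le> B" using path_bounded[OF D_continuous] by blast
    obtain m :: nat where m: "B \<le> real m" using real_arch_simple by blast
    have "\<omega> \<in> G (real m) t" unfolding G_def using B m by force
    then show ?case using elim[rule_format, of m] by simp
  qed
qed

text \<open>\<open>D_eq_0_AE\<close> has an exceptional set for each time. These sets are united
  over countably many grid points; then all Riemann sums of \<open>cmod (D s)\<close> vanish, hence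
  the integral, and by continuity \<open>D\<close> at every time.\<close>

theorem pathwise_equation:
  "AE \<omega> in M. \<forall>t\<ge>0. h t \<omega> = cis (w t \<omega>) * (x + integral {0..t} (\<lambda>s. cis (- w s \<omega>) * b (h s \<omega>)))"
proof -
  have "AE \<omega> in M. \<forall>N n i :: nat. D (real i * real N / real n) \<omega> = 0"
    using D_eq_0_AE by (simp add: AE_all_countable)
  then show ?thesis
  proof eventually_elim
    case (elim \<omega>)
    have "D t \<omega> = 0" if t: "0 \<le> t" for t
    proof -
      \<comment> \<open>\<open>t + 1\<close> makes the interval nondegenerate also for
        \<open>t = 0\<close>.\<close>
      obtain N :: nat where N: "t + 1 \<le> real N" using real_arch_simple by blast
      have cont: "continuous_on {0..real N} (\<lambda>s. cmod (D s \<omega>))" by (intro continuous_intros D_continuous)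
      have "(\<lambda>n. \<Sum>i<n. (real N / real n) *\<^sub>R cmod (D (real i * real N / real n) \<omega>)) \<longlonglongrightarrow> integral {0..real N} (\<lambda>s. cmod (D s \<omega>))"
        by (rule riemann_sum_tendsto[OF cont]) simp
      then have "integral {0..real N} (\<lambda>s. cmod (D s \<omega>)) = 0" using elim by (simp add: LIMSEQ_const_iff)
      then have "cmod (D t \<omega>) = 0" using t N by (intro integral_eq_0_imp_eq_0[OF cont]) auto
      then show ?thesis by simp
    qed
    then show ?case by (simp add: D_def c_def)
  qed
qed

end

subsection \<open>The equation on the unit disc\<close>

text \<open>The phase does not affect the modulus, so it is enough to differentiate
  \<open>cis (- \<theta>) * Y\<close>, which is continuously differentiable although
  \<open>\<theta>\<close> is merely continuous. In the derivative of the squared modulus the phases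
  cancel, and a linear equation for \<open>1 - (cmod Y)\<^sup>2\<close> is left.\<close>

lemma rotating_riccati:
  fixes Y :: "real \<Rightarrow> complex" and \<theta> :: "real \<Rightarrow> real" and K :: real
  assumes Y: "continuous_on {0..T} Y" and \<theta>: "continuous_on {0..T} \<theta>"
    and eq: "\<And>r. r \<in> {0..T} \<Longrightarrow> Y r = cis (\<theta> r) * (z + integral {0..r} (\<lambda>s. cis (- \<theta> s) * (complex_of_real K * (1 - (Y s)\<^sup>2))))"
    and r: "r \<in> {0..T}"
  shows "1 - (cmod (Y r))\<^sup>2 = (1 - (cmod z)\<^sup>2) * exp (- 2 * K * integral {0..r} (\<lambda>s. Re (Y s)))"
proof -
  define g where "g s = cis (- \<theta> s) * (complex_of_real K * (1 - (Y s)\<^sup>2))" for s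
  define C where "C r = z + integral {0..r} g" for r
  define I where "I r = integral {0..r} (\<lambda>s. Re (Y s))" for r
  define u where "u r = 1 - ((Re (C r))\<^sup>2 + (Im (C r))\<^sup>2)" for r
  have gc: "continuous_on {0..T} g" unfolding g_def by (intro continuous_intros Y \<theta>)
  have YC: "Y r = cis (\<theta> r) * C r" if "r \<in> {0..T}" for r using eq[OF that] by (simp add: C_def g_def[abs_def])
  have CY: "C r = cis (- \<theta> r) * Y r" if "r \<in> {0..T}" for r
    using YC[OF that] by (simp add: mult.assoc[symmetric] cis_mult)
  have u_eq: "u r = 1 - (cmod (Y r))\<^sup>2" if "r \<in> {0..T}" for r
    unfolding u_def YC[OF that] norm_mult by (simp add: cmod_power2)
  have dC: "(C has_vector_derivative g r) (at r within {0..T})" if "r \<in> {0..T}" for r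
    unfolding C_def using has_vector_derivative_add[OF has_vector_derivative_const integral_has_vector_derivative[OF gc that]] by simp
  have dI: "(I has_field_derivative Re (Y r)) (at r within {0..T})" if "r \<in> {0..T}" for r
    unfolding I_def has_real_derivative_iff_has_vector_derivative
    by (rule integral_has_vector_derivative) (intro continuous_intros Y that)+
  have dRe: "((\<lambda>r. Re (C r)) has_field_derivative Re (g r)) (at r within {0..T})"
    and dIm: "((\<lambda>r. Im (C r)) has_field_derivative Im (g r)) (at r within {0..T})" if "r \<in> {0..T}" for r
    using bounded_linear.has_vector_derivative[OF bounded_linear_Re dC[OF that]]
      bounded_linear.has_vector_derivative[OF bounded_linear_Im dC[OF that]]
    by (simp_all add: has_real_derivative_iff_has_vector_derivative)
  have key: "Re (C r) * Re (g r) + Im (C r) * Im (g r) = K * Re (Y r) * u r" if "r \<in> {0..T}" for r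
  proof -
    have "Re (C r) * Re (g r) + Im (C r) * Im (g r) = Re (cnj (C r) * g r)" by simp
    also have "cnj (C r) * g r = (cis (\<theta> r) * cis (- \<theta> r)) * (cnj (Y r) * (complex_of_real K * (1 - (Y r)\<^sup>2)))"
      unfolding CY[OF that] g_def by (simp add: cis_cnj mult_ac)
    also have "\<dots> = complex_of_real K * (cnj (Y r) - complex_of_real ((cmod (Y r))\<^sup>2) * Y r)"
      unfolding complex_norm_square by (simp add: cis_mult power2_eq_square algebra_simps)
    also have "Re \<dots> = K * Re (Y r) * u r" unfolding u_eq[OF that] by (simp add: algebra_simps)
    finally show ?thesis .
  qed
  \<comment> \<open>Integrating factor: the product turns out to be constant.\<close>
  have "((\<lambda>r. u r * exp (2 * K * I r)) has_field_derivative 0) (at r within {0..T})" if "r \<in> {0..T}" for r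
  proof -
    have deriv: "((\<lambda>r. (1 - ((P r)\<^sup>2 + (Q r)\<^sup>2)) * exp (2 * K * I r)) has_field_derivative
        (- (2 * P r * p + 2 * Q r * q)) * exp (2 * K * I r) + (1 - ((P r)\<^sup>2 + (Q r)\<^sup>2)) * (exp (2 * K * I r) * (2 * K * Re (Y r)))) (at r within {0..T})"
      if "(P has_field_derivative p) (at r within {0..T})" "(Q has_field_derivative q) (at r within {0..T})" for P Q :: "real \<Rightarrow> real" and p q
      using that dI[OF \<open>r \<in> {0..T}\<close>] by (auto intro!: derivative_eq_intros simp: algebra_simps)
    have "((\<lambda>r. u r * exp (2 * K * I r)) has_field_derivative
       (- (2 * Re (C r) * Re (g r) + 2 * Im (C r) * Im (g r))) * exp (2 * K * I r) + u r * (exp (2 * K * I r) * (2 * K * Re (Y r)))) (at r within {0..T})"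
      unfolding u_def by (rule deriv[OF dRe[OF that] dIm[OF that]])
    also have "(- (2 * Re (C r) * Re (g r) + 2 * Im (C r) * Im (g r))) = - 2 * (K * Re (Y r) * u r)"
      unfolding key[OF that, symmetric] by simp
    finally show ?thesis by (simp add: algebra_simps)
  qed
  then obtain c where c: "\<And>r. r \<in> {0..T} \<Longrightarrow> u r * exp (2 * K * I r) = c"
    using has_field_derivative_zero_constant[of "{0..T}" "\<lambda>r. u r * exp (2 * K * I r)"] by auto
  have "u r * exp (2 * K * I r) = u 0 * exp (2 * K * I 0)" using c[OF r] c[of 0] r by simp
  also have "\<dots> = 1 - (cmod z)\<^sup>2" by (simp add: u_def C_def I_def cmod_power2)
  finally have "u r * (exp (2 * K * I r) * exp (- (2 * K * I r))) = (1 - (cmod z)\<^sup>2) * exp (- (2 * K * I r))"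
    by (simp only: mult.assoc[symmetric])
  then show ?thesis unfolding u_eq[OF r] I_def by (simp add: exp_add[symmetric])
qed

text \<open>The left side is the generator applied to the corrected logarithm; the rotation damps
  \<open>z\<close> at rate \<open>v\<close> and \<open>z\<^sup>2\<close> at rate
  \<open>4 * v\<close>. The choice of \<open>\<beta>\<close> cancels the term
  \<open>- 2 K Re z\<close> of the logarithm and leaves \<open>\<beta> K D\<close> with
  \<open>D = Re (1 - z\<^sup>2)\<close>, which is nonpositive but vanishes at \<open>z = 1\<close>
  and \<open>z = - 1\<close>. There the damping of \<open>\<gamma> z\<^sup>2\<close> is negative.
  Since \<open>Re (z (1 - z\<^sup>2)) \<le> 2 D\<close>, \<open>\<gamma>\<close> can be chosen such
  that the total coefficient of \<open>D\<close> is 0.\<close>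

lemma lyapunov_drift_le:
  fixes z :: complex and K v :: real
  defines "\<gamma> \<equiv> K\<^sup>2 / (2 * v * (K + v))" and "\<beta> \<equiv> - 2 * K / v"
  assumes K: "K > 0" and v: "v > 0" and z: "cmod z \<le> 1"
  shows "\<beta> * Re (complex_of_real K * (1 - z\<^sup>2)) - v * \<beta> * Re z
     + 2 * \<gamma> * Re (z * (complex_of_real K * (1 - z\<^sup>2))) - 4 * v * \<gamma> * Re (z\<^sup>2) - 2 * K * Re z \<le> - 4 * v * \<gamma>"
proof -
  define p q where "p = Re z" and "q = Im z"
  define D where "D = 1 - p\<^sup>2 + q\<^sup>2"
  have pq: "p\<^sup>2 + q\<^sup>2 \<le> 1" using z power_le_one[of "cmod z" 2] by (simp add: p_def q_def cmod_power2[symmetric])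
  have "2 * q\<^sup>2 \<le> D" using pq by (simp add: D_def)
  moreover have "0 \<le> 2 * q\<^sup>2" by simp
  ultimately have D: "2 * q\<^sup>2 \<le> D" "D \<ge> 0" by linarith+
  have p1: "p \<le> 1" using complex_Re_le_cmod[of z] z by (simp add: p_def)
  have \<gamma>: "\<gamma> > 0" using K v by (simp add: \<gamma>_def)
  have Dz: "Re (1 - z\<^sup>2) = D" "Re (z\<^sup>2) = 1 - D" by (simp_all add: D_def p_def q_def Re_power2)
  have cub: "Re (z * (1 - z\<^sup>2)) = p * (D + 2 * q\<^sup>2)"
    by (simp add: D_def p_def q_def power2_eq_square algebra_simps)
  have "p * (D + 2 * q\<^sup>2) \<le> 1 * (D + 2 * q\<^sup>2)" using p1 D by (intro mult_right_mono) auto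
  then have cub_le: "Re (z * (1 - z\<^sup>2)) \<le> 2 * D" unfolding cub using D by simp
  have vb: "v * \<beta> = - 2 * K" using v by (simp add: \<beta>_def)
  have bal: "\<beta> * K + 4 * \<gamma> * K + 4 * v * \<gamma> = 0" using K v by (simp add: \<beta>_def \<gamma>_def divide_simps) algebra
  have "\<beta> * Re (complex_of_real K * (1 - z\<^sup>2)) - v * \<beta> * Re z
     + 2 * \<gamma> * Re (z * (complex_of_real K * (1 - z\<^sup>2))) - 4 * v * \<gamma> * Re (z\<^sup>2) - 2 * K * Re z
     = \<beta> * K * D + 2 * \<gamma> * K * Re (z * (1 - z\<^sup>2)) - 4 * v * \<gamma> * (1 - D)"
  proof -
    have "Re (complex_of_real K * (1 - z\<^sup>2)) = K * D" using Dz by simp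
    moreover have "Re (z * (complex_of_real K * (1 - z\<^sup>2))) = K * Re (z * (1 - z\<^sup>2))"
      by (simp add: algebra_simps power2_eq_square)
    ultimately show ?thesis unfolding vb Dz by simp
  qed
  also have "\<dots> \<le> \<beta> * K * D + 2 * \<gamma> * K * (2 * D) - 4 * v * \<gamma> * (1 - D)"
    using cub_le \<gamma> K by (intro diff_right_mono add_left_mono mult_left_mono) auto
  also have "\<dots> = (\<beta> * K + 4 * \<gamma> * K + 4 * v * \<gamma>) * D - 4 * v * \<gamma>" by (simp add: algebra_simps)
  finally show ?thesis unfolding bal by simp
qed

text \<open>
  The fluctuation \<open>cis (\<theta> s)\<close> is kept exact, because its expectation is known; the remaining errors
  are \<open>O(s\<^sup>2)\<close> or bounded by \<open>\<integral>\<^sub>0\<^sup>s \<bar>cis (\<theta> r) - 1\<bar> dr\<close>, whose expectation is \<open>O(s\<^sup>3\<^sup>/\<^sup>2)\<close>.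
\<close>

lemma lyapunov_one_step:
  fixes Y :: "real \<Rightarrow> complex" and \<theta> :: "real \<Rightarrow> real" and K \<beta> \<gamma> a s :: real and z b :: complex
  defines "b \<equiv> complex_of_real K * (1 - z\<^sup>2)"
    and "dev \<equiv> integral {0..s} (\<lambda>r. cmod (cis (\<theta> r) - 1))"
    and "c \<equiv> \<bar>\<beta>\<bar> + \<bar>\<gamma>\<bar>"
  assumes Y: "continuous_on {0..s} Y" and \<theta>: "continuous_on {0..s} \<theta>" and \<theta>0: "\<theta> 0 = 0"
    and eq: "\<And>r. r \<in> {0..s} \<Longrightarrow> Y r = cis (\<theta> r) * (z + integral {0..r} (\<lambda>s. cis (- \<theta> s) * (complex_of_real K * (1 - (Y s)\<^sup>2))))"
    and z: "cmod z < 1" and K: "K > 0" and s: "s > 0" "2 * K * s \<le> 1" and a: "0 < a" "a \<le> 1" "a * c \<le> 1"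
  shows "(1 - (cmod (Y s))\<^sup>2) powr a * (1 + a * Re (\<beta> * Y s + \<gamma> * (Y s)\<^sup>2)) \<le>
    (1 - (cmod z)\<^sup>2) powr a * (1 + a * (Re (cis (\<theta> s) * (\<beta> * (z + s * b))) + Re (cis (2 * \<theta> s) * (\<gamma> * (z\<^sup>2 + 2 * s * (z * b))))
      - 2 * K * s * Re z + 2 * a * K * c * s + (4 * K + 12 * c * K) * dev + (12 * K\<^sup>2 + 10 * c * K\<^sup>2) * s\<^sup>2))"
proof -
  have s0: "0 \<le> s" using s by simp
  \<comment> \<open>The exact formula for \<open>1 - (cmod (Y r))\<^sup>2\<close> keeps the path in
    the disc, which makes the constants below independent of the path.\<close>
  have Y1: "cmod (Y r) \<le> 1" if "r \<in> {0..s}" for r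
  proof -
    have "0 < 1 - (cmod z)\<^sup>2" using z power_strict_mono[of "cmod z" 1 2] by simp
    then have "0 < (1 - (cmod z)\<^sup>2) * exp (- 2 * K * integral {0..r} (\<lambda>s. Re (Y s)))" by simp
    also have "\<dots> = 1 - (cmod (Y r))\<^sup>2" by (rule rotating_riccati[OF Y \<theta> eq that, symmetric])
    finally have "0 < 1 - (cmod (Y r))\<^sup>2" .
    then have "(cmod (Y r))\<^sup>2 \<le> 1\<^sup>2" by simp
    then show ?thesis by (rule power2_le_imp_le) simp
  qed
  define j where "j r = cmod (cis (\<theta> r) - 1)" for r
  have jc: "continuous_on {0..s} j" unfolding j_def by (intro continuous_intros \<theta>)
  have j0: "0 \<le> j r" for r by (simp add: j_def)
  have j_int: "j integrable_on {0..r}" if "r \<in> {0..s}" for r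
    by (rule integrable_continuous_interval) (rule continuous_on_subset[OF jc], use that in auto)
  have dev: "dev = integral {0..s} j" "0 \<le> dev"
    unfolding dev_def j_def by (auto intro!: integral_nonneg j_int[unfolded j_def] s0)
  have lin: "integral {0..s} (\<lambda>r. 2 * r) = s\<^sup>2"
    using integral_unique[OF ident_has_integral[OF s0]] by simp
  have b2: "cmod (complex_of_real K * (1 - y\<^sup>2)) \<le> 2 * K" if "cmod y \<le> 1" for y
  proof -
    have "cmod (1 - y\<^sup>2) \<le> 2"
      using norm_triangle_ineq4[of 1 "y\<^sup>2"] power_le_one[of "cmod y" 2] that by (simp add: norm_power)
    then show ?thesis using K by (simp add: norm_mult)
  qed
  define g where "g r = cis (- \<theta> r) * (complex_of_real K * (1 - (Y r)\<^sup>2))" for r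
  have gc: "continuous_on {0..s} g" unfolding g_def by (intro continuous_intros Y \<theta>)
  have g_int: "g integrable_on {0..r}" if "r \<in> {0..s}" for r
    by (rule integrable_continuous_interval) (rule continuous_on_subset[OF gc], use that in auto)
  define C where "C r = z + integral {0..r} g" for r
  have YC: "Y r = cis (\<theta> r) * C r" if "r \<in> {0..s}" for r using eq[OF that] by (simp add: C_def g_def[abs_def])
  have C1: "cmod (C r) \<le> 1" if "r \<in> {0..s}" for r using Y1[OF that] YC[OF that] by (simp add: norm_mult)
  have g_bound: "cmod (g r) \<le> 2 * K" if "r \<in> {0..s}" for r
    unfolding g_def norm_mult[of "cis _"] norm_cis using b2[OF Y1[OF that]] by simp
  have Cz: "cmod (C r - z) \<le> 2 * K * r" if "r \<in> {0..s}" for r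
  proof -
    have "cmod (integral {0..r} g) \<le> 2 * K * (r - 0)"
      by (rule integral_bound) (use that g_bound in \<open>auto intro: continuous_on_subset[OF gc]\<close>)
    then show ?thesis by (simp add: C_def)
  qed
  have Yz: "cmod (Y r - z) \<le> j r + 2 * K * r" if "r \<in> {0..s}" for r
  proof -
    have "Y r - z = (cis (\<theta> r) - 1) * C r + (C r - z)" unfolding YC[OF that] by (simp add: algebra_simps)
    also have "cmod \<dots> \<le> j r * cmod (C r) + cmod (C r - z)"
      using norm_triangle_ineq[of "(cis (\<theta> r) - 1) * C r" "C r - z"] by (simp add: norm_mult j_def)
    also have "\<dots> \<le> j r * 1 + 2 * K * r" using C1[OF that] Cz[OF that] j0 by (intro add_mono mult_left_mono) auto
    finally show ?thesis by simp
  qed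
  \<comment> \<open>The errors below are integrals over \<open>{0..s}\<close>, and their integrands
    are majorized by a combination of \<open>j r\<close> and \<open>2 * r\<close>, whose integrals
    are \<open>dev\<close> and \<open>s\<^sup>2\<close>.\<close>
  have maj_int: "(\<lambda>r. p * j r + q * (2 * r)) integrable_on {0..s}" for p q :: real
    by (intro integrable_continuous_interval continuous_intros jc)
  have maj: "integral {0..s} (\<lambda>r. p * j r + q * (2 * r)) = p * dev + q * s\<^sup>2" for p q :: real
  proof -
    have "integral {0..s} (\<lambda>r. p * j r + q * (2 * r)) = integral {0..s} (\<lambda>r. p * j r) + integral {0..s} (\<lambda>r. q * (2 * r))"
      by (intro integral_add integrable_continuous_interval continuous_intros jc)
    then show ?thesis unfolding dev(1) lin[symmetric] by simp
  qed
  \<comment> \<open>Error of one Euler step for the rotated path \<open>C\<close>.\<close>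
  define \<rho> where "\<rho> = C s - (z + s * b)"
  have \<rho>: "cmod \<rho> \<le> 4 * K * dev + 2 * K\<^sup>2 * s\<^sup>2"
  proof -
    have "integral {0..s} (\<lambda>r. g r - b) = integral {0..s} g - integral {0..s} (\<lambda>r. b)"
      using g_int[of s] s0 by (intro integral_diff) auto
    then have "\<rho> = integral {0..s} (\<lambda>r. g r - b)"
      unfolding \<rho>_def C_def using s0 by (simp add: scaleR_conv_of_real)
    also have "cmod \<dots> \<le> integral {0..s} (\<lambda>r. 4 * K * j r + 2 * K\<^sup>2 * (2 * r))"
    proof (rule integral_norm_bound_integral)
      show "(\<lambda>r. g r - b) integrable_on {0..s}" using g_int[of s] s0 by (intro integrable_diff) auto
      fix r assume r: "r \<in> {0..s}"
      define bY where "bY = complex_of_real K * (1 - (Y r)\<^sup>2)"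
      have "cmod (cis (- \<theta> r) - 1) = j r"
        unfolding j_def using complex_mod_cnj[of "cis (\<theta> r) - 1"] by (simp add: cis_cnj)
      moreover have "cmod bY \<le> 2 * K" unfolding bY_def by (rule b2[OF Y1[OF r]])
      ultimately have 1: "cmod ((cis (- \<theta> r) - 1) * bY) \<le> j r * (2 * K)"
        unfolding norm_mult using j0[of r] by (simp add: mult_left_mono)
      have "bY - b = complex_of_real K * ((z - Y r) * (z + Y r))"
        by (simp add: bY_def b_def power2_eq_square algebra_simps)
      then have "cmod (bY - b) = K * (cmod (Y r - z) * cmod (z + Y r))"
        using K by (simp add: norm_mult norm_minus_commute)
      also have "\<dots> \<le> K * ((j r + 2 * K * r) * 2)"
        using norm_triangle_ineq[of z "Y r"] Y1[OF r] z Yz[OF r] j0[of r] K r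
        by (intro mult_left_mono mult_mono) auto
      finally have 2: "cmod (bY - b) \<le> K * ((j r + 2 * K * r) * 2)" .
      have gb: "g r - b = (cis (- \<theta> r) - 1) * bY + (bY - b)" by (simp add: g_def bY_def algebra_simps)
      have "cmod (g r - b) \<le> j r * (2 * K) + K * ((j r + 2 * K * r) * 2)"
        unfolding gb by (rule norm_triangle_le[OF add_mono[OF 1 2]])
      then show "cmod (g r - b) \<le> 4 * K * j r + 2 * K\<^sup>2 * (2 * r)"
        by (simp add: algebra_simps power2_eq_square)
    qed (rule maj_int)
    finally show ?thesis unfolding maj .
  qed
  define I where "I = integral {0..s} (\<lambda>r. Re (Y r))"
  have Re_int: "(\<lambda>r. Re (Y r)) integrable_on {0..s}" by (intro integrable_continuous_interval continuous_intros Y)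
  have I1: "\<bar>I\<bar> \<le> s"
  proof -
    have "norm I \<le> 1 * (s - 0)" unfolding I_def
    proof (rule integral_bound)
      show "continuous_on {0..s} (\<lambda>r. Re (Y r))" by (intro continuous_intros Y)
      fix r assume "r \<in> {0..s}"
      from Y1[OF this] show "norm (Re (Y r)) \<le> 1" using abs_Re_le_cmod[of "Y r"] by simp
    qed (rule s0)
    then show ?thesis by simp
  qed
  have I2: "s * Re z - I \<le> dev + K * s\<^sup>2"
  proof -
    have "integral {0..s} (\<lambda>r. Re z - Re (Y r)) = integral {0..s} (\<lambda>r. Re z) - I"
      unfolding I_def using Re_int by (intro integral_diff) auto
    then have "s * Re z - I = integral {0..s} (\<lambda>r. Re z - Re (Y r))" using s0 by simp
    also have "\<dots> \<le> integral {0..s} (\<lambda>r. 1 * j r + K * (2 * r))"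
    proof (rule integral_le)
      fix r assume r: "r \<in> {0..s}"
      have "Re z - Re (Y r) \<le> cmod (Y r - z)" using abs_Re_le_cmod[of "Y r - z"] by simp
      then show "Re z - Re (Y r) \<le> 1 * j r + K * (2 * r)" using Yz[OF r] by simp
    qed (use Re_int maj_int[of 1 K] in \<open>auto intro: integrable_diff\<close>)
    finally show ?thesis unfolding maj by simp
  qed
  \<comment> \<open>Of the \<open>6 * K\<^sup>2\<close>, the part \<open>2 * K\<^sup>2\<close> comes
    from \<open>I2\<close> and \<open>4 * K\<^sup>2\<close> from the quadratic term in the bound for
    the exponential.\<close>
  define E where "E = 2 * K * dev + 6 * K\<^sup>2 * s\<^sup>2"
  have \<psi>: "exp (a * (- 2 * K * I)) \<le> 1 - 2 * a * K * s * Re z + a * E"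
  proof -
    define \<eta> where "\<eta> = a * (- 2 * K * I)"
    have \<eta>1: "\<bar>\<eta>\<bar> \<le> 2 * a * K * s" using I1 a K by (simp add: \<eta>_def abs_mult)
    also have "2 * a * K * s \<le> 1 * (2 * K * s)" using a K s by (simp add: mult_right_mono)
    finally have "\<bar>\<eta>\<bar> \<le> 1" using s by simp
    then have 1: "exp \<eta> \<le> 1 + \<eta> + \<eta>\<^sup>2" by (rule exp_le_quadratic)
    have 2: "\<eta> \<le> 2 * a * K * (dev + K * s\<^sup>2 - s * Re z)"
      unfolding \<eta>_def using mult_left_mono[OF I2, of "2 * a * K"] a K by (simp add: algebra_simps)
    have "\<eta>\<^sup>2 \<le> (2 * a * K * s)\<^sup>2" using power_mono[OF \<eta>1 abs_ge_zero, of 2] by simp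
    also have "(2 * a * K * s)\<^sup>2 = a * a * (4 * K\<^sup>2 * s\<^sup>2)" by (simp add: power2_eq_square)
    also have "\<dots> \<le> a * 1 * (4 * K\<^sup>2 * s\<^sup>2)" using a by (intro mult_right_mono mult_left_mono) auto
    finally have 3: "\<eta>\<^sup>2 \<le> a * 1 * (4 * K\<^sup>2 * s\<^sup>2)" .
    have "1 + 2 * a * K * (dev + K * s\<^sup>2 - s * Re z) + a * 1 * (4 * K\<^sup>2 * s\<^sup>2) = 1 - 2 * a * K * s * Re z + a * E"
      unfolding E_def by (simp add: algebra_simps power2_eq_square)
    then show ?thesis using 1 2 3 unfolding \<eta>_def by linarith
  qed
  define \<phi> where "\<phi> = Re (\<beta> * Y s + \<gamma> * (Y s)\<^sup>2)"
  have Ys: "cmod (Y s) \<le> 1" using Y1 s0 by simp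
  have \<phi>c: "\<bar>\<phi>\<bar> \<le> c"
  proof -
    have "\<bar>\<phi>\<bar> \<le> cmod (\<beta> * Y s + \<gamma> * (Y s)\<^sup>2)" unfolding \<phi>_def by (rule abs_Re_le_cmod)
    also have "\<dots> \<le> \<bar>\<beta>\<bar> * cmod (Y s) + \<bar>\<gamma>\<bar> * (cmod (Y s))\<^sup>2"
      using norm_triangle_ineq[of "\<beta> * Y s" "\<gamma> * (Y s)\<^sup>2"] by (simp add: norm_mult norm_power)
    also have "\<dots> \<le> \<bar>\<beta>\<bar> * 1 + \<bar>\<gamma>\<bar> * 1" using Ys power_le_one[of "cmod (Y s)" 2] by (intro add_mono mult_left_mono) auto
    finally show ?thesis by (simp add: c_def)
  qed
  have c0: "0 \<le> c" by (simp add: c_def)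
  have G: "0 \<le> 1 + a * \<phi>" "1 + a * \<phi> \<le> 2"
  proof -
    have "\<bar>a * \<phi>\<bar> \<le> a * c" using \<phi>c a by (simp add: abs_mult)
    then show "0 \<le> 1 + a * \<phi>" "1 + a * \<phi> \<le> 2" using a by auto
  qed
  define \<phi>' where "\<phi>' = Re (cis (\<theta> s) * (\<beta> * (z + s * b))) + Re (cis (2 * \<theta> s) * (\<gamma> * (z\<^sup>2 + 2 * s * (z * b))))"
  have \<phi>\<phi>': "\<phi> \<le> \<phi>' + c * (3 * cmod \<rho> + 4 * K\<^sup>2 * s\<^sup>2)"
  proof -
    have sb: "cmod (s * b) \<le> 2 * K * s" using b2[of z] z s0 K by (simp add: b_def norm_mult mult.commute mult_left_mono)
    have C: "C s = z + s * b + \<rho>" by (simp add: \<rho>_def)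
    \<comment> \<open>Remainder of \<open>(C s)\<^sup>2\<close> after the first-order expansion in
      \<open>s\<close>.\<close>
    define \<tau> where "\<tau> = \<rho> * (C s + (z + s * b)) + (s * b)\<^sup>2"
    have \<tau>: "cmod \<tau> \<le> 3 * cmod \<rho> + 4 * K\<^sup>2 * s\<^sup>2"
    proof -
      have "cmod (C s + (z + s * b)) \<le> 3"
        using norm_triangle_ineq[of "C s" "z + s * b"] norm_triangle_ineq[of z "s * b"] C1[of s] z sb s by simp
      then have "cmod \<rho> * cmod (C s + (z + s * b)) \<le> cmod \<rho> * 3" by (intro mult_left_mono) auto
      moreover have "(cmod (s * b))\<^sup>2 \<le> (2 * K * s)\<^sup>2" using sb by (intro power_mono) auto
      ultimately show ?thesis
        unfolding \<tau>_def using norm_triangle_ineq[of "\<rho> * (C s + (z + s * b))" "(s * b)\<^sup>2"]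
        by (simp add: norm_mult norm_power power_mult_distrib)
    qed
    have sq: "(C s)\<^sup>2 = z\<^sup>2 + 2 * s * (z * b) + \<tau>"
      unfolding \<tau>_def C by (simp add: power2_eq_square algebra_simps)
    have "\<beta> * Y s + \<gamma> * (Y s)\<^sup>2 = cis (\<theta> s) * (\<beta> * (z + s * b)) + cis (2 * \<theta> s) * (\<gamma> * (z\<^sup>2 + 2 * s * (z * b)))
        + (\<beta> * (cis (\<theta> s) * \<rho>) + \<gamma> * (cis (2 * \<theta> s) * \<tau>))"
    proof -
      have "cis (2 * \<theta> s) = (cis (\<theta> s))\<^sup>2" by (simp add: power2_eq_square cis_mult)
      moreover have "(Y s)\<^sup>2 = (cis (\<theta> s))\<^sup>2 * (C s)\<^sup>2" using YC[of s] s0 by (simp add: power_mult_distrib)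
      moreover have "Y s = cis (\<theta> s) * (z + s * b + \<rho>)" using YC[of s] s0 C by simp
      ultimately show ?thesis unfolding sq by (simp add: algebra_simps)
    qed
    then have "\<phi> = \<phi>' + Re (\<beta> * (cis (\<theta> s) * \<rho>) + \<gamma> * (cis (2 * \<theta> s) * \<tau>))" unfolding \<phi>_def \<phi>'_def by (simp only: plus_complex.sel)
    also have "Re (\<beta> * (cis (\<theta> s) * \<rho>) + \<gamma> * (cis (2 * \<theta> s) * \<tau>)) \<le> \<bar>\<beta>\<bar> * cmod \<rho> + \<bar>\<gamma>\<bar> * cmod \<tau>"
      using complex_Re_le_cmod[of "\<beta> * (cis (\<theta> s) * \<rho>) + \<gamma> * (cis (2 * \<theta> s) * \<tau>)"]
        norm_triangle_ineq[of "\<beta> * (cis (\<theta> s) * \<rho>)" "\<gamma> * (cis (2 * \<theta> s) * \<tau>)"] by (simp add: norm_mult)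
    also have "\<dots> \<le> \<bar>\<beta>\<bar> * (3 * cmod \<rho> + 4 * K\<^sup>2 * s\<^sup>2) + \<bar>\<gamma>\<bar> * (3 * cmod \<rho> + 4 * K\<^sup>2 * s\<^sup>2)"
      using \<tau> by (intro add_mono mult_left_mono) (auto simp: add_increasing2)
    finally show ?thesis by (simp add: c_def algebra_simps)
  qed
  have E0: "0 \<le> E" using dev K by (simp add: E_def)
  have "exp (a * (- 2 * K * I)) * (1 + a * \<phi>) \<le> (1 - 2 * a * K * s * Re z + a * E) * (1 + a * \<phi>)"
    using \<psi> G by (intro mult_right_mono) auto
  also have "\<dots> = 1 + a * \<phi> - 2 * a * K * s * Re z - 2 * a * a * K * s * (Re z * \<phi>) + a * (E * (1 + a * \<phi>))"
    by (simp add: algebra_simps)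
  \<comment> \<open>The product of \<open>- 2 a K s Re z\<close> and \<open>a \<phi>\<close> has no
    useful sign and is estimated by its modulus. It is of first order in \<open>s\<close> like the
    drift, but carries an additional factor \<open>a\<close>; this is why the power has to be
    small.\<close>
  also have "\<dots> \<le> 1 + a * (\<phi>' + c * (3 * cmod \<rho> + 4 * K\<^sup>2 * s\<^sup>2)) - 2 * a * K * s * Re z + 2 * a * a * K * s * c + a * (E * 2)"
  proof -
    have "- (Re z * \<phi>) \<le> \<bar>Re z\<bar> * \<bar>\<phi>\<bar>" using abs_ge_minus_self[of "Re z * \<phi>"] by (simp add: abs_mult)
    also have "\<dots> \<le> 1 * c" using \<phi>c abs_Re_le_cmod[of z] z by (intro mult_mono) auto
    finally have "2 * a * a * K * s * (- (Re z * \<phi>)) \<le> 2 * a * a * K * s * c" using a K s by (intro mult_left_mono) auto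
    moreover have "a * (E * (1 + a * \<phi>)) \<le> a * (E * 2)" using G E0 a by (intro mult_left_mono) auto
    moreover have "a * \<phi> \<le> a * (\<phi>' + c * (3 * cmod \<rho> + 4 * K\<^sup>2 * s\<^sup>2))" using \<phi>\<phi>' a by (intro mult_left_mono) auto
    ultimately show ?thesis unfolding mult_minus_right by linarith
  qed
  also have "\<dots> = 1 + a * (\<phi>' - 2 * K * s * Re z + 2 * a * K * c * s + (c * (3 * cmod \<rho> + 4 * K\<^sup>2 * s\<^sup>2) + 2 * E))"
    by (simp add: algebra_simps)
  \<comment> \<open>The constants of \<open>dev\<close> and \<open>s\<^sup>2\<close> result from
    inserting the bound on \<open>\<rho>\<close> and adding \<open>2 * E\<close>.\<close>
  also have "\<dots> \<le> 1 + a * (\<phi>' - 2 * K * s * Re z + 2 * a * K * c * s + ((4 * K + 12 * c * K) * dev + (12 * K\<^sup>2 + 10 * c * K\<^sup>2) * s\<^sup>2))"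
  proof -
    have "c * (3 * cmod \<rho> + 4 * K\<^sup>2 * s\<^sup>2) \<le> c * (3 * (4 * K * dev + 2 * K\<^sup>2 * s\<^sup>2) + 4 * K\<^sup>2 * s\<^sup>2)"
      using \<rho> c0 by (intro mult_left_mono) auto
    then have "c * (3 * cmod \<rho> + 4 * K\<^sup>2 * s\<^sup>2) + 2 * E \<le> (4 * K + 12 * c * K) * dev + (12 * K\<^sup>2 + 10 * c * K\<^sup>2) * s\<^sup>2"
      by (simp add: E_def algebra_simps)
    then show ?thesis using a by (intro add_left_mono mult_left_mono) auto
  qed
  finally have fin: "exp (a * (- 2 * K * I)) * (1 + a * \<phi>) \<le> 1 + a * (\<phi>' - 2 * K * s * Re z + 2 * a * K * c * s + ((4 * K + 12 * c * K) * dev + (12 * K\<^sup>2 + 10 * c * K\<^sup>2) * s\<^sup>2))" .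
  have "(1 - (cmod (Y s))\<^sup>2) powr a = (1 - (cmod z)\<^sup>2) powr a * exp (a * (- 2 * K * I))"
  proof -
    have "1 - (cmod (Y s))\<^sup>2 = (1 - (cmod z)\<^sup>2) * exp (- 2 * K * I)"
      unfolding I_def by (rule rotating_riccati[OF Y \<theta> eq]) (use s0 in auto)
    moreover have "0 < 1 - (cmod z)\<^sup>2" using z power_strict_mono[of "cmod z" 1 2] by simp
    ultimately show ?thesis by (simp add: powr_mult exp_powr_real mult.commute)
  qed
  then have "(1 - (cmod (Y s))\<^sup>2) powr a * (1 + a * \<phi>) = (1 - (cmod z)\<^sup>2) powr a * (exp (a * (- 2 * K * I)) * (1 + a * \<phi>))" by simp
  also have "\<dots> \<le> (1 - (cmod z)\<^sup>2) powr a * (1 + a * (\<phi>' - 2 * K * s * Re z + 2 * a * K * c * s + ((4 * K + 12 * c * K) * dev + (12 * K\<^sup>2 + 10 * c * K\<^sup>2) * s\<^sup>2)))"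
    using fin by (intro mult_left_mono) auto
  finally show ?thesis unfolding \<phi>_def \<phi>'_def by (simp only: add.assoc[symmetric])
qed

text \<open>The exponentials are the means of \<open>cis (\<theta> s)\<close> and
  \<open>cis (2 * \<theta> s)\<close>, so the left side is the mean of the main terms in
  \<open>lyapunov_one_step\<close>. Its first-order part in \<open>s\<close> is handled by
  \<open>lyapunov_drift_le\<close>, and the rest is of second order.\<close>

lemma mean_drift_le:
  fixes z b :: complex and K v s :: real
  defines "\<gamma> \<equiv> K\<^sup>2 / (2 * v * (K + v))" and "\<beta> \<equiv> - 2 * K / v" and "b \<equiv> complex_of_real K * (1 - z\<^sup>2)"
  assumes K: "K > 0" and v: "v > 0" and s: "s \<ge> 0" and z: "cmod z \<le> 1"
  shows "exp (- (v * s)) * Re (\<beta> * (z + s * b)) + exp (- (4 * v * s)) * Re (\<gamma> * (z\<^sup>2 + 2 * s * (z * b))) - 2 * K * s * Re z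
     \<le> Re (\<beta> * z + \<gamma> * z\<^sup>2) - 4 * v * \<gamma> * s + (\<bar>\<beta>\<bar> * (v\<^sup>2 + 2 * K * v) + \<bar>\<gamma>\<bar> * (16 * v\<^sup>2 + 16 * K * v)) * s\<^sup>2"
proof -
  have z2: "cmod (z\<^sup>2) \<le> 1" using z power_le_one[of "cmod z" 2] by (simp add: norm_power)
  have b2: "cmod b \<le> 2 * K"
    using norm_triangle_ineq4[of 1 "z\<^sup>2"] z2 K by (simp add: b_def norm_mult)
  have zb: "cmod (z * b) \<le> 2 * K"
    unfolding norm_mult using mult_mono[OF z b2] K by simp
  define p p2 q r where "p = Re z" and "p2 = Re (z\<^sup>2)" and "q = Re b" and "r = Re (z * b)"
  have p: "\<bar>p\<bar> \<le> 1" "\<bar>p2\<bar> \<le> 1" "\<bar>q\<bar> \<le> 2 * K" "\<bar>r\<bar> \<le> 2 * K"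
    unfolding p_def p2_def q_def r_def using z z2 b2 zb abs_Re_le_cmod order_trans by blast+
  \<comment> \<open>\<open>e1\<close> and \<open>e2\<close> are remainders after the first order,
    for the terms free of \<open>s\<close>; \<open>f1\<close> and \<open>f2\<close> are remainders
    after order zero, for terms that already contain a factor \<open>s\<close>.\<close>
  define e1 e2 f1 f2 where "e1 = exp (- (v * s)) - 1 + v * s" and "e2 = exp (- (4 * v * s)) - 1 + 4 * v * s"
    and "f1 = exp (- (v * s)) - 1" and "f2 = exp (- (4 * v * s)) - 1"
  have ef: "\<bar>e1\<bar> \<le> v\<^sup>2 * s\<^sup>2" "\<bar>e2\<bar> \<le> 16 * v\<^sup>2 * s\<^sup>2" "\<bar>f1\<bar> \<le> v * s" "\<bar>f2\<bar> \<le> 4 * v * s"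
    unfolding e1_def e2_def f1_def f2_def
    using abs_exp_minus_one_le[of "v * s"] abs_exp_minus_one_le[of "4 * v * s"] v s by (simp_all add: power_mult_distrib)
  have "exp (- (v * s)) * Re (\<beta> * (z + s * b)) = \<beta> * p + s * (\<beta> * q - v * \<beta> * p) + \<beta> * (e1 * p + f1 * (s * q))"
    unfolding e1_def f1_def p_def q_def by (simp add: algebra_simps)
  moreover have "exp (- (4 * v * s)) * Re (\<gamma> * (z\<^sup>2 + 2 * s * (z * b))) = \<gamma> * p2 + s * (2 * \<gamma> * r - 4 * v * \<gamma> * p2) + \<gamma> * (e2 * p2 + f2 * (2 * s * r))"
  proof -
    have "Re (\<gamma> * (z\<^sup>2 + 2 * s * (z * b))) = \<gamma> * (p2 + 2 * s * r)"
      unfolding p2_def r_def by simp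
    then show ?thesis unfolding e2_def f2_def by (simp add: algebra_simps)
  qed
  moreover have "\<beta> * q - v * \<beta> * p + 2 * \<gamma> * r - 4 * v * \<gamma> * p2 - 2 * K * p \<le> - 4 * v * \<gamma>"
    unfolding p_def p2_def q_def r_def b_def \<gamma>_def \<beta>_def by (rule lyapunov_drift_le[OF K v z])
  then have "s * (\<beta> * q - v * \<beta> * p + 2 * \<gamma> * r - 4 * v * \<gamma> * p2 - 2 * K * p) \<le> s * (- 4 * v * \<gamma>)"
    using s by (rule mult_left_mono)
  moreover have "\<beta> * (e1 * p + f1 * (s * q)) \<le> \<bar>\<beta>\<bar> * ((v\<^sup>2 + 2 * K * v) * s\<^sup>2)"
  proof -
    have "\<bar>e1 * p + f1 * (s * q)\<bar> \<le> \<bar>e1\<bar> * \<bar>p\<bar> + \<bar>f1\<bar> * (s * \<bar>q\<bar>)"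
      using abs_triangle_ineq[of "e1 * p" "f1 * (s * q)"] s by (simp add: abs_mult)
    also have "\<dots> \<le> v\<^sup>2 * s\<^sup>2 * 1 + v * s * (s * (2 * K))"
    proof (rule add_mono)
      show "\<bar>e1\<bar> * \<bar>p\<bar> \<le> v\<^sup>2 * s\<^sup>2 * 1" by (rule mult_mono[OF ef(1) p(1)]) auto
      show "\<bar>f1\<bar> * (s * \<bar>q\<bar>) \<le> v * s * (s * (2 * K))"
        by (rule mult_mono[OF ef(3) mult_left_mono[OF p(3) s]]) (use s v in auto)
    qed
    finally have "\<bar>\<beta>\<bar> * \<bar>e1 * p + f1 * (s * q)\<bar> \<le> \<bar>\<beta>\<bar> * ((v\<^sup>2 + 2 * K * v) * s\<^sup>2)"
      by (intro mult_left_mono) (simp_all add: algebra_simps power2_eq_square)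
    then show ?thesis using abs_ge_self[of "\<beta> * (e1 * p + f1 * (s * q))"] unfolding abs_mult by linarith
  qed
  moreover have "\<gamma> * (e2 * p2 + f2 * (2 * s * r)) \<le> \<bar>\<gamma>\<bar> * ((16 * v\<^sup>2 + 16 * K * v) * s\<^sup>2)"
  proof -
    have "\<bar>e2 * p2 + f2 * (2 * s * r)\<bar> \<le> \<bar>e2\<bar> * \<bar>p2\<bar> + \<bar>f2\<bar> * (2 * s * \<bar>r\<bar>)"
      using abs_triangle_ineq[of "e2 * p2" "f2 * (2 * s * r)"] s by (simp add: abs_mult)
    also have "\<dots> \<le> 16 * v\<^sup>2 * s\<^sup>2 * 1 + 4 * v * s * (2 * s * (2 * K))"
    proof (rule add_mono)
      show "\<bar>e2\<bar> * \<bar>p2\<bar> \<le> 16 * v\<^sup>2 * s\<^sup>2 * 1" by (rule mult_mono[OF ef(2) p(2)]) auto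
      show "\<bar>f2\<bar> * (2 * s * \<bar>r\<bar>) \<le> 4 * v * s * (2 * s * (2 * K))"
        by (rule mult_mono[OF ef(4) mult_left_mono[OF p(4)]]) (use s v in auto)
    qed
    finally have "\<bar>\<gamma>\<bar> * \<bar>e2 * p2 + f2 * (2 * s * r)\<bar> \<le> \<bar>\<gamma>\<bar> * ((16 * v\<^sup>2 + 16 * K * v) * s\<^sup>2)"
      by (intro mult_left_mono) (simp_all add: algebra_simps power2_eq_square)
    then show ?thesis using abs_ge_self[of "\<gamma> * (e2 * p2 + f2 * (2 * s * r))"] unfolding abs_mult by linarith
  qed
  moreover have "Re (\<beta> * z + \<gamma> * z\<^sup>2) = \<beta> * p + \<gamma> * p2" by (simp add: p_def p2_def)
  ultimately show ?thesis unfolding p_def[symmetric] by (simp add: algebra_simps)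
qed

locale disc_equation = rotation_equation M F w h "\<lambda>z. complex_of_real K * (1 - z\<^sup>2)" v x
  for M :: "'a measure" and F w h K v x +
  assumes K_pos: "K > 0" and v_pos: "v > 0" and x_less_1: "cmod x < 1"
begin

section \<open>Paths that satisfy the pathwise equation\<close>

definition solves :: "'a \<Rightarrow> bool" where
  "solves \<omega> \<longleftrightarrow> (\<forall>t\<ge>0. h t \<omega> = cis (w t \<omega>) * (x + integral {0..t} (\<lambda>s. cis (- w s \<omega>) * (complex_of_real K * (1 - (h s \<omega>)\<^sup>2)))))"

lemma solves_AE: "AE \<omega> in M. solves \<omega>"
  unfolding solves_def by (rule pathwise_equation)

lemma w_continuous_shift:
  assumes "0 \<le> t"
  shows "continuous_on {0..s} (\<lambda>r. w (t + r) \<omega>)"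
  by (rule continuous_on_compose2[OF w_continuous]) (use assms in \<open>auto intro!: continuous_intros\<close>)

lemma h_continuous_shift:
  assumes "0 \<le> t"
  shows "continuous_on {0..s} (\<lambda>r. h (t + r) \<omega>)"
  by (rule continuous_on_compose2[OF h_continuous]) (use assms in \<open>auto intro!: continuous_intros\<close>)

text \<open>Restart at time \<open>t\<close>: the equation keeps its form with \<open>w\<close>
  replaced by its increment after \<open>t\<close>. This makes the deterministic lemmas about
  \<open>Y\<close> and \<open>\<theta>\<close> applicable on every time step.\<close>

lemma solves_shift:
  assumes "solves \<omega>" "0 \<le> t" "0 \<le> r"
  shows "h (t + r) \<omega> = cis (w (t + r) \<omega> - w t \<omega>) * (h t \<omega> +
    integral {0..r} (\<lambda>s. cis (- (w (t + s) \<omega> - w t \<omega>)) * (complex_of_real K * (1 - (h (t + s) \<omega>)\<^sup>2))))"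
proof -
  define g where "g s = cis (- w s \<omega>) * (complex_of_real K * (1 - (h s \<omega>)\<^sup>2))" for s
  have gc: "continuous_on {0..} g" unfolding g_def by (intro continuous_intros w_continuous h_continuous)
  have eq: "h u \<omega> = cis (w u \<omega>) * (x + integral {0..u} g)" if "0 \<le> u" for u
    using assms(1) that unfolding solves_def g_def[abs_def] by blast
  have "integral {0..t} g + integral {t..t + r} g = integral {0..t + r} g"
    using assms by (intro Henstock_Kurzweil_Integration.integral_combine integrable_continuous_interval continuous_on_subset[OF gc]) auto
  moreover have "integral {t..t + r} g = integral {0..r} (\<lambda>s. g (t + s))"
    using integral_shift_Icc_real[of 0 r g t] by (simp add: o_def add.commute)
  ultimately have "h (t + r) \<omega> = cis (w (t + r) \<omega>) * ((x + integral {0..t} g) + integral {0..r} (\<lambda>s. g (t + s)))"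
    using eq[of "t + r"] assms by (simp add: add.assoc)
  also have "x + integral {0..t} g = cis (- w t \<omega>) * h t \<omega>"
    using eq[OF assms(2)] by (simp add: mult.assoc[symmetric] cis_mult)
  also have "integral {0..r} (\<lambda>s. g (t + s)) = cis (- w t \<omega>) * integral {0..r} (\<lambda>s. cis (- (w (t + s) \<omega> - w t \<omega>)) * (complex_of_real K * (1 - (h (t + s) \<omega>)\<^sup>2)))"
    unfolding integral_mult_right[symmetric] g_def mult.assoc[symmetric] cis_mult by (simp add: add.commute)
  finally show ?thesis
    by (simp add: distrib_left[symmetric] mult.assoc[symmetric] cis_mult)
qed

lemma solves_in_disc:
  assumes "solves \<omega>" "0 \<le> t"
  shows "cmod (h t \<omega>) < 1"
proof -
  have "1 - (cmod (h t \<omega>))\<^sup>2 = (1 - (cmod x)\<^sup>2) * exp (- 2 * K * integral {0..t} (\<lambda>s. Re (h s \<omega>)))"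
    by (rule rotating_riccati[where \<theta> = "\<lambda>s. w s \<omega>" and T = t])
      (use assms in \<open>auto simp: solves_def intro!: continuous_on_subset[OF w_continuous] continuous_on_subset[OF h_continuous]\<close>)
  moreover have "0 < 1 - (cmod x)\<^sup>2" using x_less_1 power_strict_mono[of "cmod x" 1 2] by simp
  ultimately have "0 < 1 - (cmod (h t \<omega>))\<^sup>2" by simp
  then have "(cmod (h t \<omega>))\<^sup>2 < 1\<^sup>2" by simp
  then show ?thesis by (rule power_less_imp_less_base) simp
qed

text \<open>In the disc \<open>|Re h| \<le> 1\<close>, so the exponent in
  \<open>rotating_riccati\<close> is at most \<open>2 * K * r\<close>. This bridges the gaps between
  the time steps.\<close>

lemma solves_growth:
  assumes "solves \<omega>" "0 \<le> t" "0 \<le> r"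
  shows "1 - (cmod (h (t + r) \<omega>))\<^sup>2 \<le> (1 - (cmod (h t \<omega>))\<^sup>2) * exp (2 * K * r)"
proof -
  define I where "I = integral {0..r} (\<lambda>s. Re (h (t + s) \<omega>))"
  have eq: "1 - (cmod (h (t + r) \<omega>))\<^sup>2 = (1 - (cmod (h t \<omega>))\<^sup>2) * exp (- 2 * K * I)"
    unfolding I_def
    by (rule rotating_riccati[where \<theta> = "\<lambda>s. w (t + s) \<omega> - w t \<omega>" and T = r])
      (use assms solves_shift in \<open>auto intro!: continuous_intros w_continuous_shift h_continuous_shift\<close>)
  have "norm I \<le> 1 * (r - 0)" unfolding I_def
  proof (rule integral_bound)
    show "continuous_on {0..r} (\<lambda>s. Re (h (t + s) \<omega>))" by (intro continuous_intros h_continuous_shift assms)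
    fix s assume "s \<in> {0..r}"
    then have "cmod (h (t + s) \<omega>) < 1" using assms by (intro solves_in_disc) auto
    then show "norm (Re (h (t + s) \<omega>)) \<le> 1" using abs_Re_le_cmod[of "h (t + s) \<omega>"] by simp
  qed (rule assms)
  then have "- I \<le> r" by simp
  then have "K * (- I) \<le> K * r" using K_pos by (intro mult_left_mono) auto
  then have "exp (- 2 * K * I) \<le> exp (2 * K * r)" by (simp add: mult.commute)
  moreover have "0 \<le> 1 - (cmod (h t \<omega>))\<^sup>2"
    using solves_in_disc[OF assms(1,2)] power_le_one[of "cmod (h t \<omega>)" 2] by simp
  ultimately show ?thesis unfolding eq by (intro mult_left_mono)
qed

section \<open>Mean deviation of the rotation over one time step\<close>

definition dev :: "real \<Rightarrow> real \<Rightarrow> 'a \<Rightarrow> real" where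
  "dev t s \<omega> = integral {0..s} (\<lambda>r. cmod (cis (w (t + r) \<omega> - w t \<omega>) - 1))"

lemma dev_riemann:
  assumes "0 \<le> t" "0 \<le> s"
  shows "(\<lambda>n. \<Sum>i<n. (s / real n) *\<^sub>R cmod (cis (w (t + grid s n i) \<omega> - w t \<omega>) - 1)) \<longlonglongrightarrow> dev t s \<omega>"
  unfolding dev_def using assms
  by (intro riemann_sum_tendsto[of s "\<lambda>r. cmod (cis (w (t + r) \<omega> - w t \<omega>) - 1)"] continuous_intros w_continuous_shift)

lemma cmod_cis_increment_measurable:
  assumes "0 \<le> t" "0 \<le> r"
  shows "(\<lambda>\<omega>. cmod (cis (w (t + r) \<omega> - w t \<omega>) - 1)) \<in> borel_measurable M"
  using assms by (intro measurable_compose[OF _ borel_measurable_norm] borel_measurable_diff cis_measurable w_measurable borel_measurable_const) auto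

lemma dev_measurable:
  assumes "0 \<le> t" "0 \<le> s"
  shows "dev t s \<in> borel_measurable M"
proof (rule borel_measurable_LIMSEQ_metric)
  show "(\<lambda>n. \<Sum>i<n. (s / real n) *\<^sub>R cmod (cis (w (t + grid s n i) \<omega> - w t \<omega>) - 1)) \<longlonglongrightarrow> dev t s \<omega>" for \<omega>
    by (rule dev_riemann[OF assms])
  show "(\<lambda>\<omega>. \<Sum>i<n. (s / real n) *\<^sub>R cmod (cis (w (t + grid s n i) \<omega> - w t \<omega>) - 1)) \<in> borel_measurable M" for n
    using assms by (intro borel_measurable_sum borel_measurable_scaleR borel_measurable_const cmod_cis_increment_measurable) auto
qed

text \<open>A Cauchy-Schwarz estimate with weight \<open>U\<close>, which is known at time
  \<open>t\<close>: the conditional mean square of \<open>cis \<Delta>w - 1\<close> is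
  \<open>2 * (1 - exp (- (v * r)))\<close>, hence at most \<open>2 * v * s\<close>.\<close>

lemma expectation_increment_le:
  assumes t: "0 \<le> t" and r: "0 \<le> r" "r \<le> s" and s: "0 < s" and U: "U \<in> borel_measurable (F t)" "integrable M U" "AE \<omega> in M. 0 \<le> U \<omega>"
  shows "integrable M (\<lambda>\<omega>. U \<omega> * cmod (cis (w (t + r) \<omega> - w t \<omega>) - 1))"
    "expectation (\<lambda>\<omega>. U \<omega> * cmod (cis (w (t + r) \<omega> - w t \<omega>) - 1)) \<le> sqrt (2 * v * s) * expectation U"
proof -
  let ?j = "\<lambda>\<omega>. cmod (cis (w (t + r) \<omega> - w t \<omega>) - 1)"
  \<comment> \<open>With this value both halves of
    \<open>j \<le> j\<^sup>2 / (2 * \<kappa>) + \<kappa> / 2\<close> receive the same bound.\<close>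
  define \<kappa> where "\<kappa> = sqrt (2 * v * s)"
  have \<kappa>: "\<kappa> > 0" "\<kappa>\<^sup>2 = 2 * v * s" using v_pos s by (simp_all add: \<kappa>_def)
  have Um: "U \<in> borel_measurable M" using U(2) by auto
  have jm: "?j \<in> borel_measurable M" by (rule cmod_cis_increment_measurable[OF t r(1)])
  show int: "integrable M (\<lambda>\<omega>. U \<omega> * ?j \<omega>)"
  proof (rule Bochner_Integration.integrable_bound[of _ "\<lambda>\<omega>. 2 * U \<omega>"])
    show "AE \<omega> in M. norm (U \<omega> * ?j \<omega>) \<le> norm (2 * U \<omega>)"
    proof (rule AE_I2)
      fix \<omega> show "norm (U \<omega> * ?j \<omega>) \<le> norm (2 * U \<omega>)"
        using mult_left_mono[OF cmod_cis_minus_1_le_2[of "w (t + r) \<omega> - w t \<omega>"] abs_ge_zero[of "U \<omega>"]] by (simp add: abs_mult mult.commute)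
    qed
  qed (use U Um jm in auto)
  have cosint: "integrable M (\<lambda>\<omega>. U \<omega> * cos (1 * (w (t + r) \<omega> - w t \<omega>)))"
  proof (rule Bochner_Integration.integrable_bound[OF U(2)])
    show "AE \<omega> in M. norm (U \<omega> * cos (1 * (w (t + r) \<omega> - w t \<omega>))) \<le> norm (U \<omega>)"
      by (intro AE_I2) (auto simp: abs_mult intro!: mult_left_le)
  qed (use Um w_measurable[of t] w_measurable[of "t + r"] t r in auto)
  have sq: "U \<omega> * (?j \<omega>)\<^sup>2 = 2 * U \<omega> - 2 * (U \<omega> * cos (1 * (w (t + r) \<omega> - w t \<omega>)))" for \<omega>
    unfolding cmod_cis_minus_1_power2 by (simp add: algebra_simps)
  have sqint: "integrable M (\<lambda>\<omega>. U \<omega> * (?j \<omega>)\<^sup>2)" unfolding sq using U(2) cosint by simp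
  have U0: "0 \<le> expectation U" by (rule integral_nonneg_AE[OF U(3)])
  have "expectation (\<lambda>\<omega>. U \<omega> * (?j \<omega>)\<^sup>2) = 2 * expectation U - 2 * (expectation U * exp (- (1\<^sup>2 * v * ((t + r) - t))))"
    unfolding sq using U(2) cosint expectation_cos_increment[OF t _ U(1,2), of "t + r" 1] r by simp
  also have "\<dots> = expectation U * (2 * (1 - exp (- (v * r))))" by (simp add: algebra_simps)
  also have "\<dots> \<le> expectation U * \<kappa>\<^sup>2"
  proof (rule mult_left_mono[OF _ U0])
    have "1 - exp (- (v * r)) \<le> v * r" using exp_ge_add_one_self[of "- (v * r)"] by simp
    also have "v * r \<le> v * s" using r v_pos by simp
    finally show "2 * (1 - exp (- (v * r))) \<le> \<kappa>\<^sup>2" unfolding \<kappa>(2) by simp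
  qed
  finally have sq_le: "expectation (\<lambda>\<omega>. U \<omega> * (?j \<omega>)\<^sup>2) \<le> expectation U * \<kappa>\<^sup>2" .
  have "expectation (\<lambda>\<omega>. U \<omega> * ?j \<omega>) \<le> expectation (\<lambda>\<omega>. (U \<omega> * (?j \<omega>)\<^sup>2) / (2 * \<kappa>) + \<kappa> / 2 * U \<omega>)"
  proof (rule integral_mono_AE)
    show "AE \<omega> in M. U \<omega> * ?j \<omega> \<le> (U \<omega> * (?j \<omega>)\<^sup>2) / (2 * \<kappa>) + \<kappa> / 2 * U \<omega>"
      using U(3)
    proof eventually_elim
      case (elim \<omega>)
      have "2 * ?j \<omega> * \<kappa> \<le> (?j \<omega>)\<^sup>2 + \<kappa>\<^sup>2" by (rule sum_squares_bound)
      then have "?j \<omega> \<le> (?j \<omega>)\<^sup>2 / (2 * \<kappa>) + \<kappa> / 2" using \<kappa>(1) by (simp add: field_simps power2_eq_square)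
      from mult_left_mono[OF this elim] show ?case by (simp add: algebra_simps)
    qed
  qed (use int sqint U(2) in auto)
  also have "\<dots> = expectation (\<lambda>\<omega>. U \<omega> * (?j \<omega>)\<^sup>2) / (2 * \<kappa>) + \<kappa> / 2 * expectation U"
    using sqint U(2) by simp
  also have "\<dots> \<le> expectation U * \<kappa>\<^sup>2 / (2 * \<kappa>) + \<kappa> / 2 * expectation U"
    using sq_le \<kappa>(1) by (intro add_right_mono divide_right_mono) auto
  also have "\<dots> = \<kappa> * expectation U" using \<kappa>(1) by (simp add: power2_eq_square field_simps)
  finally show "expectation (\<lambda>\<omega>. U \<omega> * ?j \<omega>) \<le> sqrt (2 * v * s) * expectation U" unfolding \<kappa>_def .
qed

text \<open>Expectation and time integral are exchanged through Riemann sums and dominated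
  convergence with majorant \<open>2 * s * U\<close>. The resulting order \<open>s * sqrt s\<close>
  is small compared with a drift of order \<open>s\<close>.\<close>

lemma expectation_U_dev_le:
  assumes t: "0 \<le> t" and s: "0 < s" and U: "U \<in> borel_measurable (F t)" "integrable M U" "AE \<omega> in M. 0 \<le> U \<omega>"
  shows "integrable M (\<lambda>\<omega>. U \<omega> * dev t s \<omega>)" "expectation (\<lambda>\<omega>. U \<omega> * dev t s \<omega>) \<le> s * sqrt (2 * v * s) * expectation U"
proof -
  let ?j = "\<lambda>r \<omega>. cmod (cis (w (t + r) \<omega> - w t \<omega>) - 1)"
  define S where "S n \<omega> = (\<Sum>i<n. (s / real n) *\<^sub>R ?j (grid s n i) \<omega>)" for n \<omega>
  have Um: "U \<in> borel_measurable M" using U(2) by auto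
  have s0: "0 \<le> s" using s by simp
  have Sm: "S n \<in> borel_measurable M" for n
    unfolding S_def using s0 by (intro borel_measurable_sum borel_measurable_scaleR borel_measurable_const cmod_cis_increment_measurable t) auto
  have S_le: "0 \<le> S n \<omega>" "S n \<omega> \<le> 2 * s" for n \<omega>
  proof -
    show "0 \<le> S n \<omega>" unfolding S_def using s0 by (intro sum_nonneg) auto
    have "S n \<omega> \<le> (\<Sum>i<n. (s / real n) * 2)"
      unfolding S_def using s0 cmod_cis_minus_1_le_2 by (intro sum_mono) (auto intro!: mult_left_mono divide_right_mono)
    also have "\<dots> \<le> 2 * s" using s0 by (cases "n = 0") auto
    finally show "S n \<omega> \<le> 2 * s" .
  qed
  have lim: "(\<lambda>n. S n \<omega>) \<longlonglongrightarrow> dev t s \<omega>" for \<omega> unfolding S_def by (rule dev_riemann[OF t s0])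
  have dom: "AE \<omega> in M. norm (U \<omega> * S n \<omega>) \<le> 2 * s * U \<omega>" for n
    using U(3)
  proof eventually_elim
    case (elim \<omega>)
    then show ?case using mult_left_mono[OF S_le(2)[of n \<omega>] elim] S_le(1)[of n \<omega>] by (simp add: abs_mult mult.commute)
  qed
  have dc: "AE \<omega> in M. (\<lambda>n. U \<omega> * S n \<omega>) \<longlonglongrightarrow> U \<omega> * dev t s \<omega>"
    by (intro AE_I2 tendsto_intros lim)
  have m1: "(\<lambda>\<omega>. U \<omega> * dev t s \<omega>) \<in> borel_measurable M" using Um dev_measurable[OF t s0] by (rule borel_measurable_times)
  have m2: "(\<lambda>\<omega>. U \<omega> * S n \<omega>) \<in> borel_measurable M" for n using Um Sm by (rule borel_measurable_times)
  have w: "integrable M (\<lambda>\<omega>. 2 * s * U \<omega>)" using U(2) by simp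
  show "integrable M (\<lambda>\<omega>. U \<omega> * dev t s \<omega>)"
    by (rule integrable_dominated_convergence[OF m1 m2 w dc dom])
  have conv: "(\<lambda>n. expectation (\<lambda>\<omega>. U \<omega> * S n \<omega>)) \<longlonglongrightarrow> expectation (\<lambda>\<omega>. U \<omega> * dev t s \<omega>)"
    by (rule integral_dominated_convergence[OF m1 m2 w dc dom])
  have U0: "0 \<le> expectation U" by (rule integral_nonneg_AE[OF U(3)])
  have "expectation (\<lambda>\<omega>. U \<omega> * S n \<omega>) \<le> s * sqrt (2 * v * s) * expectation U" for n
  proof -
    have pt: "0 \<le> grid s n i \<and> grid s n i \<le> s" if "i < n" for i
      using uniform_point[of i n s] that s0 by auto
    have int: "integrable M (\<lambda>\<omega>. U \<omega> * ?j (grid s n i) \<omega>)" if "i < n" for i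
      using expectation_increment_le(1)[OF t _ _ s U] pt[OF that] by blast
    have "expectation (\<lambda>\<omega>. U \<omega> * S n \<omega>) = expectation (\<lambda>\<omega>. \<Sum>i<n. (s / real n) * (U \<omega> * ?j (grid s n i) \<omega>))"
      unfolding S_def by (simp add: sum_distrib_left mult_ac)
    also have "\<dots> = (\<Sum>i<n. (s / real n) * expectation (\<lambda>\<omega>. U \<omega> * ?j (grid s n i) \<omega>))"
      using int by (subst Bochner_Integration.integral_sum) auto
    also have "\<dots> \<le> (\<Sum>i<n. (s / real n) * (sqrt (2 * v * s) * expectation U))"
      using s0 pt by (intro sum_mono mult_left_mono expectation_increment_le(2)[OF t _ _ s U]) auto
    also have "\<dots> \<le> s * sqrt (2 * v * s) * expectation U"
      using s0 v_pos U0 by (cases "n = 0") auto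
    finally show ?thesis .
  qed
  then show "expectation (\<lambda>\<omega>. U \<omega> * dev t s \<omega>) \<le> s * sqrt (2 * v * s) * expectation U"
    by (intro LIMSEQ_le_const2[OF conv]) auto
qed

section \<open>Expected decay of the Lyapunov function\<close>

definition \<gamma> :: real where "\<gamma> = K\<^sup>2 / (2 * v * (K + v))"
definition \<beta> :: real where "\<beta> = - 2 * K / v"
definition U :: "real \<Rightarrow> real \<Rightarrow> 'a \<Rightarrow> real" where "U a t \<omega> = (1 - (cmod (h t \<omega>))\<^sup>2) powr a"
text \<open>The exponential of \<open>a\<close> times the corrected logarithm, with the corrector
  expanded to first order in \<open>a\<close>. As the corrector enters linearly, the rotation shows
  up only as \<open>cis \<Delta>w\<close> and \<open>cis (2 * \<Delta>w)\<close>, whose conditional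
  means are explicit.\<close>

definition V :: "real \<Rightarrow> real \<Rightarrow> 'a \<Rightarrow> real" where
  "V a t \<omega> = U a t \<omega> * (1 + a * Re (\<beta> * h t \<omega> + \<gamma> * (h t \<omega>)\<^sup>2))"

lemma gamma_pos: "\<gamma> > 0" using K_pos v_pos by (simp add: \<gamma>_def)

lemma U_adapted: "0 \<le> t \<Longrightarrow> U a t \<in> borel_measurable (F t)"
  unfolding U_def using h_adapted[of t] by measurable

lemma U_bounds:
  assumes "solves \<omega>" "0 \<le> t" "0 \<le> a"
  shows "0 \<le> U a t \<omega>" "U a t \<omega> \<le> 1"
proof -
  have "(cmod (h t \<omega>))\<^sup>2 \<le> 1" using solves_in_disc[OF assms(1,2)] by (intro power_le_one) auto
  then show "0 \<le> U a t \<omega>" "U a t \<omega> \<le> 1" unfolding U_def using assms(3) by (auto intro!: powr_le1)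
qed

lemma integrable_solves_bounded:
  fixes f :: "'a \<Rightarrow> 'b::{banach, second_countable_topology}"
  assumes "f \<in> borel_measurable M" "\<And>\<omega>. solves \<omega> \<Longrightarrow> norm (f \<omega>) \<le> B"
  shows "integrable M f"
proof (rule integrable_const_bound[of _ B])
  show "AE \<omega> in M. norm (f \<omega>) \<le> B" using solves_AE by eventually_elim (rule assms)
qed (rule assms)

text \<open>Along almost every path \<open>h\<close> stays in the disc, and \<open>f\<close> is
  bounded on its closure. The coefficients known at time \<open>t\<close> in
  \<open>expectation_V_step\<close> have this shape.\<close>

lemma integrable_U_mult:
  fixes f :: "complex \<Rightarrow> 'b::{banach, second_countable_topology, real_normed_algebra_1}"
  assumes t: "0 \<le> t" and a: "0 \<le> a" and f: "continuous_on UNIV f"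
  shows "integrable M (\<lambda>\<omega>. of_real (U a t \<omega>) * f (h t \<omega>))" "(\<lambda>\<omega>. of_real (U a t \<omega>) * f (h t \<omega>)) \<in> borel_measurable (F t)"
proof -
  have fm: "f \<in> borel_measurable borel" using f by (rule borel_measurable_continuous_onI)
  have "compact (f ` cball 0 1)" by (intro compact_continuous_image continuous_on_subset[OF f]) auto
  then have "bounded (f ` cball 0 1)" by (rule compact_imp_bounded)
  then obtain B where "\<forall>y\<in>f ` cball 0 1. norm y \<le> B" unfolding bounded_iff by blast
  then have B: "norm (f z) \<le> B" if "cmod z \<le> 1" for z using that by simp
  have "(\<lambda>\<omega>. of_real (U a t \<omega>) :: 'b) \<in> borel_measurable (F t)"
    by (rule measurable_compose[OF U_adapted[OF t]]) (intro borel_measurable_continuous_onI continuous_intros)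
  then show m: "(\<lambda>\<omega>. of_real (U a t \<omega>) * f (h t \<omega>)) \<in> borel_measurable (F t)"
    using measurable_compose[OF h_adapted[OF t] fm] by (rule borel_measurable_times)
  show "integrable M (\<lambda>\<omega>. of_real (U a t \<omega>) * f (h t \<omega>))"
  proof (rule integrable_solves_bounded[OF measurable_F_M[OF m t]])
    fix \<omega> assume g: "solves \<omega>"
    have h1: "cmod (h t \<omega>) \<le> 1" using solves_in_disc[OF g t] by simp
    have "norm (of_real (U a t \<omega>) * f (h t \<omega>)) \<le> norm (of_real (U a t \<omega>) :: 'b) * norm (f (h t \<omega>))" by (rule norm_mult_ineq)
    also have "\<dots> \<le> 1 * B"
      using U_bounds[OF g t a] B[OF h1] by (intro mult_mono) auto
    finally show "norm (of_real (U a t \<omega>) * f (h t \<omega>)) \<le> B" by simp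
  qed
qed

lemma V_integrable: "0 \<le> t \<Longrightarrow> 0 \<le> a \<Longrightarrow> integrable M (V a t)"
  unfolding V_def using integrable_U_mult(1)[of t a "\<lambda>z. 1 + a * Re (\<beta> * z + \<gamma> * z\<^sup>2)"] by (simp add: continuous_intros)

text \<open>The bound of \<open>lyapunov_one_step\<close> is linear in \<open>cis \<Delta>w\<close>,
  \<open>cis (2 * \<Delta>w)\<close> and \<open>dev\<close>, with coefficients known at time
  \<open>t\<close>. The first two are averaged exactly, \<open>dev\<close> is estimated by
  \<open>expectation_U_dev_le\<close>, and \<open>mean_drift_le\<close> evaluates the main
  terms.\<close>

lemma expectation_V_step:
  fixes a s t :: real
  defines "C0 \<equiv> \<bar>\<beta>\<bar> + \<bar>\<gamma>\<bar>"
  defines "C1 \<equiv> 4 * K + 12 * C0 * K"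
    and "C2 \<equiv> 12 * K\<^sup>2 + 10 * C0 * K\<^sup>2 + (\<bar>\<beta>\<bar> * (v\<^sup>2 + 2 * K * v) + \<bar>\<gamma>\<bar> * (16 * v\<^sup>2 + 16 * K * v))"
  assumes t: "0 \<le> t" and s: "s > 0" "2 * K * s \<le> 1" and a: "0 < a" "a \<le> 1" "a * C0 \<le> 1"
  shows "expectation (V a (t + s)) \<le> expectation (V a t) + a * s * (- 4 * v * \<gamma> + 2 * a * K * C0 + C2 * s + C1 * sqrt (2 * v * s)) * expectation (U a t)"
proof -
  define b where "b z = complex_of_real K * (1 - z\<^sup>2)" for z :: complex
  define f1 where "f1 z = \<beta> * (z + s * b z)" for z :: complex
  define f2 where "f2 z = \<gamma> * (z\<^sup>2 + 2 * s * (z * b z))" for z :: complex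
  define P1 where "P1 \<omega> = of_real (U a t \<omega>) * f1 (h t \<omega>)" for \<omega>
  define P2 where "P2 \<omega> = of_real (U a t \<omega>) * f2 (h t \<omega>)" for \<omega>
  define \<phi> where "\<phi> z = Re (\<beta> * z + \<gamma> * z\<^sup>2)" for z :: complex
  let ?\<Delta> = "\<lambda>\<omega>. w (t + s) \<omega> - w t \<omega>"
  have a0: "0 \<le> a" and s0: "0 \<le> s" using a s by auto
  have f_cont: "continuous_on UNIV f1" "continuous_on UNIV f2" "continuous_on UNIV \<phi>"
    unfolding f1_def f2_def b_def \<phi>_def by (intro continuous_intros)+
  have P: "integrable M P1" "P1 \<in> borel_measurable (F t)" "integrable M P2" "P2 \<in> borel_measurable (F t)"
    unfolding P1_def P2_def by (intro integrable_U_mult t a0 f_cont)+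
  have iU: "integrable M (U a t)" using integrable_U_mult(1)[OF t a0, of "\<lambda>_. 1::real"] by simp
  have iUR: "integrable M (\<lambda>\<omega>. U a t \<omega> * Re (h t \<omega>))"
    using integrable_U_mult(1)[OF t a0, of Re] by (simp add: continuous_intros)
  have iU\<phi>: "integrable M (\<lambda>\<omega>. U a t \<omega> * \<phi> (h t \<omega>))"
    using integrable_U_mult(1)[OF t a0 f_cont(3)] by simp
  have U0: "AE \<omega> in M. 0 \<le> U a t \<omega>" using solves_AE by eventually_elim (rule U_bounds(1)[OF _ t a0])
  note dev = expectation_U_dev_le[OF t s(1) U_adapted[OF t] iU U0]
  have cism: "(\<lambda>\<omega>. cis (k * ?\<Delta> \<omega>)) \<in> borel_measurable M" for k
    using w_measurable[of t] w_measurable[of "t + s"] t s0 by (intro cis_measurable) auto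
  have iPq: "integrable M (\<lambda>\<omega>. P \<omega> * cis (k * ?\<Delta> \<omega>))" if "integrable M P" for P :: "'a \<Rightarrow> complex" and k
  proof (rule Bochner_Integration.integrable_bound[OF that])
    show "(\<lambda>\<omega>. P \<omega> * cis (k * ?\<Delta> \<omega>)) \<in> borel_measurable M" using that cism by (intro borel_measurable_times) auto
    show "AE \<omega> in M. norm (P \<omega> * cis (k * ?\<Delta> \<omega>)) \<le> norm (P \<omega>)" by (simp add: norm_mult)
  qed
  have EP: "integrable M (\<lambda>\<omega>. Re (P \<omega> * cis (k * ?\<Delta> \<omega>)))"
      "expectation (\<lambda>\<omega>. Re (P \<omega> * cis (k * ?\<Delta> \<omega>))) = expectation (\<lambda>\<omega>. Re (P \<omega>)) * exp (- (k\<^sup>2 * v * s))"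
    if "integrable M P" "P \<in> borel_measurable (F t)" for P :: "'a \<Rightarrow> complex" and k
  proof -
    show "integrable M (\<lambda>\<omega>. Re (P \<omega> * cis (k * ?\<Delta> \<omega>)))" by (rule integrable_Re[OF iPq[OF that(1)]])
    have "expectation (\<lambda>\<omega>. P \<omega> * cis (k * ?\<Delta> \<omega>)) = expectation P * exp (- (k\<^sup>2 * v * (t + s - t)))"
      using s0 by (intro expectation_cis_increment t that) auto
    then have "Re (expectation (\<lambda>\<omega>. P \<omega> * cis (k * ?\<Delta> \<omega>))) = Re (expectation P) * exp (- (k\<^sup>2 * v * s))" by simp
    then show "expectation (\<lambda>\<omega>. Re (P \<omega> * cis (k * ?\<Delta> \<omega>))) = expectation (\<lambda>\<omega>. Re (P \<omega>)) * exp (- (k\<^sup>2 * v * s))"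
      unfolding integral_Re[OF iPq[OF that(1)]] integral_Re[OF that(1)] .
  qed
  define D1 where "D1 = 12 * K\<^sup>2 + 10 * C0 * K\<^sup>2"
  define D2 where "D2 = \<bar>\<beta>\<bar> * (v\<^sup>2 + 2 * K * v) + \<bar>\<gamma>\<bar> * (16 * v\<^sup>2 + 16 * K * v)"
  \<comment> \<open>Pointwise majorant of \<open>V a (t + s)\<close>, arranged so that the
    expectation of each summand is available. \<open>D1\<close> holds the pathwise error of second
    order; the error \<open>D2\<close> arises only after averaging.\<close>
  define Q where "Q \<omega> = U a t \<omega> + a * (Re (P1 \<omega> * cis (1 * ?\<Delta> \<omega>)) + Re (P2 \<omega> * cis (2 * ?\<Delta> \<omega>)) - 2 * K * s * (U a t \<omega> * Re (h t \<omega>))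
     + (2 * a * K * C0 * s + D1 * s\<^sup>2) * U a t \<omega> + C1 * (U a t \<omega> * dev t s \<omega>))" for \<omega>
  have iQ: "integrable M Q"
    unfolding Q_def using iU iUR dev(1) EP(1)[OF P(1,2)] EP(1)[OF P(3,4)]
    by (intro Bochner_Integration.integrable_add Bochner_Integration.integrable_diff integrable_mult_right)
  have "expectation (V a (t + s)) \<le> expectation Q"
  proof (rule integral_mono_AE)
    show "integrable M (V a (t + s))" using t s0 a0 by (intro V_integrable) auto
    show "AE \<omega> in M. V a (t + s) \<omega> \<le> Q \<omega>"
      using solves_AE
    proof eventually_elim
      case (elim \<omega>)
      have "V a (t + s) \<omega> \<le> U a t \<omega> * (1 + a * (Re (cis (?\<Delta> \<omega>) * (\<beta> * (h t \<omega> + s * b (h t \<omega>)))) + Re (cis (2 * ?\<Delta> \<omega>) * (\<gamma> * ((h t \<omega>)\<^sup>2 + 2 * s * (h t \<omega> * b (h t \<omega>)))))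
        - 2 * K * s * Re (h t \<omega>) + 2 * a * K * C0 * s + (4 * K + 12 * C0 * K) * dev t s \<omega> + (12 * K\<^sup>2 + 10 * C0 * K\<^sup>2) * s\<^sup>2))"
        unfolding V_def U_def b_def C0_def dev_def
        by (rule lyapunov_one_step[where Y = "\<lambda>r. h (t + r) \<omega>" and \<theta> = "\<lambda>r. w (t + r) \<omega> - w t \<omega>"])
          (use solves_shift[OF elim t] solves_in_disc[OF elim t] K_pos s a t in
            \<open>auto simp: C0_def intro!: continuous_intros w_continuous_shift h_continuous_shift\<close>)
      also have "\<dots> = Q \<omega>"
      proof -
        have reu: "Re (of_real u * z) = u * Re z" for u z by simp
        have P1': "Re (P1 \<omega> * cis (1 * ?\<Delta> \<omega>)) = U a t \<omega> * Re (cis (?\<Delta> \<omega>) * (\<beta> * (h t \<omega> + s * b (h t \<omega>))))"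
        proof -
          have "P1 \<omega> * cis (1 * ?\<Delta> \<omega>) = of_real (U a t \<omega>) * (cis (?\<Delta> \<omega>) * (\<beta> * (h t \<omega> + s * b (h t \<omega>))))"
            by (simp add: P1_def f1_def mult_ac)
          then show ?thesis by (simp only: reu)
        qed
        have P2': "Re (P2 \<omega> * cis (2 * ?\<Delta> \<omega>)) = U a t \<omega> * Re (cis (2 * ?\<Delta> \<omega>) * (\<gamma> * ((h t \<omega>)\<^sup>2 + 2 * s * (h t \<omega> * b (h t \<omega>)))))"
        proof -
          have "P2 \<omega> * cis (2 * ?\<Delta> \<omega>) = of_real (U a t \<omega>) * (cis (2 * ?\<Delta> \<omega>) * (\<gamma> * ((h t \<omega>)\<^sup>2 + 2 * s * (h t \<omega> * b (h t \<omega>)))))"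
            by (simp add: P2_def f2_def mult_ac)
          then show ?thesis by (simp only: reu)
        qed
        have alg: "u * (1 + a * (p + q - k * r + m + C * jv + d * e)) = u + a * (u * p + u * q - k * (u * r) + (m + d * e) * u + C * (u * jv))"
          for u p q k r m C jv d e :: real by (simp add: algebra_simps)
        show ?thesis unfolding Q_def P1' P2' C1_def D1_def by (rule alg)
      qed
      finally show ?case .
    qed
  qed (rule iQ)
  also have "expectation Q = expectation (U a t) + a * (expectation (\<lambda>\<omega>. Re (P1 \<omega>)) * exp (- (v * s)) + expectation (\<lambda>\<omega>. Re (P2 \<omega>)) * exp (- (4 * v * s))
     - 2 * K * s * expectation (\<lambda>\<omega>. U a t \<omega> * Re (h t \<omega>)) + (2 * a * K * C0 * s + D1 * s\<^sup>2) * expectation (U a t) + C1 * expectation (\<lambda>\<omega>. U a t \<omega> * dev t s \<omega>))"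
  proof -
    have gen: "expectation (\<lambda>\<omega>. u \<omega> + a * (p \<omega> + q \<omega> - k * r \<omega> + m * u \<omega> + C * jv \<omega>)) =
      expectation u + a * (expectation p + expectation q - k * expectation r + m * expectation u + C * expectation jv)"
      if "integrable M u" "integrable M p" "integrable M q" "integrable M r" "integrable M jv" for u p q r jv :: "'a \<Rightarrow> real" and k m C
      using that by simp
    have e1: "expectation (\<lambda>\<omega>. Re (P1 \<omega> * cis (1 * ?\<Delta> \<omega>))) = expectation (\<lambda>\<omega>. Re (P1 \<omega>)) * exp (- (v * s))"
      using EP(2)[OF P(1,2), of 1] by simp
    have e2: "expectation (\<lambda>\<omega>. Re (P2 \<omega> * cis (2 * ?\<Delta> \<omega>))) = expectation (\<lambda>\<omega>. Re (P2 \<omega>)) * exp (- (4 * v * s))"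
      using EP(2)[OF P(3,4), of 2] by simp
    show ?thesis unfolding Q_def gen[OF iU EP(1)[OF P(1,2)] EP(1)[OF P(3,4)] iUR dev(1)] e1 e2 ..
  qed
  also have "\<dots> \<le> expectation (U a t) + a * (expectation (\<lambda>\<omega>. U a t \<omega> * \<phi> (h t \<omega>)) + (- 4 * v * \<gamma> * s + D2 * s\<^sup>2) * expectation (U a t)
      + (2 * a * K * C0 * s + D1 * s\<^sup>2) * expectation (U a t) + C1 * (s * sqrt (2 * v * s) * expectation (U a t)))"
  proof (intro add_left_mono mult_left_mono add_mono)
    show "expectation (\<lambda>\<omega>. U a t \<omega> * dev t s \<omega>) \<le> s * sqrt (2 * v * s) * expectation (U a t)" by (rule dev(2))
    show "0 \<le> C1" using K_pos by (simp add: C1_def C0_def)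
    show "0 \<le> 2 * a * K * C0 * s + D1 * s\<^sup>2" using K_pos s a by (simp add: D1_def C0_def)
    \<comment> \<open>The averaged terms are gathered under one expectation again, since
      \<open>mean_drift_le\<close> is applied pointwise at \<open>z = h t \<omega>\<close>.\<close>
    have "expectation (\<lambda>\<omega>. Re (P1 \<omega>)) * exp (- (v * s)) + expectation (\<lambda>\<omega>. Re (P2 \<omega>)) * exp (- (4 * v * s)) - 2 * K * s * expectation (\<lambda>\<omega>. U a t \<omega> * Re (h t \<omega>))
      = expectation (\<lambda>\<omega>. Re (P1 \<omega>) * exp (- (v * s)) + Re (P2 \<omega>) * exp (- (4 * v * s)) - 2 * K * s * (U a t \<omega> * Re (h t \<omega>)))"
      using integrable_Re[OF P(1)] integrable_Re[OF P(3)] iUR by (simp del: integral_Re)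
    also have "\<dots> \<le> expectation (\<lambda>\<omega>. U a t \<omega> * \<phi> (h t \<omega>) + (- 4 * v * \<gamma> * s + D2 * s\<^sup>2) * U a t \<omega>)"
    proof (rule integral_mono_AE)
      show "AE \<omega> in M. Re (P1 \<omega>) * exp (- (v * s)) + Re (P2 \<omega>) * exp (- (4 * v * s)) - 2 * K * s * (U a t \<omega> * Re (h t \<omega>))
         \<le> U a t \<omega> * \<phi> (h t \<omega>) + (- 4 * v * \<gamma> * s + D2 * s\<^sup>2) * U a t \<omega>"
        using solves_AE
      proof eventually_elim
        case (elim \<omega>)
        have "exp (- (v * s)) * Re (f1 (h t \<omega>)) + exp (- (4 * v * s)) * Re (f2 (h t \<omega>)) - 2 * K * s * Re (h t \<omega>)
          \<le> \<phi> (h t \<omega>) - 4 * v * \<gamma> * s + D2 * s\<^sup>2"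
          unfolding f1_def f2_def b_def \<phi>_def D2_def \<gamma>_def \<beta>_def
          by (rule mean_drift_le[OF K_pos v_pos s0]) (use solves_in_disc[OF elim t] in simp)
        from mult_left_mono[OF this U_bounds(1)[OF elim t a0]]
        have le: "U a t \<omega> * (exp (- (v * s)) * Re (f1 (h t \<omega>)) + exp (- (4 * v * s)) * Re (f2 (h t \<omega>)) - 2 * K * s * Re (h t \<omega>))
          \<le> U a t \<omega> * (\<phi> (h t \<omega>) - 4 * v * \<gamma> * s + D2 * s\<^sup>2)" .
        have R: "Re (P1 \<omega>) = U a t \<omega> * Re (f1 (h t \<omega>))" "Re (P2 \<omega>) = U a t \<omega> * Re (f2 (h t \<omega>))"
          by (simp_all add: P1_def P2_def)
        have alg: "u * f * e + u * g * d - k * (u * r) = u * (e * f + d * g - k * r)" "u * p + (- q + m) * u = u * (p - q + m)"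
          for u f e g d k r p q m :: real by (simp_all add: algebra_simps)
        show ?case using le unfolding R alg[symmetric] by simp
      qed
    qed (use integrable_Re[OF P(1)] integrable_Re[OF P(3)] iUR iU iU\<phi> in auto)
    also have "\<dots> = expectation (\<lambda>\<omega>. U a t \<omega> * \<phi> (h t \<omega>)) + (- 4 * v * \<gamma> * s + D2 * s\<^sup>2) * expectation (U a t)"
      using iU iU\<phi> by simp
    finally show "expectation (\<lambda>\<omega>. Re (P1 \<omega>)) * exp (- (v * s)) + expectation (\<lambda>\<omega>. Re (P2 \<omega>)) * exp (- (4 * v * s)) - 2 * K * s * expectation (\<lambda>\<omega>. U a t \<omega> * Re (h t \<omega>))
      \<le> expectation (\<lambda>\<omega>. U a t \<omega> * \<phi> (h t \<omega>)) + (- 4 * v * \<gamma> * s + D2 * s\<^sup>2) * expectation (U a t)" .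
  qed (use a in auto)
  also have "\<dots> = (expectation (U a t) + a * expectation (\<lambda>\<omega>. U a t \<omega> * \<phi> (h t \<omega>)))
     + a * s * (- 4 * v * \<gamma> + 2 * a * K * C0 + (D1 + D2) * s + C1 * sqrt (2 * v * s)) * expectation (U a t)"
    by (simp add: algebra_simps power2_eq_square)
  also have "expectation (U a t) + a * expectation (\<lambda>\<omega>. U a t \<omega> * \<phi> (h t \<omega>)) = expectation (V a t)"
  proof -
    have "V a t = (\<lambda>\<omega>. U a t \<omega> + a * (U a t \<omega> * \<phi> (h t \<omega>)))"
      unfolding V_def \<phi>_def by (intro ext) (simp only: distrib_left mult_1_right mult.left_commute)
    then show ?thesis using iU iU\<phi> by simp
  qed
  also have "D1 + D2 = C2" by (simp add: D1_def D2_def C2_def)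
  finally show ?thesis .
qed

lemma U_V_bounds:
  assumes "solves \<omega>" "0 \<le> t" "0 < a" "a * (\<bar>\<beta>\<bar> + \<bar>\<gamma>\<bar>) \<le> 1 / 2"
  shows "U a t \<omega> \<le> 2 * V a t \<omega>" "V a t \<omega> \<le> 2 * U a t \<omega>"
proof -
  have h1: "cmod (h t \<omega>) \<le> 1" using solves_in_disc[OF assms(1,2)] by simp
  define \<phi> where "\<phi> = Re (\<beta> * h t \<omega> + \<gamma> * (h t \<omega>)\<^sup>2)"
  have "\<bar>\<phi>\<bar> \<le> cmod (\<beta> * h t \<omega> + \<gamma> * (h t \<omega>)\<^sup>2)" unfolding \<phi>_def by (rule abs_Re_le_cmod)
  also have "\<dots> \<le> \<bar>\<beta>\<bar> * cmod (h t \<omega>) + \<bar>\<gamma>\<bar> * (cmod (h t \<omega>))\<^sup>2"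
    using norm_triangle_ineq[of "\<beta> * h t \<omega>" "\<gamma> * (h t \<omega>)\<^sup>2"] by (simp add: norm_mult norm_power)
  also have "\<dots> \<le> \<bar>\<beta>\<bar> * 1 + \<bar>\<gamma>\<bar> * 1" using h1 power_le_one[of "cmod (h t \<omega>)" 2] by (intro add_mono mult_left_mono) auto
  finally have "a * \<bar>\<phi>\<bar> \<le> a * (\<bar>\<beta>\<bar> + \<bar>\<gamma>\<bar>)" using assms(3) by (intro mult_left_mono) auto
  then have "a * \<bar>\<phi>\<bar> \<le> 1 / 2" using assms(4) by linarith
  then have "\<bar>a * \<phi>\<bar> \<le> 1 / 2" using assms(3) by (simp add: abs_mult)
  then have "1 / 2 \<le> 1 + a * \<phi>" "1 + a * \<phi> \<le> 2" by (simp_all add: abs_le_iff)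
  from this[THEN mult_left_mono, OF U_bounds(1)[OF assms(1,2)]] assms(3)
  have "U a t \<omega> * (1 / 2) \<le> V a t \<omega>" "V a t \<omega> \<le> U a t \<omega> * 2" unfolding V_def \<phi>_def[symmetric] by auto
  then show "U a t \<omega> \<le> 2 * V a t \<omega>" "V a t \<omega> \<le> 2 * U a t \<omega>" by simp_all
qed

theorem modulus_tendsto_1: "AE \<omega> in M. ((\<lambda>t. cmod (h t \<omega>)) \<longlongrightarrow> 1) at_top"
proof -
  define C0 where "C0 = \<bar>\<beta>\<bar> + \<bar>\<gamma>\<bar>"
  define C1 where "C1 = 4 * K + 12 * C0 * K"
  define C2 where "C2 = 12 * K\<^sup>2 + 10 * C0 * K\<^sup>2 + (\<bar>\<beta>\<bar> * (v\<^sup>2 + 2 * K * v) + \<bar>\<gamma>\<bar> * (16 * v\<^sup>2 + 16 * K * v))"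
  define \<mu> where "\<mu> = v * \<gamma>"
  have \<mu>: "\<mu> > 0" using v_pos gamma_pos by (simp add: \<mu>_def)
  have C0: "C0 \<ge> 0" by (simp add: C0_def)
  \<comment> \<open>The second bound gives \<open>a * C0 \<le> 1 / 2\<close>, which makes
    \<open>U\<close> and \<open>V\<close> comparable; the third one keeps the second-order effect
    \<open>2 * a * K * C0\<close> below \<open>\<mu>\<close>.\<close>
  define a where "a = min 1 (min (1 / (2 * C0 + 2)) (\<mu> / (2 * K * C0 + 1)))"
  have Kc: "0 < 2 * K * C0 + 1" using K_pos C0 by (simp add: add_nonneg_pos)
  have a: "0 < a" "a \<le> 1" "a * C0 \<le> 1 / 2" "2 * a * K * C0 \<le> \<mu>"
  proof -
    show "0 < a" using C0 \<mu> Kc by (simp add: a_def)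
    show "a \<le> 1" by (simp add: a_def)
    have "a * (2 * C0 + 2) \<le> 1" using C0 by (simp add: a_def pos_le_divide_eq[symmetric])
    then show "a * C0 \<le> 1 / 2" using \<open>0 < a\<close> by (simp add: algebra_simps)
    have "a * (2 * K * C0 + 1) \<le> \<mu>" using Kc by (simp add: a_def pos_le_divide_eq[symmetric])
    then show "2 * a * K * C0 \<le> \<mu>" using \<open>0 < a\<close> by (simp add: algebra_simps)
  qed
  have "((\<lambda>s. C2 * s + C1 * sqrt (2 * v * s)) \<longlongrightarrow> C2 * 0 + C1 * sqrt (2 * v * 0)) (at_right 0)"
    by (intro tendsto_intros)
  from order_tendstoD(2)[OF this, of \<mu>] have e1: "\<forall>\<^sub>F s in at_right 0. C2 * s + C1 * sqrt (2 * v * s) < \<mu>" using \<mu> by simp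
  have "((\<lambda>s. 2 * K * s + \<mu> * a * s) \<longlongrightarrow> 2 * K * 0 + \<mu> * a * 0) (at_right 0)"
    by (intro tendsto_intros)
  from order_tendstoD(2)[OF this, of 1] have e2: "\<forall>\<^sub>F s in at_right 0. 2 * K * s + \<mu> * a * s < 1" by simp
  \<comment> \<open>Of the drift \<open>- 4 * \<mu>\<close>, one \<open>\<mu>\<close> is spent on
    the choice of \<open>a\<close> and one on that of \<open>s\<close>, so
    \<open>- 2 * \<mu>\<close> remains. The last condition ensures \<open>2 * K * s \<le> 1\<close>
    and \<open>0 \<le> \<rho>\<close>.\<close>
  obtain s where s: "0 < s" "C2 * s + C1 * sqrt (2 * v * s) < \<mu>" "2 * K * s + \<mu> * a * s < 1"
    using eventually_happens'[OF _ eventually_conj[OF eventually_at_right_less eventually_conj[OF e1 e2]]] by auto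
  have pos: "0 < K * s" "0 < \<mu> * a * s" using K_pos s(1) \<mu> a(1) by simp_all
  \<comment> \<open>The decrease is \<open>2 * \<mu> * a * s\<close> times the mean of
    \<open>U\<close>; expressing it through \<open>V \<le> 2 * U\<close> halves the rate.\<close>
  define \<rho> where "\<rho> = 1 - \<mu> * a * s"
  have \<rho>: "0 \<le> \<rho>" "\<rho> < 1" using s(3) pos by (auto simp: \<rho>_def)
  have ac: "a * (\<bar>\<beta>\<bar> + \<bar>\<gamma>\<bar>) \<le> 1 / 2" using a(3) by (simp add: C0_def)
  have step: "expectation (V a (t + s)) \<le> \<rho> * expectation (V a t)" if t: "0 \<le> t" for t
  proof -
    have iU: "integrable M (U a t)" using integrable_U_mult(1)[OF t, of a "\<lambda>_. 1::real"] a by simp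
    have U0: "0 \<le> expectation (U a t)"
    proof (rule integral_nonneg_AE)
      show "AE \<omega> in M. 0 \<le> U a t \<omega>" using solves_AE by eventually_elim (rule U_bounds(1)[OF _ t], use a in auto)
    qed
    have VU: "expectation (V a t) \<le> 2 * expectation (U a t)"
    proof -
      have "expectation (V a t) \<le> expectation (\<lambda>\<omega>. 2 * U a t \<omega>)"
      proof (rule integral_mono_AE)
        show "AE \<omega> in M. V a t \<omega> \<le> 2 * U a t \<omega>" using solves_AE by eventually_elim (rule U_V_bounds(2)[OF _ t a(1) ac])
      qed (use V_integrable[OF t] iU a in auto)
      then show ?thesis by simp
    qed
    have "expectation (V a (t + s)) \<le> expectation (V a t) + a * s * (- 4 * v * \<gamma> + 2 * a * K * C0 + C2 * s + C1 * sqrt (2 * v * s)) * expectation (U a t)"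
      unfolding C0_def C1_def C2_def using pos s a ac by (intro expectation_V_step t) (auto simp: C0_def)
    also have "\<dots> \<le> expectation (V a t) + a * s * (- 2 * \<mu>) * expectation (U a t)"
    proof -
      have "- 4 * v * \<gamma> + 2 * a * K * C0 + C2 * s + C1 * sqrt (2 * v * s) \<le> - 2 * \<mu>" using s(2) a(4) by (simp add: \<mu>_def)
      then show ?thesis using a(1) s(1) U0 by (intro add_left_mono mult_right_mono mult_left_mono) auto
    qed
    also have "\<dots> = expectation (V a t) - (\<mu> * a * s) * (2 * expectation (U a t))" by simp
    also have "\<dots> \<le> expectation (V a t) - (\<mu> * a * s) * expectation (V a t)"
      using VU pos by (intro diff_left_mono mult_left_mono) auto
    finally show ?thesis by (simp add: \<rho>_def algebra_simps)
  qed
  have V0: "AE \<omega> in M. 0 \<le> V a (real n * s) \<omega>" for n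
    using solves_AE
  proof eventually_elim
    case (elim \<omega>)
    have "0 \<le> real n * s" using s by simp
    from U_V_bounds(1)[OF elim this a(1) ac] U_bounds(1)[OF elim this, of a] a(1) show ?case by simp
  qed
  have "AE \<omega> in M. (\<lambda>n. V a (real n * s) \<omega>) \<longlonglongrightarrow> 0"
  proof (rule geometric_decay_AE[OF _ V0 _ \<rho>])
    show "integrable M (V a (real n * s))" for n using s a by (intro V_integrable) auto
    show "expectation (V a (real n * s)) \<le> expectation (V a 0) * \<rho> ^ n" for n
    proof (induction n)
      case (Suc n)
      have "expectation (V a (real (Suc n) * s)) \<le> \<rho> * expectation (V a (real n * s))"
        using step[of "real n * s"] s(1) by (simp add: algebra_simps)
      also have "\<dots> \<le> \<rho> * (expectation (V a 0) * \<rho> ^ n)" using Suc \<rho>(1) by (rule mult_left_mono)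
      finally show ?case by (simp add: mult_ac)
    qed simp
  qed
  with solves_AE show ?thesis
  proof eventually_elim
    case (elim \<omega>)
    define u where "u t = 1 - (cmod (h t \<omega>))\<^sup>2" for t
    have u_pos: "0 \<le> u t" if "0 \<le> t" for t
      using solves_in_disc[OF elim(1) that] power_le_one[of "cmod (h t \<omega>)" 2] by (simp add: u_def)
    have "(\<lambda>n. U a (real n * s) \<omega>) \<longlonglongrightarrow> 0"
    proof (rule Lim_null_comparison)
      show "(\<lambda>n. 2 * V a (real n * s) \<omega>) \<longlonglongrightarrow> 0" using tendsto_mult_right_zero[OF elim(2)] .
      have "norm (U a (real n * s) \<omega>) \<le> 2 * V a (real n * s) \<omega>" for n
      proof -
        have "0 \<le> real n * s" using s by simp
        from U_V_bounds(1)[OF elim(1) this a(1) ac] U_bounds(1)[OF elim(1) this, of a] a(1) show ?thesis by simp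
      qed
      then show "\<forall>\<^sub>F n in sequentially. norm (U a (real n * s) \<omega>) \<le> 2 * V a (real n * s) \<omega>" by simp
    qed
    \<comment> \<open>\<open>1 - (cmod h)\<^sup>2\<close> is recovered from \<open>U\<close> by the
      power \<open>1 / a\<close>, which preserves convergence to 0.\<close>
    moreover have u_U: "u (real n * s) = U a (real n * s) \<omega> powr (1 / a)" for n
      using u_pos[of "real n * s"] s a(1) by (simp add: U_def u_def powr_powr powr_one)
    have "(\<lambda>n. u (real n * s)) \<longlonglongrightarrow> 0"
      unfolding u_U
    proof (rule tendsto_zero_powrI)
      show "(\<lambda>n. U a (real n * s) \<omega>) \<longlonglongrightarrow> 0" by fact
      show "\<forall>\<^sub>F n in sequentially. 0 \<le> U a (real n * s) \<omega>"
        using U_bounds(1)[OF elim(1), of _ a] s a by (intro always_eventually) auto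
      show "(\<lambda>n. 1 / a) \<longlonglongrightarrow> 1 / a" by simp
    qed (use a in auto)
    then have un: "(\<lambda>n. u (real n * s) * exp (2 * K * s)) \<longlonglongrightarrow> 0" by (rule tendsto_mult_left_zero)
    \<comment> \<open>\<open>nat \<lfloor>t / s\<rfloor>\<close> counts the complete steps before
      \<open>t\<close>; the remaining time is at most \<open>s\<close> and is covered by
      \<open>solves_growth\<close>.\<close>
    have fl: "filterlim (\<lambda>t. nat \<lfloor>t / s\<rfloor>) sequentially at_top"
    proof -
      have "filterlim (\<lambda>t. t / s) at_top at_top" using s(1) by real_asymp
      then show ?thesis
        by (intro filterlim_compose[OF filterlim_nat_sequentially] filterlim_compose[OF filterlim_floor_sequentially])
    qed
    have "(u \<longlongrightarrow> 0) at_top"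
    proof (rule Lim_null_comparison)
      show "((\<lambda>t. u (real (nat \<lfloor>t / s\<rfloor>) * s) * exp (2 * K * s)) \<longlongrightarrow> 0) at_top"
        by (rule filterlim_compose[OF un fl])
      show "\<forall>\<^sub>F t in at_top. norm (u t) \<le> u (real (nat \<lfloor>t / s\<rfloor>) * s) * exp (2 * K * s)"
        using eventually_ge_at_top[of 0]
      proof eventually_elim
        case t: (elim t)
        define n where "n = nat \<lfloor>t / s\<rfloor>"
        define r where "r = t - real n * s"
        have "0 \<le> t / s" using t s by simp
        then have n: "real n \<le> t / s" "t / s < real n + 1" unfolding n_def by linarith+
        have "real n * s \<le> t" using n(1) s(1) by (simp add: pos_le_divide_eq)
        moreover have "t < (real n + 1) * s" using n(2) s(1) by (simp add: pos_divide_less_eq)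
        ultimately have r: "0 \<le> r" "r \<le> s" by (auto simp: r_def algebra_simps)
        have "u t \<le> u (real n * s) * exp (2 * K * r)"
          using solves_growth[OF elim(1) _ r(1), of "real n * s"] s(1) by (simp add: u_def r_def)
        also have "\<dots> \<le> u (real n * s) * exp (2 * K * s)"
          using u_pos[of "real n * s"] s(1) r K_pos by (intro mult_left_mono) auto
        finally show ?case unfolding n_def[symmetric] using u_pos[OF t] by simp
      qed
    qed
    then have "((\<lambda>t. sqrt (1 - u t)) \<longlongrightarrow> sqrt (1 - 0)) at_top" by (intro tendsto_intros)
    then show ?case by (simp add: u_def)
  qed
qed

end

subsection \<open>Brownian increments\<close>

text \<open>Rescaling reduces this to the characteristic function of the standard normal
  law.\<close>

lemma (in prob_space) expectation_cis_normal:
  assumes X: "distributed M lborel X (\<lambda>x. ennreal (normal_density 0 \<sigma> x))" and \<sigma>: "\<sigma> > 0"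
  shows "expectation (\<lambda>\<omega>. cis (u * X \<omega>)) = exp (- (u\<^sup>2 * \<sigma>\<^sup>2 / 2))"
proof -
  have Z: "distributed M lborel (\<lambda>\<omega>. X \<omega> / \<sigma>) (\<lambda>x. ennreal (std_normal_density x))"
    using normal_standard_normal_convert[OF \<sigma>, of X 0] X by simp
  then have [measurable]: "(\<lambda>\<omega>. X \<omega> / \<sigma>) \<in> borel_measurable M" by (simp add: distributed_def)
  have "distr M borel (\<lambda>\<omega>. X \<omega> / \<sigma>) = distr M lborel (\<lambda>\<omega>. X \<omega> / \<sigma>)" by (rule distr_cong) auto
  also have "\<dots> = std_normal_distribution" by (rule distributed_distr_eq_density[OF Z])
  finally have "char (distr M borel (\<lambda>\<omega>. X \<omega> / \<sigma>)) (u * \<sigma>) = complex_of_real (exp (- ((u * \<sigma>)\<^sup>2) / 2))"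
    by (simp add: char_std_normal_distribution)
  moreover have "char (distr M borel (\<lambda>\<omega>. X \<omega> / \<sigma>)) (u * \<sigma>) = expectation (\<lambda>\<omega>. iexp ((u * \<sigma>) * (X \<omega> / \<sigma>)))"
    unfolding char_def by (rule integral_distr) auto
  moreover have "iexp ((u * \<sigma>) * (X \<omega> / \<sigma>)) = cis (u * X \<omega>)" for \<omega>
    using \<sigma> by (simp add: cis_conv_exp)
  ultimately show ?thesis by (simp add: power_mult_distrib)
qed

text \<open>\<open>Y\<close> and \<open>cis (u * X)\<close> generate sigma-algebras inside the two
  independent ones, so the product formula for independent variables applies.\<close>

lemma (in prob_space) expectation_mult_cis_indep:
  fixes Y :: "'a \<Rightarrow> complex" and X :: "'a \<Rightarrow> real"
  assumes G: "subalgebra M G" and Y: "Y \<in> borel_measurable G" "integrable M Y"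
    and X: "X \<in> borel_measurable M" and indep: "indep_set (sets G) (sets (vimage_algebra (space M) X borel))"
  shows "expectation (\<lambda>\<omega>. Y \<omega> * cis (u * X \<omega>)) = expectation Y * expectation (\<lambda>\<omega>. cis (u * X \<omega>))"
proof -
  have Ym: "Y \<in> borel_measurable M" using Y(2) by auto
  have sp: "space G = space M" using G by (simp add: subalgebra_def)
  have sub: "sigma_sets (space M) {Y -` A \<inter> space M |A. A \<in> sets borel} \<subseteq> sets G"
    unfolding sp[symmetric] by (rule sets.sigma_sets_subset) (use Y(1) in \<open>auto intro: measurable_sets\<close>)
  define Z where "Z \<omega> = cis (u * X \<omega>)" for \<omega>
  have cm: "(\<lambda>y. cis (u * y)) \<in> borel_measurable borel" by (intro borel_measurable_continuous_onI continuous_intros)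
  have Zm: "Z \<in> borel_measurable M" unfolding Z_def using X cm by (rule measurable_compose)
  have "X \<in> measurable (vimage_algebra (space M) X borel) borel" by (rule measurable_vimage_algebra1) simp
  then have Zv: "Z \<in> measurable (vimage_algebra (space M) X borel) borel" unfolding Z_def using cm by (rule measurable_compose)
  have "sigma_sets (space (vimage_algebra (space M) X borel)) {Z -` A \<inter> space M |A. A \<in> sets borel} \<subseteq> sets (vimage_algebra (space M) X borel)"
    by (rule sets.sigma_sets_subset) (use measurable_sets[OF Zv] in auto)
  then have "sigma_sets (space M) {Z -` A \<inter> space M |A. A \<in> sets borel} \<subseteq> sets (vimage_algebra (space M) X borel)" by simp
  with indep sub have "indep_set (sigma_sets (space M) {Y -` A \<inter> space M |A. A \<in> sets borel}) (sigma_sets (space M) {Z -` A \<inter> space M |A. A \<in> sets borel})"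
    unfolding indep_sets2_eq by blast
  then have "indep_var borel Y borel Z" unfolding indep_var_eq using Ym Zm by simp
  moreover have "integrable M Z"
    by (rule integrable_const_bound[of _ 1]) (use Zm in \<open>auto simp: Z_def\<close>)
  ultimately have "expectation (\<lambda>\<omega>. Y \<omega> * Z \<omega>) = expectation Y * expectation Z"
    using Y(2) by (intro indep_var_lebesgue_integral)
  then show ?thesis unfolding Z_def[abs_def] .
qed

lemma brownian_motion_increment:
  assumes "prob_space M" "\<And>t. 0 \<le> t \<Longrightarrow> subalgebra M (F t)" "brownian_motion M F W" "0 \<le> s" "s \<le> t"
  shows "Y \<in> borel_measurable (F s) \<Longrightarrow> integrable M (Y :: _ \<Rightarrow> complex) \<Longrightarrow>
      (LINT \<omega>|M. Y \<omega> * cis (u * (W t \<omega> - W s \<omega>))) = (LINT \<omega>|M. Y \<omega>) * exp (- (u\<^sup>2 * (t - s) / 2))"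
    and "integrable M (\<lambda>\<omega>. (W t \<omega> - W s \<omega>)\<^sup>2)"
    and "(LINT \<omega>|M. (W t \<omega> - W s \<omega>)\<^sup>2) = t - s"
proof -
  interpret prob_space M by fact
  let ?X = "\<lambda>\<omega>. W t \<omega> - W s \<omega>"
  show "(LINT \<omega>|M. Y \<omega> * cis (u * ?X \<omega>)) = (LINT \<omega>|M. Y \<omega>) * exp (- (u\<^sup>2 * (t - s) / 2))"
    if Y: "Y \<in> borel_measurable (F s)" "integrable M Y" for Y :: "_ \<Rightarrow> complex"
  \<comment> \<open>\<open>brownian_motion\<close> speaks of \<open>s < t\<close> only; for
    \<open>s = t\<close> the increment is 0 and the identity is immediate.\<close>
  proof (cases "s = t")
    case False
    then have st: "s < t" using assms by simp
    have d: "distributed M lborel ?X (\<lambda>x. ennreal (normal_density 0 (sqrt (t - s)) x))"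
      and i: "indep_set (sets (F s)) (sets (vimage_algebra (space M) ?X borel))"
      using assms(3,4) st unfolding brownian_motion_def by blast+
    have "?X \<in> borel_measurable M" using d by (simp add: distributed_def)
    from expectation_mult_cis_indep[OF assms(2)[OF assms(4)] Y this i, of u] expectation_cis_normal[OF d, of u] st
    show ?thesis by simp
  qed simp
  have "integrable M (\<lambda>\<omega>. (?X \<omega>)\<^sup>2) \<and> expectation (\<lambda>\<omega>. (?X \<omega>)\<^sup>2) = t - s"
  proof (cases "s = t")
    case False
    then have st: "s < t" using assms by simp
    have d: "distributed M lborel ?X (\<lambda>x. ennreal (normal_density 0 (sqrt (t - s)) x))"
      using assms(3,4) st unfolding brownian_motion_def by blast
    have "integrable lborel (\<lambda>x. normal_density 0 (sqrt (t - s)) x * x\<^sup>2)"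
      using integrable_normal_moment[of "sqrt (t - s)" 0 2] st by simp
    then have "integrable M (\<lambda>\<omega>. (?X \<omega>)\<^sup>2)"
      using distributed_integrable[OF d, of "\<lambda>x. x\<^sup>2"] by simp
    moreover have "expectation (\<lambda>\<omega>. (?X \<omega>)\<^sup>2) = t - s"
      using normal_distributed_variance[OF _ d] normal_distributed_expectation[OF _ d] st by simp
    ultimately show ?thesis by simp
  qed simp
  then show "integrable M (\<lambda>\<omega>. (?X \<omega>)\<^sup>2)" "expectation (\<lambda>\<omega>. (?X \<omega>)\<^sup>2) = t - s" by auto
qed

section \<open>From the Stratonovich equation to the pathwise setting\<close>

theorem theorem2:
  fixes M :: "'a measure" and F :: "real \<Rightarrow> 'a measure"
    and W :: "real \<Rightarrow> 'a \<Rightarrow> real" and h :: "real \<Rightarrow> 'a \<Rightarrow> complex"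
    and K \<epsilon> :: real and x :: complex
  assumes "complete_filtered_prob_space M F"
    and "brownian_motion M F W"
    and "K > 0" and "\<epsilon> > 0" and "cmod x < 1"
    and "stratonovich_solution M F W
           (\<lambda>z. complex_of_real K * (1 - z\<^sup>2))
           (\<lambda>z. complex_of_real (sqrt 2) * \<i> * complex_of_real \<epsilon> * z) h"
    and "AE \<omega> in M. h 0 \<omega> = x"
  shows "AE \<omega> in M. ((\<lambda>t. cmod (h t \<omega>)) \<longlongrightarrow> 1) at_top"
proof -
  interpret complete_filtered_prob_space M F by fact
  define b where "b z = complex_of_real K * (1 - z\<^sup>2)" for z
  define \<sigma> where "\<sigma> z = complex_of_real (sqrt 2) * \<i> * complex_of_real \<epsilon> * z" for z
  have W_ad: "W t \<in> borel_measurable (F t)" and h_ad: "h t \<in> borel_measurable (F t)" if "0 \<le> t" for t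
    using assms(2,6) that unfolding brownian_motion_def stratonovich_solution_def adapted_def by auto
  obtain I where I: "\<And>t. 0 \<le> t \<Longrightarrow> has_stratonovich_integral M F W (\<lambda>s \<omega>. \<sigma> (h s \<omega>)) t (I t)"
    "\<And>t. 0 \<le> t \<Longrightarrow> AE \<omega> in M. h t \<omega> = h 0 \<omega> + (LINT s:{0..t}|lborel. b (h s \<omega>)) + I t \<omega>"
    using assms(6) unfolding stratonovich_solution_def b_def[abs_def] \<sigma>_def[abs_def] by blast
  have "AE \<omega> in M. continuous_on {0..} (\<lambda>t. W t \<omega>) \<and> continuous_on {0..} (\<lambda>t. h t \<omega>) \<and> W 0 \<omega> = 0 \<and> h 0 \<omega> = x"
    using assms(2,6,7) unfolding brownian_motion_def stratonovich_solution_def continuous_process_def by auto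
  then obtain N where N: "N \<in> null_sets M"
    "{\<omega> \<in> space M. \<not> (continuous_on {0..} (\<lambda>t. W t \<omega>) \<and> continuous_on {0..} (\<lambda>t. h t \<omega>) \<and> W 0 \<omega> = 0 \<and> h 0 \<omega> = x)} \<subseteq> N"
    unfolding eventually_ae_filter by blast
  define A where "A = space M - N"
  define w where "w t \<omega> = (if \<omega> \<in> A then sqrt 2 * \<epsilon> * W t \<omega> else 0)" for t \<omega>
  define g where "g t \<omega> = (if \<omega> \<in> A then h t \<omega> else x)" for t \<omega>
  have A_AE: "AE \<omega> in M. \<omega> \<in> A" unfolding A_def using AE_not_in[OF N(1)] AE_space by eventually_elim auto
  have A_path: "continuous_on {0..} (\<lambda>t. W t \<omega>)" "continuous_on {0..} (\<lambda>t. h t \<omega>)" "W 0 \<omega> = 0" "h 0 \<omega> = x" if "\<omega> \<in> A" for \<omega>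
    using that N(2) by (auto simp: A_def)
  \<comment> \<open>Adaptedness survives the modification off \<open>A\<close> because
    \<open>F 0\<close>, and hence every later \<open>F t\<close>, contains all null sets.\<close>
  have A_sets: "A \<inter> space (F t) \<in> sets (F t)" if "0 \<le> t" for t
  proof -
    have "N \<in> sets (F t)" using null_sets_F N(1) sets_F_mono[OF that] by blast
    moreover have "A \<inter> space (F t) = space (F t) - N" using space_F by (auto simp: A_def)
    ultimately show ?thesis by auto
  qed
  have M_meas: "f \<in> borel_measurable M" if "f \<in> borel_measurable (F t)" "0 \<le> t" for t and f :: "'a \<Rightarrow> 'c::topological_space"
    using measurable_from_subalg[OF subalgebra_F[OF that(2)] that(1)] .
  \<comment> \<open>The increments of \<open>sqrt 2 * \<epsilon> * W\<close> have variance
    \<open>2 * \<epsilon>\<^sup>2 * (t - s)\<close>, hence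
    \<open>v = \<epsilon>\<^sup>2\<close>.\<close>
  interpret disc_equation M F w g K "\<epsilon>\<^sup>2" x
  proof unfold_locales
    show "0 < K" "0 < \<epsilon>\<^sup>2" "cmod x < 1" "0 \<le> \<epsilon>\<^sup>2" using assms by auto
    show "subalgebra M (F t)" if "0 \<le> t" for t using subalgebra_F that .
    show "sets (F s) \<subseteq> sets (F t)" if "s \<le> t" for s t using sets_F_mono[OF that] .
    show "w t \<in> borel_measurable (F t)" if "0 \<le> t" for t
      unfolding w_def using A_sets[OF that] W_ad[OF that] by (intro measurable_If_set) auto
    show "g t \<in> borel_measurable (F t)" if "0 \<le> t" for t
      unfolding g_def using A_sets[OF that] h_ad[OF that] by (intro measurable_If_set) auto
    show "continuous_on {0..} (\<lambda>t. w t \<omega>)" for \<omega>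
      unfolding w_def using A_path(1)[of \<omega>] by (cases "\<omega> \<in> A") (auto intro!: continuous_intros)
    show "continuous_on {0..} (\<lambda>t. g t \<omega>)" for \<omega>
      unfolding g_def using A_path(2)[of \<omega>] by (cases "\<omega> \<in> A") (auto intro!: continuous_intros)
    show "w 0 \<omega> = 0" "g 0 \<omega> = x" for \<omega> using A_path by (auto simp: w_def g_def)
    show "continuous_on UNIV (\<lambda>z. complex_of_real K * (1 - z\<^sup>2))" by (intro continuous_intros)
    note bm = brownian_motion_increment[OF prob_space_axioms subalgebra_F assms(2)]
    have dw: "AE \<omega> in M. w t \<omega> - w s \<omega> = sqrt 2 * \<epsilon> * (W t \<omega> - W s \<omega>)" for s t
      using A_AE by eventually_elim (simp add: w_def algebra_simps)
    have wm: "w t \<in> borel_measurable M" if "0 \<le> t" for t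
      using \<open>\<And>t. 0 \<le> t \<Longrightarrow> w t \<in> borel_measurable (F t)\<close> M_meas that by blast
    have Wm: "W t \<in> borel_measurable M" if "0 \<le> t" for t using M_meas[OF W_ad[OF that] that] .
    have hm: "h t \<in> borel_measurable M" if "0 \<le> t" for t using M_meas[OF h_ad[OF that] that] .
    have cism: "(\<lambda>\<omega>. cis (f \<omega>)) \<in> borel_measurable M" if "f \<in> borel_measurable M" for f
      using that by (rule measurable_compose[where g = cis]) (auto intro!: borel_measurable_continuous_onI continuous_intros)
    {
      fix s t :: real assume st: "0 \<le> s" "s \<le> t"
      have t0: "0 \<le> t" using st by simp
      show "expectation (\<lambda>\<omega>. Y \<omega> * cis (k * (w t \<omega> - w s \<omega>))) = expectation Y * exp (- (k\<^sup>2 * \<epsilon>\<^sup>2 * (t - s)))"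
        if Y: "Y \<in> borel_measurable (F s)" "integrable M Y" for Y :: "'a \<Rightarrow> complex" and k
      proof -
        have "expectation (\<lambda>\<omega>. Y \<omega> * cis (k * (w t \<omega> - w s \<omega>))) = expectation (\<lambda>\<omega>. Y \<omega> * cis ((k * (sqrt 2 * \<epsilon>)) * (W t \<omega> - W s \<omega>)))"
        proof (rule integral_cong_AE)
          show "AE \<omega> in M. Y \<omega> * cis (k * (w t \<omega> - w s \<omega>)) = Y \<omega> * cis ((k * (sqrt 2 * \<epsilon>)) * (W t \<omega> - W s \<omega>))"
            using dw[of t s] by eventually_elim (simp add: mult.assoc)
        qed (use Y(2) wm[OF st(1)] wm[OF t0] Wm[OF st(1)] Wm[OF t0] in \<open>auto intro!: borel_measurable_times cism\<close>)
        also have "\<dots> = expectation Y * exp (- ((k * (sqrt 2 * \<epsilon>))\<^sup>2 * (t - s) / 2))"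
          by (rule bm(1)[OF _ st Y])
        also have "(k * (sqrt 2 * \<epsilon>))\<^sup>2 * (t - s) / 2 = k\<^sup>2 * \<epsilon>\<^sup>2 * (t - s)" by (simp add: power_mult_distrib)
        finally show ?thesis .
      qed
      have sq: "AE \<omega> in M. 2 * \<epsilon>\<^sup>2 * (W t \<omega> - W s \<omega>)\<^sup>2 = (w t \<omega> - w s \<omega>)\<^sup>2"
        using dw[of t s] by eventually_elim (simp add: power_mult_distrib)
      have sqm: "(\<lambda>\<omega>. (w t \<omega> - w s \<omega>)\<^sup>2) \<in> borel_measurable M" "(\<lambda>\<omega>. 2 * \<epsilon>\<^sup>2 * (W t \<omega> - W s \<omega>)\<^sup>2) \<in> borel_measurable M"
        using wm[OF st(1)] wm[OF t0] Wm[OF st(1)] Wm[OF t0] by auto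
      have int: "integrable M (\<lambda>\<omega>. 2 * \<epsilon>\<^sup>2 * (W t \<omega> - W s \<omega>)\<^sup>2)" using bm(2)[OF _ st] by simp
      then show "integrable M (\<lambda>\<omega>. (w t \<omega> - w s \<omega>)\<^sup>2)"
        using integrable_cong_AE[OF sqm(2,1) sq] by simp
      have "expectation (\<lambda>\<omega>. (w t \<omega> - w s \<omega>)\<^sup>2) = expectation (\<lambda>\<omega>. 2 * \<epsilon>\<^sup>2 * (W t \<omega> - W s \<omega>)\<^sup>2)"
        using integral_cong_AE[OF sqm(2,1) sq] by simp
      then show "expectation (\<lambda>\<omega>. (w t \<omega> - w s \<omega>)\<^sup>2) = 2 * \<epsilon>\<^sup>2 * (t - s)" using bm(3)[OF _ st] by simp
    }
    fix t e :: real assume t: "0 \<le> t" and e: "0 < e"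
    define S where "S n p \<omega> = (\<Sum>i<n. (g (p i) \<omega> + g (p (Suc i)) \<omega>) / 2 * (\<i> * complex_of_real (w (p (Suc i)) \<omega> - w (p i) \<omega>)))
        - (g t \<omega> - x - integral {0..t} (\<lambda>s. complex_of_real K * (1 - (g s \<omega>)\<^sup>2)))" for n p \<omega>
    have I_meas: "I t \<in> borel_measurable M" using I(1)[OF t] by (simp add: has_stratonovich_integral_def)
    \<comment> \<open>One third for the deviation threshold and one for its probability, so that the
      final inequality is strict.\<close>
    have e3: "0 < e / 3" using e by simp
    from I(1)[OF t, unfolded has_stratonovich_integral_def, THEN conjunct2, THEN conjunct2, THEN spec, THEN mp, OF e3, THEN spec, THEN mp, OF e3]
    obtain \<delta> where \<delta>: "\<delta> > 0" "\<forall>n p. is_partition t n p \<and> (\<forall>i<n. p (Suc i) - p i < \<delta>) \<longrightarrow>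
        prob {\<omega> \<in> space M. e / 3 < dist (trapezoidal_sum (\<lambda>s \<omega>. \<sigma> (h s \<omega>)) W n p \<omega>) (I t \<omega>)} < e / 3"
      by (elim exE conjE)
    have "expectation (\<lambda>\<omega>. min 1 (cmod (S n p \<omega>))) < e" if p: "is_partition t n p" "\<forall>i<n. p (Suc i) - p i < \<delta>" for n p
    proof -
      have p_nonneg: "0 \<le> p i" if "i \<le> n" for i
        using that
      proof (induction i)
        case (Suc i)
        then have "p i \<le> p (Suc i)" using p(1) by (simp add: is_partition_def)
        then show ?case using Suc by simp
      qed (use p(1) in \<open>simp add: is_partition_def\<close>)
      define X where "X \<omega> = trapezoidal_sum (\<lambda>s \<omega>. \<sigma> (h s \<omega>)) W n p \<omega> - I t \<omega>" for \<omega>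
      have Xm: "X \<in> borel_measurable M"
        unfolding X_def trapezoidal_sum_def \<sigma>_def using I_meas hm[OF p_nonneg] Wm[OF p_nonneg]
        by (intro borel_measurable_diff borel_measurable_sum borel_measurable_times borel_measurable_divide borel_measurable_add borel_measurable_const borel_measurable_of_real) auto
      have XS: "AE \<omega> in M. X \<omega> = S n p \<omega>"
        using A_AE I(2)[OF t]
      proof eventually_elim
        case (elim \<omega>)
        have "continuous_on {0..t} (\<lambda>s. b (h s \<omega>))"
          unfolding b_def by (intro continuous_intros continuous_on_subset[OF A_path(2)[OF elim(1)]]) auto
        then have "(LINT s:{0..t}|lborel. b (h s \<omega>)) = integral {0..t} (\<lambda>s. b (h s \<omega>))"
          by (intro set_borel_integral_eq_integral(2) borel_integrable_atLeastAtMost')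
        then have "I t \<omega> = g t \<omega> - x - integral {0..t} (\<lambda>s. complex_of_real K * (1 - (g s \<omega>)\<^sup>2))"
          using elim A_path(4)[OF elim(1)] by (simp add: g_def b_def)
        \<comment> \<open>The real factor \<open>sqrt 2 * \<epsilon>\<close> moves from the
          coefficient \<open>\<sigma>\<close> into the integrator \<open>w\<close>.\<close>
        moreover have "trapezoidal_sum (\<lambda>s \<omega>. \<sigma> (h s \<omega>)) W n p \<omega> =
          (\<Sum>i<n. (g (p i) \<omega> + g (p (Suc i)) \<omega>) / 2 * (\<i> * complex_of_real (w (p (Suc i)) \<omega> - w (p i) \<omega>)))"
          unfolding trapezoidal_sum_def \<sigma>_def g_def w_def using elim(1) by (intro sum.cong) (auto simp: field_simps)
        ultimately show ?case by (simp add: X_def S_def)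
      qed
      show ?thesis
      \<comment> \<open>Without integrability the Bochner integral has the default value 0, which is
        below \<open>e\<close>; in the other case integrability supplies the measurability that the
        change from \<open>S n p\<close> to \<open>X\<close> uses.\<close>
      proof (cases "integrable M (\<lambda>\<omega>. min 1 (cmod (S n p \<omega>)))")
        case True
        have "expectation (\<lambda>\<omega>. min 1 (cmod (S n p \<omega>))) = expectation (\<lambda>\<omega>. min 1 (cmod (X \<omega>)))"
        proof (rule integral_cong_AE)
          show "AE \<omega> in M. min 1 (cmod (S n p \<omega>)) = min 1 (cmod (X \<omega>))" using XS by eventually_elim simp
        qed (use True Xm in auto)
        also have "\<dots> \<le> e / 3 + prob {\<omega> \<in> space M. e / 3 < cmod (X \<omega>)}"
          using e by (intro expectation_min_one_norm_le Xm) auto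
        also have "\<dots> \<le> e / 3 + e / 3" using \<delta>(2)[rule_format, OF conjI[OF p]] by (simp add: X_def dist_norm)
        finally show ?thesis using e by simp
      qed (use e in \<open>simp add: not_integrable_integral_eq\<close>)
    qed
    then show "\<exists>\<delta>>0. \<forall>n p. is_partition t n p \<and> (\<forall>i<n. p (Suc i) - p i < \<delta>) \<longrightarrow>
      expectation (\<lambda>\<omega>. min 1 (cmod ((\<Sum>i<n. (g (p i) \<omega> + g (p (Suc i)) \<omega>) / 2 * (\<i> * complex_of_real (w (p (Suc i)) \<omega> - w (p i) \<omega>)))
        - (g t \<omega> - x - integral {0..t} (\<lambda>s. complex_of_real K * (1 - (g s \<omega>)\<^sup>2)))))) < e"
      unfolding S_def using \<delta>(1) by blast
  qed
  show ?thesis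
    using modulus_tendsto_1 A_AE by eventually_elim (simp add: g_def)
qed

end
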